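(* Assume that $\mathcal Y$ is the $1$-dimensional torus $\mathbb T^1=\mathbb R/\mathbb Z$ (so $A(y),B(y)\in\mathbb R$). Let $$M:=\max_{y\in\mathcal Y}\left(k^y-\frac{B(y)^2}{4A(y)}\right),\qquad \gamma:=\int_0^1\frac{B(y)}{2A(y)}\,dy,$$ and let $j:[M,+\infty)\to[j(M),+\infty)$ be the bijection $$j:k\mapsto\int_0^1\sqrt{\frac{k-k^y+\frac{B(y)^2}{4A(y)}}{A(y)}}\,dy.$$ Then $k_\varepsilon$ converges as $\varepsilon\to0$ and: 1. If $|\gamma|\le j(M)$, then $\lim_{\varepsilon\to0}k_\varepsilon=M$; 2. If $|\gamma|\ge j(M)$, then $\lim_{\varepsilon\to0}k_\varepsilon=j^{-1}(|\gamma|)$.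
   Context: Let $p\geq1$ and $\alpha\in(0,1)$; here $n=1$. $\mathcal Y=\mathbb T^1=\mathbb R/\mathbb Z$; $\mathcal Z$ is either the torus $\mathbb T^p=\mathbb R^p/\mathbb Z^p$ or an open bounded domain in $\mathbb R^p$ with $\mathcal C^{2,\alpha}$ boundary. Set $\mathcal W=\mathcal Y\times\mathcal Z$; if $\partial\mathcal W\neq\emptyset$, $\nu$ is the outward unit normal on $\partial\mathcal W$; if $\partial\mathcal Z\ne\emptyset$, $\nu_2$ is the outward unit normal on $\partial\mathcal Z$. Boundary conditions are required only on nonempty boundaries. Coefficients: $A\in\mathcal C^{2,\alpha}(\mathcal Y,\mathbb R)$, $a\in\mathcal C^{2,\alpha}(\overline{\mathcal Z},M_p(\mathbb R))$ with $a$ symmetric-matrix valued, both uniformly elliptic (there are constants $\overline A>\underline A>0$, $\overline a>\underline a>0$ with $\underline A\le A(y)\le\overline A$ and $\underline a|\xi'|^2\le\xi'\cdot a(z)\xi'\le\overline a|\xi'|^2$ for all $y\in\mathcal Y$, $z\in\overline{\mathcal Z}$, $\xi'\in\mathbb R^p$); $B\in\mathcal C^{1,\alpha}(\mathcal Y,\mathbb R)$, $b\in\mathcal C^{1,\alpha}(\overline{\mathcal Z},\mathbb R^p)$; $c\in\mathcal C^{0,1}(\overline{\mathcal W})$ (Lipschitz). Thus $A,B$ depend only on $y$, $a,b$ only on $z$, and $c$ on $(y,z)$. If $\partial\mathcal W\neq\emptyset$, assume $\begin{pmatrix}B\\ b\end{pmatrix}\cdot\nu=0$ on $\partial\mathcal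 W$. Let $\mathcal A=\begin{pmatrix}A&0\\0&a\end{pmatrix}$. Operators: $\mathcal L_y^\varepsilon\phi=\varepsilon^2\nabla_y\cdot(A\nabla_y\phi)+\varepsilon\nabla_y\cdot(\phi B)$ and $\mathcal L_z\phi=\nabla_z\cdot(a\nabla_z\phi)+\nabla_z\cdot(\phi b)$. Global eigenvalue problem: for $\varepsilon>0$, $(\varphi_\varepsilon,k_\varepsilon)\in\mathcal C^{2,\alpha}(\mathcal W)\times\mathbb R$ is the (unique) solution of $(\mathcal L_y^\varepsilon+\mathcal L_z+c)\varphi_\varepsilon=k_\varepsilon\varphi_\varepsilon$ in $\mathcal W$, $\varphi_\varepsilon>0$ in $\mathcal W$, $\nu\cdot\mathcal A\nabla\varphi_\varepsilon=0$ on $\partial\mathcal W$, $\int_{\mathcal W}\varphi_\varepsilon=1$. Local eigenvalue problem: for $y_0\in\mathcal Y$, $(\psi^{y_0},k^{y_0})\in\mathcal C^{2,\alpha}(\mathcal Z)\times\mathbb R$ is the (unique) solution of $(\mathcal L_z+c(y_0,\cdot))\psi^{y_0}=k^{y_0}\psi^{y_0}$ in $\mathcal Z$, $\psi^{y_0}>0$ in $\mathcal Z$, $\nu_2\cdot a\nabla\psi^{y_0}=0$ on $\partial\mathcal Z$, $\int_{\mathcal Z}\psi^{y_0}=1$. *)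

theory Defs
  imports "HOL-Analysis.Analysis"
begin

section \<open>Tori and bounded domains\<close>

text \<open>
  A function on \<open>\<real>/\<int>\<close> or \<open>\<real>\<^sup>p/\<int>\<^sup>p\<close> is represented by its periodic lift to \<open>\<real>\<close> or \<open>\<real>\<^sup>p\<close>.
  The cross-section \<open>Z\<close> is either a torus, lifted to the whole space, or a subset of the
  space.  The lift of the cylinder \<open>Y \<times> Z\<close> with \<open>Y = \<real>/\<int>\<close> is \<open>UNIV \<times> lift Z\<close>.  A lifted torus
  has empty frontier, so boundary conditions are void for it.  Functions on a domain are only
  ever constrained on its closure.
\<close>

datatype 'a section_space = Torus | Domain "'a set"

fun lift :: "'a section_space \<Rightarrow> 'a set" where
  "lift Torus = UNIV"
| "lift (Domain \<Omega>) = \<Omega>"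

text \<open>The set over which integrals over \<open>Z\<close> are taken.\<close>

fun cell :: "'a::euclidean_space section_space \<Rightarrow> 'a set" where
  "cell Torus = cbox 0 One"
| "cell (Domain \<Omega>) = \<Omega>"

fun periodic_section :: "'a::euclidean_space section_space \<Rightarrow> ('a \<Rightarrow> 'b) \<Rightarrow> bool" where
  "periodic_section Torus f \<longleftrightarrow> (\<forall>z. \<forall>e\<in>Basis. f (z + e) = f z)"
| "periodic_section (Domain \<Omega>) f \<longleftrightarrow> True"

definition periodic1 :: "(real \<Rightarrow> 'b) \<Rightarrow> bool" where
  "periodic1 f \<longleftrightarrow> (\<forall>y. f (y + 1) = f y)"

definition periodic_cyl :: "'a::euclidean_space section_space \<Rightarrow> (real \<times> 'a \<Rightarrow> 'b) \<Rightarrow> bool" where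
  "periodic_cyl Z f \<longleftrightarrow>
     (\<forall>z\<in>closure (lift Z). periodic1 (\<lambda>y. f (y, z))) \<and>
     (\<forall>y. periodic_section Z (\<lambda>z. f (y, z)))"

section \<open>Hoelder spaces\<close>

text \<open>
  Membership in \<open>C\<^sup>k\<^sup>,\<^sup>\<alpha>(S)\<close>, used for closures of domains with smooth boundary, for the whole
  space with periodic functions, and for balls.  Derivatives are taken relative to \<open>S\<close>, so that
  for a closed \<open>S\<close> regularity holds up to the boundary; \<open>D e\<close> is the partial derivative in
  direction \<open>e\<close>.  In these uses the Hoelder bound on the derivatives of top order entails
  boundedness of all lower-order ones (for periodic functions, by periodicity).
\<close>

primrec holder_space ::
  "nat \<Rightarrow> real \<Rightarrow> 'a::euclidean_space set \<Rightarrow> ('a \<Rightarrow> 'b::real_normed_vector) \<Rightarrow> bool" where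
  "holder_space 0 \<alpha> S f \<longleftrightarrow>
     (\<exists>C. \<forall>x\<in>S. \<forall>y\<in>S. norm (f x - f y) \<le> C * dist x y powr \<alpha>)"
| "holder_space (Suc k) \<alpha> S f \<longleftrightarrow>
     (\<exists>D. (\<forall>x\<in>S. (f has_derivative (\<lambda>h. \<Sum>e\<in>Basis. (h \<bullet> e) *\<^sub>R D e x)) (at x within S)) \<and>
          (\<forall>e\<in>Basis. holder_space k \<alpha> S (D e)))"

section \<open>Boundary regularity and the outward normal\<close>

text \<open>
  Near \<open>x\<close>, the set \<open>S\<close> is the part of a ball strictly above a graph, in orthonormal coordinates
  whose last axis is \<open>e\<close>; \<open>g\<close> is the graph function, extended constantly along \<open>e\<close>.
\<close>

definition boundary_chart ::
  "'a::euclidean_space set \<Rightarrow> 'a \<Rightarrow> real \<Rightarrow> 'a \<Rightarrow> ('a \<Rightarrow> real) \<Rightarrow> bool" where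
  "boundary_chart S x r e g \<longleftrightarrow>
     r > 0 \<and> norm e = 1 \<and> (\<forall>w t. g (w + t *\<^sub>R e) = g w) \<and>
     S \<inter> ball x r = {w \<in> ball x r. g w < w \<bullet> e}"

definition holder_boundary :: "nat \<Rightarrow> real \<Rightarrow> 'a::euclidean_space set \<Rightarrow> bool" where
  "holder_boundary k \<alpha> S \<longleftrightarrow>
     (\<forall>x\<in>frontier S. \<exists>r e g. boundary_chart S x r e g \<and> holder_space k \<alpha> (ball x r) g)"

text \<open>
  The set is \<open>{w. g w - w \<bullet> e < 0}\<close> near \<open>x\<close>, so the outward unit normal is the normalised
  gradient of \<open>w \<mapsto> g w - w \<bullet> e\<close> at \<open>x\<close>.
\<close>

definition outward_unit_normal :: "'a::euclidean_space set \<Rightarrow> 'a \<Rightarrow> 'a \<Rightarrow> bool" where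
  "outward_unit_normal S x \<nu> \<longleftrightarrow>
     x \<in> frontier S \<and> norm \<nu> = 1 \<and>
     (\<exists>r e g s. boundary_chart S x r e g \<and> s > 0 \<and>
        ((\<lambda>w. g w - w \<bullet> e) has_derivative (\<lambda>h. s * (\<nu> \<bullet> h))) (at x))"

fun admissible_section :: "real \<Rightarrow> 'a::euclidean_space section_space \<Rightarrow> bool" where
  "admissible_section \<alpha> Torus \<longleftrightarrow> True"
| "admissible_section \<alpha> (Domain \<Omega>) \<longleftrightarrow>
     open \<Omega> \<and> connected \<Omega> \<and> \<Omega> \<noteq> {} \<and> bounded \<Omega> \<and> holder_boundary 2 \<alpha> \<Omega>"

section \<open>Differential operators\<close>

text \<open>
  Like \<^const>\<open>frechet_derivative\<close>, these take a filter, so that \<open>at x within closure S\<close> gives the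
  gradient at boundary points.
\<close>

definition gradient :: "('a::euclidean_space \<Rightarrow> real) \<Rightarrow> 'a filter \<Rightarrow> 'a" where
  "gradient f F = (\<Sum>e\<in>Basis. frechet_derivative f F e *\<^sub>R e)"

definition divergence :: "('a::euclidean_space \<Rightarrow> 'a) \<Rightarrow> 'a filter \<Rightarrow> real" where
  "divergence V F = (\<Sum>e\<in>Basis. frechet_derivative V F e \<bullet> e)"

definition L_y :: "(real \<Rightarrow> real) \<Rightarrow> (real \<Rightarrow> real) \<Rightarrow> real \<Rightarrow> (real \<Rightarrow> real) \<Rightarrow> real \<Rightarrow> real" where
  "L_y A B \<epsilon> u y =
     \<epsilon>\<^sup>2 * deriv (\<lambda>s. A s * deriv u s) y + \<epsilon> * deriv (\<lambda>s. u s * B s) y"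

definition L_z ::
  "(real^'n \<Rightarrow> real^'n^'n) \<Rightarrow> (real^'n \<Rightarrow> real^'n) \<Rightarrow> (real^'n \<Rightarrow> real) \<Rightarrow> real^'n \<Rightarrow> real" where
  "L_z a b u z =
     divergence (\<lambda>x. a x *v gradient u (at x)) (at z) + divergence (\<lambda>x. u x *\<^sub>R b x) (at z)"

text \<open>Multiplication by the block matrix with diagonal blocks \<open>A y\<close> and \<open>a z\<close>.\<close>

definition block_diag_mult ::
  "(real \<Rightarrow> real) \<Rightarrow> (real^'n \<Rightarrow> real^'n^'n) \<Rightarrow> real \<times> (real^'n) \<Rightarrow> real \<times> (real^'n) \<Rightarrow> real \<times> (real^'n)"
where
  "block_diag_mult A a w \<xi> = (A (fst w) * fst \<xi>, a (snd w) *v snd \<xi>)"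

section \<open>The eigenvalue problems\<close>

definition local_eigenpair ::
  "real \<Rightarrow> (real^'n) section_space \<Rightarrow> (real^'n \<Rightarrow> real^'n^'n) \<Rightarrow> (real^'n \<Rightarrow> real^'n) \<Rightarrow>
   (real \<times> (real^'n) \<Rightarrow> real) \<Rightarrow> real \<Rightarrow> (real^'n \<Rightarrow> real) \<Rightarrow> real \<Rightarrow> bool" where
  "local_eigenpair \<alpha> Z a b c y0 \<psi> k \<longleftrightarrow>
     holder_space 2 \<alpha> (closure (lift Z)) \<psi> \<and> periodic_section Z \<psi> \<and>
     (\<forall>z\<in>lift Z. L_z a b \<psi> z + c (y0, z) * \<psi> z = k * \<psi> z) \<and>
     (\<forall>z\<in>lift Z. \<psi> z > 0) \<and>
     (\<forall>z \<nu>. outward_unit_normal (lift Z) z \<nu> \<longrightarrow>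
        \<nu> \<bullet> (a z *v gradient \<psi> (at z within closure (lift Z))) = 0) \<and>
     (\<psi> has_integral 1) (cell Z)"

definition global_eigenpair ::
  "real \<Rightarrow> (real^'n) section_space \<Rightarrow> (real \<Rightarrow> real) \<Rightarrow> (real^'n \<Rightarrow> real^'n^'n) \<Rightarrow>
   (real \<Rightarrow> real) \<Rightarrow> (real^'n \<Rightarrow> real^'n) \<Rightarrow> (real \<times> (real^'n) \<Rightarrow> real) \<Rightarrow> real \<Rightarrow>
   (real \<times> (real^'n) \<Rightarrow> real) \<Rightarrow> real \<Rightarrow> bool" where
  "global_eigenpair \<alpha> Z A a B b c \<epsilon> \<phi> k \<longleftrightarrow>
     (let W = UNIV \<times> lift Z in
       holder_space 2 \<alpha> (closure W) \<phi> \<and> periodic_cyl Z \<phi> \<and>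
       (\<forall>(y, z)\<in>W. L_y A B \<epsilon> (\<lambda>s. \<phi> (s, z)) y + L_z a b (\<lambda>x. \<phi> (y, x)) z + c (y, z) * \<phi> (y, z)
          = k * \<phi> (y, z)) \<and>
       (\<forall>w\<in>W. \<phi> w > 0) \<and>
       (\<forall>w \<nu>. outward_unit_normal W w \<nu> \<longrightarrow>
          \<nu> \<bullet> block_diag_mult A a w (gradient \<phi> (at w within closure W)) = 0) \<and>
       (\<phi> has_integral 1) ({0..1} \<times> cell Z))"

section \<open>The limit\<close>

text \<open>In the following, \<open>\<kappa> y\<close> is the local eigenvalue at \<open>y\<close>.\<close>

definition M_const :: "(real \<Rightarrow> real) \<Rightarrow> (real \<Rightarrow> real) \<Rightarrow> (real \<Rightarrow> real) \<Rightarrow> real" where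
  "M_const A B \<kappa> = (SUP y. \<kappa> y - (B y)\<^sup>2 / (4 * A y))"

definition gamma_const :: "(real \<Rightarrow> real) \<Rightarrow> (real \<Rightarrow> real) \<Rightarrow> real" where
  "gamma_const A B = integral {0..1} (\<lambda>y. B y / (2 * A y))"

definition j_fun :: "(real \<Rightarrow> real) \<Rightarrow> (real \<Rightarrow> real) \<Rightarrow> (real \<Rightarrow> real) \<Rightarrow> real \<Rightarrow> real" where
  "j_fun A B \<kappa> k = integral {0..1} (\<lambda>y. sqrt ((k - \<kappa> y + (B y)\<^sup>2 / (4 * A y)) / A y))"

end

theory Submission
  imports Defs
begin

text \<open>
  Substituting \<open>\<phi> = e\<^bsup>S(y)/\<epsilon>\<^esup> \<psi>\<^bsup>y\<^esup>(z)\<close> into the global problem and keeping the terms of order one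
  gives the Hamilton-Jacobi equation \<open>H(y, S'(y)) = k\<close> on the circle, with
  \<open>H(y, p) = A(y) p\<^sup>2 + B(y) p + \<kappa>(y)\<close>.  Its minimum over \<open>p\<close> is \<open>V(y) = \<kappa>(y) - B(y)\<^sup>2/(4 A(y))\<close>, and
  at a level \<open>k \<ge> M = max V\<close> its solutions are
  \<open>p = - B/(2A) \<plusminus> sqrt ((k - V)/A)\<close>.  A periodic phase \<open>S\<close> needs momentum of mean zero, that is,
  \<open>j(k) = \<bar>\<gamma>\<bar>\<close>.  If \<open>\<bar>\<gamma>\<bar> > j(M)\<close> this selects \<open>k\<close>; if \<open>\<bar>\<gamma>\<bar> \<le> j(M)\<close> the limit is \<open>M\<close>.

  The eigenvalue is estimated from both sides by a maximum principle.  If a positive function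
  \<open>v\<close> satisfies the Neumann condition and \<open>L v \<ge> l v\<close>, then \<open>k\<^sub>\<epsilon> \<ge> l\<close>: where \<open>v/\<phi>\<^sub>\<epsilon>\<close> attains its
  maximum \<open>t\<close>, the function \<open>t \<phi>\<^sub>\<epsilon> - v \<ge> 0\<close> touches zero, and \<open>k\<^sub>\<epsilon> < l\<close> would make it
  a strict supersolution of a linear elliptic inequality there.  In the interior this contradicts
  the second-order conditions at a minimum, and on the boundary it contradicts the Hopf lemma
  combined with the Neumann condition (lemmas \<open>strict_positivity\<close> and \<open>comparison\<close>).  Upper bounds
  follow in the same way from minima of the ratio; a sign \<open>\<sigma> = \<plusminus>1\<close> treats both at once.

  Since \<open>c\<close> is only Lipschitz, \<open>\<psi>\<^bsup>y\<^esup>\<close> need not be twice differentiable in \<open>y\<close>; the test function is a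
  maximum (or minimum) of finitely many functions \<open>e\<^bsup>S\<^sub>i(y)/\<epsilon>\<^esup> \<psi>\<^bsup>x\<^sub>i\<^esup>(z)\<close>, each used only in a window
  around \<open>x\<^sub>i\<close>.  There \<open>\<psi>\<^bsup>x\<^sub>i\<^esup>\<close> is frozen, at the cost of the Lipschitz oscillation of \<open>c\<close>, and
  \<open>S\<^sub>i\<close> is the first-order Taylor polynomial of \<open>S\<close> bent by a quadratic term, which makes each piece lose against
  its neighbours at the edge of its window by an exponentially large factor.  In this way
  every periodic \<open>C\<^sup>1\<close> phase with \<open>H(y, S') < l\<close> gives \<open>k\<^sub>\<epsilon> \<le> l\<close> for small \<open>\<epsilon>\<close>, and with
  \<open>H(y, S') > l\<close> gives \<open>k\<^sub>\<epsilon> \<ge> l\<close> (lemma \<open>eventually_comparison_of_C1_phase\<close>).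

  The phases are as follows.  For \<open>l > M\<close> with \<open>j(l) > \<bar>\<gamma>\<bar>\<close>, the momentum
  \<open>- B/(2A) + \<theta> sqrt ((l - V)/A)\<close> with \<open>\<theta> = \<gamma>/j(l)\<close> has mean zero and Hamiltonian below \<open>l\<close>.  At the
  level with \<open>j(l) = \<bar>\<gamma>\<bar>\<close>, the choice \<open>\<theta> = \<plusminus>1\<close> has Hamiltonian equal to \<open>l\<close>.  The bound
  \<open>liminf k\<^sub>\<epsilon> \<ge> M\<close> comes from \<open>H \<ge> V\<close>: a steep concave parabola \<open>S\<close> centred at a maximum point of
  \<open>V\<close> has \<open>H(y, S')\<close> close to or above \<open>M\<close> everywhere (lemma
  \<open>eventually_ge_below_pointwise_bound\<close>).
\<close>

section \<open>The trace of a product of semidefinite matrices\<close>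

text \<open>
  Completing the square in the variable \<open>k\<close> splits \<open>Q\<close> into a rank-one matrix and the Schur
  complement of the entry \<open>Q k k\<close>.  Paired with \<open>H\<close>, the rank-one part gives a value of the
  quadratic form of \<open>H\<close>; the Schur complement is again positive definite and lives on the
  remaining indices, so induction applies.
\<close>

lemma sum_posdef_mult_psd_nonneg:
  fixes Q H :: "'i \<Rightarrow> 'i \<Rightarrow> real"
  assumes "finite I"
    and "\<And>i j. i \<in> I \<Longrightarrow> j \<in> I \<Longrightarrow> Q i j = Q j i"
    and "\<And>x. \<exists>i\<in>I. x i \<noteq> 0 \<Longrightarrow> 0 < (\<Sum>i\<in>I. \<Sum>j\<in>I. Q i j * x i * x j)"
    and "\<And>x. 0 \<le> (\<Sum>i\<in>I. \<Sum>j\<in>I. H i j * x i * x j)"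
  shows "0 \<le> (\<Sum>i\<in>I. \<Sum>j\<in>I. Q i j * H i j)"
  using assms
proof (induction I arbitrary: Q rule: finite_induct)
  case empty
  then show ?case by simp
next
  case (insert k I)
  note sym = insert.prems(1) and pos = insert.prems(2) and psd = insert.prems(3)
  define J where "J = insert k I"
  have [simp]: "finite J" "finite I" "k \<in> J" and kI: "k \<notin> I" and IJ: "I \<subseteq> J"
    using insert.hyps by (auto simp: J_def)
  have qkk: "Q k k > 0"
  proof -
    have "0 < (\<Sum>i\<in>J. \<Sum>j\<in>J. Q i j * (if i = k then 1 else 0) * (if j = k then 1 else 0))"
      using pos[of "\<lambda>i. if i = k then 1 else 0"] by (simp add: J_def)
    also have "\<dots> = (\<Sum>i\<in>J. \<Sum>j\<in>J. if j = k then (if i = k then Q i j else 0) else 0)"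
      by (intro sum.cong refl) auto
    also have "\<dots> = Q k k"
      by (simp add: sum.delta)
    finally show ?thesis .
  qed
  define Q' where "Q' = (\<lambda>i j. Q i j - Q i k * Q k j / Q k k)"
  have Q'0: "Q' k j = 0" "Q' j k = 0" for j
    using qkk by (auto simp: Q'_def)
  have restr: "(\<Sum>i\<in>J. \<Sum>j\<in>J. Q' i j * F i j) = (\<Sum>i\<in>I. \<Sum>j\<in>I. Q' i j * F i j)" for F
    using insert.hyps by (simp add: J_def Q'0)
  have split: "(\<Sum>i\<in>J. \<Sum>j\<in>J. Q i j * F i j) =
      (\<Sum>i\<in>I. \<Sum>j\<in>I. Q' i j * F i j) + (\<Sum>i\<in>J. \<Sum>j\<in>J. F i j * Q i k * Q k j) / Q k k" for F
  proof -
    have "(\<Sum>i\<in>J. \<Sum>j\<in>J. Q i j * F i j) =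
        (\<Sum>i\<in>J. \<Sum>j\<in>J. Q' i j * F i j + F i j * Q i k * Q k j / Q k k)"
      by (intro sum.cong refl) (simp add: Q'_def algebra_simps)
    then show ?thesis
      by (simp add: sum.distrib restr sum_divide_distrib)
  qed
  have "0 \<le> (\<Sum>i\<in>I. \<Sum>j\<in>I. Q' i j * H i j)"
  proof (rule insert.IH)
    show "Q' i j = Q' j i" if "i \<in> I" "j \<in> I" for i j
      using that sym[of i j] sym[of i k] sym[of j k] by (simp add: Q'_def)
    show "0 < (\<Sum>i\<in>I. \<Sum>j\<in>I. Q' i j * x i * x j)" if x: "\<exists>i\<in>I. x i \<noteq> 0" for x
    proof -
      \<comment> \<open>The value at \<open>k\<close> that makes the completed square vanish.\<close>
      define s where "s = (\<Sum>i\<in>I. Q i k * x i)"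
      define x' where "x' = (\<lambda>i. if i = k then - s / Q k k else x i)"
      have [simp]: "x' i = x i" if "i \<in> I" for i using that kI by (auto simp: x'_def)
      have "(\<Sum>i\<in>J. Q i k * x' i) = 0"
        using insert.hyps qkk by (simp add: J_def s_def[symmetric]) (simp add: x'_def)
      moreover have "(\<Sum>j\<in>J. Q k j * x' j) = (\<Sum>i\<in>J. Q i k * x' i)"
        using sym by (intro sum.cong refl) (auto simp: J_def)
      moreover have "(\<Sum>i\<in>J. \<Sum>j\<in>J. (x' i * x' j) * Q i k * Q k j) =
          (\<Sum>i\<in>J. Q i k * x' i) * (\<Sum>j\<in>J. Q k j * x' j)"
        by (simp add: sum_product mult_ac)
      ultimately have "(\<Sum>i\<in>J. \<Sum>j\<in>J. Q i j * (x' i * x' j)) =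
          (\<Sum>i\<in>I. \<Sum>j\<in>I. Q' i j * (x' i * x' j))"
        using split[of "\<lambda>i j. x' i * x' j"] by simp
      also have "\<dots> = (\<Sum>i\<in>I. \<Sum>j\<in>I. Q' i j * x i * x j)"
        by (intro sum.cong refl) (simp add: mult_ac)
      finally have eq: "(\<Sum>i\<in>I. \<Sum>j\<in>I. Q' i j * x i * x j) =
          (\<Sum>i\<in>J. \<Sum>j\<in>J. Q i j * x' i * x' j)" by (simp add: mult.assoc)
      have "\<exists>i\<in>J. x' i \<noteq> 0" using x IJ by force
      then show ?thesis using pos[of x'] unfolding eq by (simp add: J_def)
    qed
    show "0 \<le> (\<Sum>i\<in>I. \<Sum>j\<in>I. H i j * x i * x j)" for x
    proof -
      define x' where "x' = (\<lambda>i. if i = k then 0 else x i)"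
      have "(\<Sum>i\<in>J. \<Sum>j\<in>J. H i j * x' i * x' j) = (\<Sum>i\<in>I. \<Sum>j\<in>I. H i j * x' i * x' j)"
        using insert.hyps by (simp add: J_def) (simp add: x'_def)
      also have "\<dots> = (\<Sum>i\<in>I. \<Sum>j\<in>I. H i j * x i * x j)"
        using kI by (intro sum.cong refl) (auto simp: x'_def)
      finally show ?thesis using psd[of x'] by (simp add: J_def)
    qed
  qed
  moreover have "0 \<le> (\<Sum>i\<in>J. \<Sum>j\<in>J. H i j * Q i k * Q k j)"
  proof -
    have "(\<Sum>i\<in>J. \<Sum>j\<in>J. H i j * Q i k * Q k j) = (\<Sum>i\<in>J. \<Sum>j\<in>J. H i j * Q i k * Q j k)"
      using sym by (intro sum.cong refl) (auto simp: J_def)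
    then show ?thesis using psd[of "\<lambda>i. Q i k"] by (simp add: J_def)
  qed
  ultimately show ?case
    using split[of H] qkk by (simp add: J_def)
qed

text \<open>
  This is the sign of the second-order term \<open>tr (P D\<^sup>2u)\<close> at a minimum of \<open>u\<close>.
\<close>

lemma trace_posdef_comp_psd_nonneg:
  fixes P H :: "'a::euclidean_space \<Rightarrow> 'a"
  assumes "linear P" and "\<And>x y. P x \<bullet> y = x \<bullet> P y" and "\<And>x. x \<noteq> 0 \<Longrightarrow> 0 < x \<bullet> P x"
    and "linear H" and "\<And>x. 0 \<le> x \<bullet> H x"
  shows "0 \<le> (\<Sum>e\<in>Basis. P e \<bullet> H e)"
proof -
  have expand: "(\<Sum>i\<in>Basis. \<Sum>j\<in>Basis. (F i \<bullet> j) * x i * x j) =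
      (\<Sum>i\<in>Basis. x i *\<^sub>R i) \<bullet> F (\<Sum>i\<in>Basis. x i *\<^sub>R i)" if "linear F" for F :: "'a \<Rightarrow> 'a" and x
  proof -
    have "F (\<Sum>i\<in>Basis. x i *\<^sub>R i) = (\<Sum>i\<in>Basis. x i *\<^sub>R F i)"
      by (simp only: linear_sum[OF that] linear_cmul[OF that])
    then have "(\<Sum>i\<in>Basis. x i *\<^sub>R i) \<bullet> F (\<Sum>i\<in>Basis. x i *\<^sub>R i) =
        (\<Sum>i\<in>Basis. x i *\<^sub>R F i) \<bullet> (\<Sum>i\<in>Basis. x i *\<^sub>R i)"
      by (rule trans[OF arg_cong[where f="\<lambda>v. _ \<bullet> v"] inner_commute])
    also have "\<dots> = (\<Sum>i\<in>Basis. \<Sum>j\<in>Basis. (F i \<bullet> j) * x i * x j)"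
      unfolding inner_sum_left unfolding inner_sum_right
      by (intro sum.cong refl) (simp add: mult.commute mult.left_commute)
    finally show ?thesis by (rule sym)
  qed
  have "0 \<le> (\<Sum>i\<in>Basis. \<Sum>j\<in>Basis. (P i \<bullet> j) * (H i \<bullet> j))"
  proof (rule sum_posdef_mult_psd_nonneg)
    show "P i \<bullet> j = P j \<bullet> i" for i j
      using assms(2)[of i j] by (simp add: inner_commute)
    show "0 < (\<Sum>i\<in>Basis. \<Sum>j\<in>Basis. (P i \<bullet> j) * x i * x j)" if "\<exists>i\<in>Basis. x i \<noteq> 0" for x
    proof -
      have "(\<Sum>i\<in>Basis. x i *\<^sub>R i) \<noteq> (0::'a)"
      proof
        assume 0: "(\<Sum>i\<in>Basis. x i *\<^sub>R i) = (0::'a)"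
        have "x i = 0" if "i \<in> Basis" for i
          using arg_cong[OF 0, of "\<lambda>v. v \<bullet> i"] that by (simp only: inner_sum_left_Basis inner_zero_left)
        with that show False by blast
      qed
      then show ?thesis unfolding expand[OF assms(1)] by (rule assms(3))
    qed
    show "0 \<le> (\<Sum>i\<in>Basis. \<Sum>j\<in>Basis. (H i \<bullet> j) * x i * x j)" for x
      unfolding expand[OF assms(4)] by (rule assms(5))
  qed simp
  also have "\<dots> = (\<Sum>e\<in>Basis. P e \<bullet> H e)"
    by (intro sum.cong refl) (rule euclidean_inner[symmetric])
  finally show ?thesis .
qed

section \<open>Second-order operators at a minimum\<close>

text \<open>
  Gradient and Hessian are explicit arguments, so that a second-order operator at a point is a
  linear function of the value, the gradient and the Hessian there.
\<close>

definition jet2 ::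
  "'a::euclidean_space set \<Rightarrow> ('a \<Rightarrow> real) \<Rightarrow> ('a \<Rightarrow> 'a) \<Rightarrow> ('a \<Rightarrow> 'a \<Rightarrow> 'a) \<Rightarrow> bool" where
  "jet2 S u G H \<longleftrightarrow>
     (\<forall>x\<in>S. (u has_derivative (\<lambda>h. G x \<bullet> h)) (at x) \<and> (G has_derivative H x) (at x))"

text \<open>
  The operator \<open>tr (P D\<^sup>2u) + q \<bullet> \<nabla>u + r u\<close> at one point.
\<close>
definition elliptic_op ::
  "('a::euclidean_space \<Rightarrow> 'a) \<Rightarrow> 'a \<Rightarrow> real \<Rightarrow> real \<Rightarrow> 'a \<Rightarrow> ('a \<Rightarrow> 'a) \<Rightarrow> real" where
  "elliptic_op P q r u g H = (\<Sum>e\<in>Basis. P e \<bullet> H e) + q \<bullet> g + r * u"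

lemma jet2_subset: "jet2 S u G H \<Longrightarrow> T \<subseteq> S \<Longrightarrow> jet2 T u G H"
  by (auto simp: jet2_def)

lemma jet2_lincomb:
  assumes "jet2 S u G H" "jet2 S v G' H'"
  shows "jet2 S (\<lambda>x. s * u x + t * v x) (\<lambda>x. s *\<^sub>R G x + t *\<^sub>R G' x)
      (\<lambda>x h. s *\<^sub>R H x h + t *\<^sub>R H' x h)"
  unfolding jet2_def
proof (intro ballI conjI)
  fix x assume x: "x \<in> S"
  have 1: "(u has_derivative (\<lambda>h. G x \<bullet> h)) (at x)" "(G has_derivative H x) (at x)"
    "(v has_derivative (\<lambda>h. G' x \<bullet> h)) (at x)" "(G' has_derivative H' x) (at x)"
    using assms x by (auto simp: jet2_def)
  show "((\<lambda>x. s * u x + t * v x) has_derivative (\<lambda>h. (s *\<^sub>R G x + t *\<^sub>R G' x) \<bullet> h)) (at x)"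
    using has_derivative_add[OF has_derivative_mult_right[OF 1(1), of s] has_derivative_mult_right[OF 1(3), of t]]
    by (simp add: inner_add_left)
  show "((\<lambda>x. s *\<^sub>R G x + t *\<^sub>R G' x) has_derivative (\<lambda>h. s *\<^sub>R H x h + t *\<^sub>R H' x h)) (at x)"
    by (intro has_derivative_add has_derivative_scaleR_right 1)
qed

lemma elliptic_op_lincomb:
  "elliptic_op P q r (s * u + t * v) (s *\<^sub>R g + t *\<^sub>R g') (\<lambda>h. s *\<^sub>R H h + t *\<^sub>R H' h) =
   s * elliptic_op P q r u g H + t * elliptic_op P q r v g' H'"
  by (simp add: elliptic_op_def inner_add_right sum.distrib sum_distrib_left algebra_simps)

text \<open>
  For the Hessian, restrict to a line through \<open>x\<close>: a negative second derivative would make the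
  first derivative negative just after \<open>x\<close>, and \<open>u\<close> would decrease below its minimum.
\<close>

lemma jet2_minimum:
  fixes u :: "'a::euclidean_space \<Rightarrow> real"
  assumes S: "open S" "x \<in> S" and jet: "jet2 S u G H" and min: "\<And>y. y \<in> S \<Longrightarrow> u x \<le> u y"
  shows "G x = 0" and "0 \<le> \<xi> \<bullet> H x \<xi>"
proof -
  have "(\<lambda>h. G x \<bullet> h) = (\<lambda>h. 0)"
    using jet S min by (intro differential_zero_maxmin[of x S u]) (auto simp: jet2_def)
  then have "G x \<bullet> G x = 0" by (rule fun_cong)
  then show G0: "G x = 0" by simp
  show "0 \<le> \<xi> \<bullet> H x \<xi>"
  proof (rule ccontr)
    assume neg: "\<not> 0 \<le> \<xi> \<bullet> H x \<xi>"
    define l where "l = (\<lambda>t::real. x + t *\<^sub>R \<xi>)"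
    have l': "(l has_derivative (\<lambda>t. t *\<^sub>R \<xi>)) (at t)" for t
      unfolding l_def by (auto intro!: derivative_eq_intros)
    have l0: "l 0 = x" by (simp add: l_def)
    have "open (l -` S)"
      unfolding l_def by (intro open_vimage S continuous_intros)
    then obtain d where d: "d > 0" "\<And>t. \<bar>t\<bar> < d \<Longrightarrow> l t \<in> S"
      using S(2) l0 unfolding open_dist by (force simp: dist_real_def)
    have g': "((\<lambda>t. u (l t)) has_real_derivative (G (l t) \<bullet> \<xi>)) (at t)" if "l t \<in> S" for t
    proof -
      have "(u has_derivative (\<lambda>h. G (l t) \<bullet> h)) (at (l t))"
        using jet that by (auto simp: jet2_def)
      from has_derivative_compose[OF l' this] show ?thesis
        by (simp add: has_field_derivative_def mult_commute_abs)
    qed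
    have "((\<lambda>t. G (l t)) has_derivative (\<lambda>t. H x (t *\<^sub>R \<xi>))) (at 0)"
      using has_derivative_compose[OF l'[of 0], of G "H x"] jet S(2) l0 by (auto simp: jet2_def)
    then have "((\<lambda>t. G (l t) \<bullet> \<xi>) has_derivative (\<lambda>t. H x (t *\<^sub>R \<xi>) \<bullet> \<xi>)) (at 0)"
      by (rule has_derivative_inner_left)
    moreover have "linear (H x)"
      using jet S(2) by (auto simp: jet2_def intro: has_derivative_linear)
    ultimately have "((\<lambda>t. G (l t) \<bullet> \<xi>) has_real_derivative (\<xi> \<bullet> H x \<xi>)) (at 0)"
      by (simp add: has_field_derivative_def linear_cmul inner_commute mult_commute_abs)
    from DERIV_neg_dec_right[OF this] neg obtain d' where d': "d' > 0"
      "\<And>t. 0 < t \<Longrightarrow> t < d' \<Longrightarrow> G (l t) \<bullet> \<xi> < 0"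
      using l0 G0 by (auto simp: not_le)
    define t where "t = min d d' / 2"
    have t: "0 < t" "t < d" "t < d'" using d d' by (auto simp: t_def)
    have "\<exists>z>0. z < t \<and> u (l t) - u (l 0) = (t - 0) * (G (l z) \<bullet> \<xi>)"
      using t d by (intro MVT2 g') auto
    then obtain z where z: "0 < z" "z < t" "u (l t) - u (l 0) = t * (G (l z) \<bullet> \<xi>)" by auto
    moreover have "t * (G (l z) \<bullet> \<xi>) < 0"
      using d'(2)[of z] z t by (simp add: mult_pos_neg)
    moreover have "u (l 0) \<le> u (l t)" using min d t l0 by simp
    ultimately show False by simp
  qed
qed

definition elliptic_matrix :: "('a::euclidean_space \<Rightarrow> 'a) \<Rightarrow> real \<Rightarrow> bool" where
  "elliptic_matrix P m \<longleftrightarrow>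
     linear P \<and> (\<forall>x y. P x \<bullet> y = x \<bullet> P y) \<and> (\<forall>x. m * (norm x)\<^sup>2 \<le> x \<bullet> P x)"

text \<open>
  The gradient vanishes and the second-order term is nonnegative, so only the zeroth-order term
  remains.  The value \<open>u x\<close> is arbitrary: the interior argument uses the value zero, the Hopf lemma
  a negative value.
\<close>

lemma elliptic_op_at_minimum:
  fixes u :: "'a::euclidean_space \<Rightarrow> real"
  assumes "open S" "x \<in> S" and jet: "jet2 S u G H" and min: "\<And>y. y \<in> S \<Longrightarrow> u x \<le> u y"
    and P: "elliptic_matrix P m" "m > 0"
  shows "r * u x \<le> elliptic_op P q r (u x) (G x) (H x)"
proof -
  have "0 \<le> (\<Sum>e\<in>Basis. P e \<bullet> H x e)"
  proof (rule trace_posdef_comp_psd_nonneg)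
    show "0 < y \<bullet> P y" if "y \<noteq> 0" for y
    proof -
      have "0 < m * (norm y)\<^sup>2" using P(2) that by simp
      also have "\<dots> \<le> y \<bullet> P y" using P(1) by (simp add: elliptic_matrix_def)
      finally show ?thesis .
    qed
    show "linear (H x)"
      using jet assms(2) by (auto simp: jet2_def intro: has_derivative_linear)
    show "0 \<le> \<xi> \<bullet> H x \<xi>" for \<xi> by (rule jet2_minimum(2)[OF assms(1-4)])
  qed (use P in \<open>auto simp: elliptic_matrix_def\<close>)
  moreover have "G x = 0" by (rule jet2_minimum(1)[OF assms(1-4)])
  ultimately show ?thesis by (simp add: elliptic_op_def)
qed

section \<open>The Hopf boundary lemma\<close>

text \<open>
  Stated for a derivative relative to a set, because it is applied at boundary points.
\<close>

lemma directional_derivative_ge: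
  fixes w :: "'a::euclidean_space \<Rightarrow> real"
  assumes der: "(w has_derivative (\<lambda>h. g \<bullet> h)) (at x within T)"
    and "d > 0" and dir: "\<And>t. 0 < t \<Longrightarrow> t < d \<Longrightarrow> x + t *\<^sub>R h \<in> T \<and> w x + c * t \<le> w (x + t *\<^sub>R h)"
  shows "c \<le> g \<bullet> h"
proof -
  define l where "l = (\<lambda>t::real. x + t *\<^sub>R h)"
  have l': "(l has_derivative (\<lambda>t. t *\<^sub>R h)) (at 0 within {0<..<d})"
    unfolding l_def by (auto intro!: derivative_eq_intros)
  have "l ` {0<..<d} \<subseteq> T" using dir by (auto simp: l_def)
  then have "(w has_derivative (\<lambda>h. g \<bullet> h)) (at (l 0) within l ` {0<..<d})"
    using has_derivative_subset[OF der] by (simp add: l_def)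
  from diff_chain_within[OF l' this]
  have "((\<lambda>t. w (l t)) has_derivative (\<lambda>t. t * (g \<bullet> h))) (at 0 within {0<..<d})"
    by (simp add: o_def)
  then have "((\<lambda>t. w (l t)) has_real_derivative (g \<bullet> h)) (at 0 within {0<..<d})"
    by (simp add: has_field_derivative_def mult_commute_abs)
  then have lim: "((\<lambda>t. (w (l t) - w (l 0)) / (t - 0)) \<longlongrightarrow> g \<bullet> h) (at 0 within {0<..<d})"
    by (simp add: has_field_derivative_iff)
  have ev: "\<forall>\<^sub>F t in at 0 within {0<..<d}. c \<le> (w (l t) - w (l 0)) / (t - 0)"
    unfolding eventually_at_filter
  proof (intro always_eventually allI impI)
    fix t :: real assume "t \<noteq> 0" "t \<in> {0<..<d}"
    then have "0 < t" "w x + c * t \<le> w (l t)" using dir by (auto simp: l_def)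
    then show "c \<le> (w (l t) - w (l 0)) / (t - 0)" by (simp add: l_def field_simps)
  qed
  have "at (0::real) within {0<..<d} \<noteq> bot"
    using \<open>d > 0\<close> by (simp add: trivial_limit_within islimpt_greaterThanLessThan1)
  from tendsto_lowerbound[OF lim ev this] show ?thesis .
qed

definition hopf_barrier :: "real \<Rightarrow> 'a::euclidean_space \<Rightarrow> real \<Rightarrow> 'a \<Rightarrow> real" where
  "hopf_barrier k x1 R x = exp (- k * ((x - x1) \<bullet> (x - x1))) - exp (- k * R\<^sup>2)"

lemma jet2_hopf_barrier:
  "jet2 S (hopf_barrier k x1 R)
     (\<lambda>x. (- 2 * k * exp (- k * ((x - x1) \<bullet> (x - x1)))) *\<^sub>R (x - x1))
     (\<lambda>x h. exp (- k * ((x - x1) \<bullet> (x - x1))) *\<^sub>R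
        ((4 * k\<^sup>2 * ((x - x1) \<bullet> h)) *\<^sub>R (x - x1) - (2 * k) *\<^sub>R h))"
  unfolding jet2_def
proof (intro ballI conjI)
  fix x :: 'a
  define E where "E = exp (- k * ((x - x1) \<bullet> (x - x1)))"
  have E': "((\<lambda>x. exp (- k * ((x - x1) \<bullet> (x - x1)))) has_derivative
      (\<lambda>h. - 2 * k * E * ((x - x1) \<bullet> h))) (at x)"
    by (auto intro!: derivative_eq_intros simp: E_def inner_commute algebra_simps)
  have "(hopf_barrier k x1 R has_derivative (\<lambda>h. - 2 * k * E * ((x - x1) \<bullet> h))) (at x)"
    unfolding hopf_barrier_def[abs_def] using has_derivative_diff[OF E' has_derivative_const] by simp
  then show "(hopf_barrier k x1 R has_derivative
      (\<lambda>h. ((- 2 * k * exp (- k * ((x - x1) \<bullet> (x - x1)))) *\<^sub>R (x - x1)) \<bullet> h)) (at x)"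
    by (simp add: E_def)
  have "((\<lambda>x. (- 2 * k * exp (- k * ((x - x1) \<bullet> (x - x1)))) *\<^sub>R (x - x1)) has_derivative
      (\<lambda>h. (- 2 * k * E) *\<^sub>R h + (- 2 * k * (- 2 * k * E * ((x - x1) \<bullet> h))) *\<^sub>R (x - x1))) (at x)"
    unfolding E_def
    by (intro has_derivative_scaleR has_derivative_mult_right E'[unfolded E_def])
       (auto intro!: derivative_eq_intros)
  moreover have "(\<lambda>h. (- 2 * k * E) *\<^sub>R h + (- 2 * k * (- 2 * k * E * ((x - x1) \<bullet> h))) *\<^sub>R (x - x1)) =
    (\<lambda>h. E *\<^sub>R ((4 * k\<^sup>2 * ((x - x1) \<bullet> h)) *\<^sub>R (x - x1) - (2 * k) *\<^sub>R h))"
    by (simp add: scaleR_diff_right power2_eq_square algebra_simps)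
  ultimately show "((\<lambda>x. (- 2 * k * exp (- k * ((x - x1) \<bullet> (x - x1)))) *\<^sub>R (x - x1)) has_derivative
      (\<lambda>h. exp (- k * ((x - x1) \<bullet> (x - x1))) *\<^sub>R
        ((4 * k\<^sup>2 * ((x - x1) \<bullet> h)) *\<^sub>R (x - x1) - (2 * k) *\<^sub>R h))) (at x)"
    by (simp add: E_def)
qed

text \<open>
  On the annulus \<open>R / 2 \<le> \<bar>x - x1\<bar> \<le> R\<close> the second-order term contributes at least \<open>k\<^sup>2 m R\<^sup>2\<close>, while
  all other terms grow at most linearly in \<open>k\<close>.  Hence the barrier is a strict subsolution for
  large \<open>k\<close>.
\<close>

lemma elliptic_op_hopf_barrier_ge:
  fixes x x1 :: "'a::euclidean_space"
  assumes P: "elliptic_matrix P m" "m > 0" and k: "k \<ge> 0" and R: "R > 0"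
    and x: "R / 2 \<le> norm (x - x1)" "norm (x - x1) \<le> R"
    and C: "(\<Sum>e\<in>Basis. P e \<bullet> e) \<le> C" "norm q \<le> C" "\<bar>r\<bar> \<le> C"
  shows "exp (- k * ((x - x1) \<bullet> (x - x1))) * (k\<^sup>2 * m * R\<^sup>2 - 2 * k * C * (1 + R) - C) \<le>
    elliptic_op P q r (hopf_barrier k x1 R x)
     ((- 2 * k * exp (- k * ((x - x1) \<bullet> (x - x1)))) *\<^sub>R (x - x1))
     (\<lambda>h. exp (- k * ((x - x1) \<bullet> (x - x1))) *\<^sub>R
        ((4 * k\<^sup>2 * ((x - x1) \<bullet> h)) *\<^sub>R (x - x1) - (2 * k) *\<^sub>R h))"
proof -
  define d where "d = x - x1"
  define E where "E = exp (- k * (d \<bullet> d))"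
  have E0: "E > 0" by (simp add: E_def)
  have dd: "d \<bullet> d = (norm d)\<^sup>2" by (simp add: power2_norm_eq_inner)
  have dR: "R\<^sup>2 / 4 \<le> d \<bullet> d" "d \<bullet> d \<le> R\<^sup>2"
    using power_mono[OF x(1), of 2] power_mono[OF x(2), of 2] R by (auto simp: d_def power2_norm_eq_inner power_divide)
  have tr: "(\<Sum>e\<in>Basis. P e \<bullet> (E *\<^sub>R ((4 * k\<^sup>2 * (d \<bullet> e)) *\<^sub>R d - (2 * k) *\<^sub>R e))) =
      E * (4 * k\<^sup>2 * (d \<bullet> P d) - 2 * k * (\<Sum>e\<in>Basis. P e \<bullet> e))"
  proof -
    have "(\<Sum>e\<in>Basis. (d \<bullet> e) * (P e \<bullet> d)) = d \<bullet> P d"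
    proof -
      have "(\<Sum>e\<in>Basis. (d \<bullet> e) * (P e \<bullet> d)) = (\<Sum>e\<in>Basis. (d \<bullet> e) * (P d \<bullet> e))"
        using P by (intro sum.cong refl) (metis elliptic_matrix_def inner_commute)
      then show ?thesis by (simp only: euclidean_inner[symmetric])
    qed
    moreover have "(\<Sum>e\<in>Basis. P e \<bullet> (E *\<^sub>R ((4 * k\<^sup>2 * (d \<bullet> e)) *\<^sub>R d - (2 * k) *\<^sub>R e))) =
      E * 4 * k\<^sup>2 * (\<Sum>e\<in>Basis. (d \<bullet> e) * (P e \<bullet> d)) - E * 2 * k * (\<Sum>e\<in>Basis. P e \<bullet> e)"
      by (simp add: inner_diff_right right_diff_distrib sum_subtractf sum_distrib_left mult_ac)
    ultimately show ?thesis by (simp add: algebra_simps)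
  qed
  have 1: "m * R\<^sup>2 \<le> 4 * (d \<bullet> P d)"
  proof -
    have "m * R\<^sup>2 \<le> m * (4 * (d \<bullet> d))" using dR P by (intro mult_left_mono) auto
    also have "\<dots> \<le> 4 * (d \<bullet> P d)" using P by (simp add: elliptic_matrix_def dd)
    finally show ?thesis .
  qed
  have 2: "\<bar>q \<bullet> d\<bar> \<le> C * R"
    using Cauchy_Schwarz_ineq2[of q d] C(2) x(2) R norm_ge_zero[of q]
    by (smt (verit) d_def mult_mono norm_ge_zero)
  have h: "0 \<le> hopf_barrier k x1 R x" "hopf_barrier k x1 R x \<le> E"
    using dR k by (auto simp: hopf_barrier_def E_def d_def[symmetric] mult_left_mono)
  have 3: "- C * E \<le> r * hopf_barrier k x1 R x"
  proof -
    have "\<bar>r * hopf_barrier k x1 R x\<bar> \<le> C * E"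
      using C(3) h by (simp add: abs_mult) (smt (verit) mult_mono)
    then show ?thesis by linarith
  qed
  have "E * (k\<^sup>2 * m * R\<^sup>2 - 2 * k * C * (1 + R) - C) \<le>
      E * (4 * k\<^sup>2 * (d \<bullet> P d) - 2 * k * (\<Sum>e\<in>Basis. P e \<bullet> e)) + (- 2 * k * E) * (q \<bullet> d) - C * E"
  proof -
    have "k\<^sup>2 * m * R\<^sup>2 \<le> 4 * k\<^sup>2 * (d \<bullet> P d)"
      using mult_left_mono[OF 1, of "k\<^sup>2"] by (simp add: mult_ac)
    moreover have "2 * k * (\<Sum>e\<in>Basis. P e \<bullet> e) \<le> 2 * k * C"
      using C(1) k by (intro mult_left_mono) auto
    moreover have "2 * k * (q \<bullet> d) \<le> 2 * k * (C * R)"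
      using 2 k by (intro mult_left_mono) auto
    ultimately have "k\<^sup>2 * m * R\<^sup>2 - 2 * k * C * (1 + R) - C \<le>
      4 * k\<^sup>2 * (d \<bullet> P d) - 2 * k * (\<Sum>e\<in>Basis. P e \<bullet> e) - 2 * k * (q \<bullet> d) - C"
      by (simp add: algebra_simps)
    from mult_left_mono[OF this, of E] E0 show ?thesis by (simp add: algebra_simps)
  qed
  also have "\<dots> \<le> elliptic_op P q r (hopf_barrier k x1 R x) ((- 2 * k * E) *\<^sub>R d)
     (\<lambda>h. E *\<^sub>R ((4 * k\<^sup>2 * (d \<bullet> h)) *\<^sub>R d - (2 * k) *\<^sub>R h))"
    using 3 unfolding elliptic_op_def tr by simp
  finally show ?thesis by (simp only: E_def d_def)
qed

text \<open>
  A small multiple of the barrier stays below \<open>w\<close> on both spheres bounding the annulus.  It stays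
  below inside as well: at a negative minimum of the difference, \<open>elliptic_op_at_minimum\<close>
  contradicts the strict subsolution property of the barrier.  So \<open>w\<close> grows
  linearly from \<open>x0\<close> along the inward normal.
\<close>

lemma hopf_boundary_point:
  fixes w :: "'a::euclidean_space \<Rightarrow> real"
  assumes R: "R > 0" and \<nu>: "norm \<nu> = 1" and x1: "x1 = x0 - R *\<^sub>R \<nu>"
    and jet: "jet2 (ball x1 R) w G H" and cont: "continuous_on (cball x1 R) w"
    and pos: "\<And>x. x \<in> ball x1 R \<Longrightarrow> 0 < w x" and nonneg: "\<And>x. x \<in> cball x1 R \<Longrightarrow> 0 \<le> w x"
    and zero: "w x0 = 0"
    and m: "m > 0" and P: "\<And>x. x \<in> ball x1 R \<Longrightarrow> elliptic_matrix (P x) m"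
    and C: "\<And>x. x \<in> ball x1 R \<Longrightarrow>
       (\<Sum>e\<in>Basis. P x e \<bullet> e) \<le> C \<and> norm (q x) \<le> C \<and> \<bar>r x\<bar> \<le> C"
    and ineq: "\<And>x. x \<in> ball x1 R \<Longrightarrow> elliptic_op (P x) (q x) (r x) (w x) (G x) (H x) \<le> K * w x"
    and der: "(w has_derivative (\<lambda>h. g \<bullet> h)) (at x0 within T)" and T: "ball x1 R \<subseteq> T"
  shows "g \<bullet> \<nu> < 0"
proof -
  \<comment> \<open>Enlarging the constant of the inequality to \<open>K'\<close>, which dominates the zeroth-order
    coefficient, makes it usable where the difference is negative.\<close>
  define K' where "K' = max K C"
  have C0: "0 \<le> C" using C[of x1] R by (auto intro: order_trans[OF norm_ge_zero])
  have K': "K \<le> K'" "C \<le> K'" "0 \<le> K'" using C0 by (auto simp: K'_def)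
  define a where "a = m * R\<^sup>2"
  have a0: "a > 0" using m R by (simp add: a_def)
  define k where "k = (2 * C * (1 + R) + C + K') / a + 1"
  have k1: "k \<ge> 1" using a0 C0 K' R by (simp add: k_def)
  have kK: "k\<^sup>2 * m * R\<^sup>2 - 2 * k * C * (1 + R) - C > K'"
  proof -
    have "k * a = 2 * C * (1 + R) + C + K' + a" using a0 by (simp add: k_def field_simps)
    then have "k * (k * a) = k * (2 * C * (1 + R)) + k * (C + K' + a)" by (simp add: algebra_simps)
    moreover have "1 * (C + K' + a) \<le> k * (C + K' + a)"
      using k1 C0 K' a0 by (intro mult_right_mono) auto
    ultimately show ?thesis using a0 by (simp add: a_def power2_eq_square algebra_simps)
  qed
  define h where "h = hopf_barrier k x1 R"
  define Gh where "Gh = (\<lambda>x. (- 2 * k * exp (- k * ((x - x1) \<bullet> (x - x1)))) *\<^sub>R (x - x1))"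
  define Hh where "Hh = (\<lambda>x h. exp (- k * ((x - x1) \<bullet> (x - x1))) *\<^sub>R
        ((4 * k\<^sup>2 * ((x - x1) \<bullet> h)) *\<^sub>R (x - x1) - (2 * k) *\<^sub>R h))"
  have jeth: "jet2 S h Gh Hh" for S
    unfolding h_def Gh_def Hh_def by (rule jet2_hopf_barrier)
  have dd: "(x - x1) \<bullet> (x - x1) = (dist x1 x)\<^sup>2" for x
    by (metis dist_norm dist_commute power2_norm_eq_inner)
  have h_le: "h x \<le> exp (- k * ((x - x1) \<bullet> (x - x1)))" for x
    by (simp add: h_def hopf_barrier_def)
  have h_le1: "h x \<le> 1" for x
    using h_le[of x] k1 by (smt (verit) exp_le_one_iff inner_ge_zero mult_nonneg_nonneg mult_minus_left)
  have h_sphere: "h x = 0" if "dist x1 x = R" for x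
    using that by (simp add: h_def hopf_barrier_def dd)
  have h_op: "K' * h x < elliptic_op (P x) (q x) (r x) (h x) (Gh x) (Hh x)"
    if x: "R / 2 \<le> dist x1 x" "dist x1 x < R" for x
  proof -
    let ?E = "exp (- k * ((x - x1) \<bullet> (x - x1)))"
    have xb: "x \<in> ball x1 R" using x by simp
    have "K' * h x \<le> K' * ?E" using h_le K' by (intro mult_left_mono) auto
    also have "\<dots> < ?E * (k\<^sup>2 * m * R\<^sup>2 - 2 * k * C * (1 + R) - C)" using kK by (simp add: mult.commute)
    also have "\<dots> \<le> elliptic_op (P x) (q x) (r x) (h x) (Gh x) (Hh x)"
      unfolding h_def Gh_def Hh_def using x k1 R C[OF xb]
      by (intro elliptic_op_hopf_barrier_ge P[OF xb] m) (auto simp: dist_norm norm_minus_commute)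
    finally show ?thesis .
  qed
  \<comment> \<open>On the inner sphere \<open>w\<close> is bounded below, which fixes the multiple of the barrier.\<close>
  obtain \<eta> where \<eta>: "\<eta> > 0" "\<And>x. dist x1 x = R / 2 \<Longrightarrow> \<eta> \<le> w x"
  proof -
    have "sphere x1 (R / 2) \<noteq> {}" using R by simp
    moreover have sub: "sphere x1 (R / 2) \<subseteq> ball x1 R" using R by auto
    moreover have "continuous_on (sphere x1 (R / 2)) w"
      using sub by (intro continuous_on_subset[OF cont]) auto
    ultimately obtain y where y: "y \<in> sphere x1 (R / 2)" "\<And>x. x \<in> sphere x1 (R / 2) \<Longrightarrow> w y \<le> w x"
      using continuous_attains_inf[OF compact_sphere] by metis
    show ?thesis
      by (rule that[of "w y"]) (use y pos sub in auto)
  qed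
  define D where "D = cball x1 R - ball x1 (R / 2)"
  have D: "x \<in> D \<longleftrightarrow> R / 2 \<le> dist x1 x \<and> dist x1 x \<le> R" for x by (auto simp: D_def)
  have x0R: "dist x1 x0 = R" using R \<nu> by (simp add: x1 dist_norm)
  define u where "u = (\<lambda>x. 1 * w x + (- \<eta>) * h x)"
  have "compact D" unfolding D_def by (intro compact_diff) auto
  moreover have "x0 \<in> D" using x0R R by (simp add: D)
  moreover have "continuous_on D u"
    unfolding u_def h_def hopf_barrier_def
    by (intro continuous_intros continuous_on_subset[OF cont]) (auto simp: D)
  ultimately obtain y where y: "y \<in> D" "\<And>x. x \<in> D \<Longrightarrow> u y \<le> u x"
    using continuous_attains_inf[of D u] by blast
  have "0 \<le> u y"
  proof (rule ccontr)
    assume neg: "\<not> 0 \<le> u y"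
    have "dist x1 y \<noteq> R"
      using neg nonneg[of y] h_sphere[of y] by (auto simp: u_def)
    moreover have "dist x1 y \<noteq> R / 2"
    proof
      assume "dist x1 y = R / 2"
      then have "\<eta> * h y \<le> \<eta> * 1" "\<eta> \<le> w y" using h_le1 \<eta> by (auto intro: mult_left_mono)
      then show False using neg by (simp add: u_def)
    qed
    ultimately have yA: "R / 2 < dist x1 y" "dist x1 y < R" using y(1) by (auto simp: D)
    define N where "N = ball x1 R - cball x1 (R / 2)"
    have N: "open N" "y \<in> N" "N \<subseteq> D" "N \<subseteq> ball x1 R"
      using yA by (auto simp: N_def D intro: open_Diff)
    have "jet2 N u (\<lambda>x. 1 *\<^sub>R G x + (- \<eta>) *\<^sub>R Gh x) (\<lambda>x h. 1 *\<^sub>R H x h + (- \<eta>) *\<^sub>R Hh x h)"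
      unfolding u_def by (intro jet2_lincomb jeth jet2_subset[OF jet N(4)])
    then have "r y * u y \<le> elliptic_op (P y) (q y) (r y) (u y) (1 *\<^sub>R G y + (- \<eta>) *\<^sub>R Gh y)
        (\<lambda>h. 1 *\<^sub>R H y h + (- \<eta>) *\<^sub>R Hh y h)"
      using N y(2) P m by (intro elliptic_op_at_minimum[of N]) auto
    also have "\<dots> = elliptic_op (P y) (q y) (r y) (w y) (G y) (H y) -
        \<eta> * elliptic_op (P y) (q y) (r y) (h y) (Gh y) (Hh y)"
      unfolding u_def elliptic_op_lincomb by simp
    also have "\<dots> < K' * w y - \<eta> * (K' * h y)"
    proof -
      have "elliptic_op (P y) (q y) (r y) (w y) (G y) (H y) \<le> K * w y" using ineq N by auto
      also have "\<dots> \<le> K' * w y" using K' nonneg[of y] yA by (intro mult_right_mono) auto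
      finally show ?thesis using mult_strict_left_mono[OF h_op \<eta>(1)] yA by force
    qed
    also have "\<dots> = K' * u y" by (simp add: u_def algebra_simps)
    also have "\<dots> \<le> C * u y" using neg K' by (intro mult_right_mono_neg) auto
    also have "\<dots> \<le> r y * u y" using neg C[of y] yA by (intro mult_right_mono_neg) auto
    finally show False by simp
  qed
  then have w_ge: "\<eta> * h x \<le> w x" if "x \<in> D" for x using y(2)[OF that] by (simp add: u_def)
  \<comment> \<open>For \<open>0 < t < R / 2\<close>, \<open>R\<^sup>2 - (R - t)\<^sup>2 \<ge> R t\<close> and \<open>exp u \<ge> 1 + u\<close> bound the barrier at
    distance \<open>R - t\<close> from \<open>x1\<close> below by \<open>c t\<close>.\<close>
  define c where "c = exp (- k * R\<^sup>2) * (k * R)"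
  have c0: "c > 0" using k1 R by (simp add: c_def)
  have "\<eta> * c \<le> g \<bullet> (- \<nu>)"
  proof (rule directional_derivative_ge[OF der, of "R / 2"])
    fix t :: real assume t: "0 < t" "t < R / 2"
    let ?x = "x0 + t *\<^sub>R (- \<nu>)"
    have "dist x1 ?x = R - t"
    proof -
      have "x1 - ?x = (t - R) *\<^sub>R \<nu>" by (simp add: x1 algebra_simps)
      then show ?thesis using \<nu> t by (simp add: dist_norm)
    qed
    note dt = this
    have "c * t \<le> h ?x"
    proof -
      have "1 + k * (R * t) \<le> 1 + k * (2 * R * t - t * t)"
        using t k1 by (intro add_left_mono mult_left_mono) (auto simp: algebra_simps)
      also have "\<dots> \<le> exp (k * (2 * R * t - t * t))" by (rule exp_ge_add_one_self)
      finally have "exp (- k * R\<^sup>2) * (1 + k * (R * t)) \<le> exp (- k * R\<^sup>2) * exp (k * (2 * R * t - t * t))"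
        by (intro mult_left_mono) auto
      also have "\<dots> = exp (- k * (R - t)\<^sup>2)"
        by (simp add: exp_add[symmetric] power2_eq_square algebra_simps)
      finally have "c * t \<le> exp (- k * (R - t)\<^sup>2) - exp (- k * R\<^sup>2)"
        by (simp add: c_def algebra_simps)
      also have "\<dots> = h ?x" unfolding h_def hopf_barrier_def dd dt by simp
      finally show ?thesis .
    qed
    then have "\<eta> * c * t \<le> \<eta> * h ?x" using \<eta> by (simp add: mult.assoc)
    also have "\<dots> \<le> w ?x" using w_ge[of ?x] t dt by (simp add: D)
    finally show "?x \<in> T \<and> w x0 + \<eta> * c * t \<le> w ?x" using zero T dt t by (auto simp: subset_iff)
  qed (use R in auto)
  then show ?thesis using mult_pos_pos[OF \<eta>(1) c0] by simp
qed

text \<open>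
  At a boundary zero of a nonnegative function every inward directional derivative is nonnegative,
  so the gradient is a multiple of the normal.  The Hopf lemma makes that multiple nonzero, and
  ellipticity then makes the conormal derivative nonzero.
\<close>

lemma no_boundary_zero_with_conormal_condition:
  fixes w :: "'a::euclidean_space \<Rightarrow> real"
  assumes R: "R > 0" and \<nu>: "norm \<nu> = 1" and x1: "x1 = x0 - R *\<^sub>R \<nu>"
    and jet: "jet2 (ball x1 R) w G H" and cont: "continuous_on (cball x1 R) w"
    and pos: "\<And>x. x \<in> ball x1 R \<Longrightarrow> 0 < w x" and nonneg: "\<And>x. x \<in> cball x1 R \<Longrightarrow> 0 \<le> w x"
    and zero: "w x0 = 0"
    and m: "m > 0" and P: "\<And>x. x \<in> ball x1 R \<Longrightarrow> elliptic_matrix (P x) m"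
    and C: "\<And>x. x \<in> ball x1 R \<Longrightarrow>
       (\<Sum>e\<in>Basis. P x e \<bullet> e) \<le> C \<and> norm (q x) \<le> C \<and> \<bar>r x\<bar> \<le> C"
    and ineq: "\<And>x. x \<in> ball x1 R \<Longrightarrow> elliptic_op (P x) (q x) (r x) (w x) (G x) (H x) \<le> K * w x"
    and der: "(w has_derivative (\<lambda>h. g \<bullet> h)) (at x0 within T)" and T: "ball x1 R \<subseteq> T"
    and P0: "elliptic_matrix P0 m" and conormal: "\<nu> \<bullet> P0 g = 0"
  shows False
proof -
  have g\<nu>: "g \<bullet> \<nu> < 0"
    by (rule hopf_boundary_point[OF R \<nu> x1 jet cont pos nonneg zero m P C ineq der T])
  have inward: "0 \<le> g \<bullet> h" if h: "h \<bullet> \<nu> < 0" for h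
  proof (rule directional_derivative_ge[OF der])
    have h0: "h \<noteq> 0" using h by auto
    show "0 < - 2 * R * (h \<bullet> \<nu>) / (h \<bullet> h)" using h R h0 by (simp add: divide_neg_pos mult_pos_neg)
    fix t assume t: "0 < t" "t < - 2 * R * (h \<bullet> \<nu>) / (h \<bullet> h)"
    then have "t * (h \<bullet> h) < - 2 * R * (h \<bullet> \<nu>)" using h0 by (simp add: field_simps)
    then have "t * (t * (h \<bullet> h)) < t * (- 2 * R * (h \<bullet> \<nu>))"
      using t(1) by (rule mult_strict_left_mono)
    moreover have "(norm (x1 - (x0 + t *\<^sub>R h)))\<^sup>2 = R\<^sup>2 + 2 * t * R * (h \<bullet> \<nu>) + t * (t * (h \<bullet> h))"
    proof -
      have "x1 - (x0 + t *\<^sub>R h) = - (R *\<^sub>R \<nu> + t *\<^sub>R h)" by (simp add: x1)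
      then have "(norm (x1 - (x0 + t *\<^sub>R h)))\<^sup>2 = (R *\<^sub>R \<nu> + t *\<^sub>R h) \<bullet> (R *\<^sub>R \<nu> + t *\<^sub>R h)"
        by (simp only: norm_minus_cancel power2_norm_eq_inner)
      also have "\<dots> = R\<^sup>2 * (\<nu> \<bullet> \<nu>) + 2 * t * R * (h \<bullet> \<nu>) + t * (t * (h \<bullet> h))"
        by (simp add: inner_add_left inner_add_right inner_commute power2_eq_square algebra_simps)
      also have "\<nu> \<bullet> \<nu> = 1" using \<nu> by (simp add: norm_eq_1)
      finally show ?thesis by simp
    qed
    ultimately have "(norm (x1 - (x0 + t *\<^sub>R h)))\<^sup>2 < R\<^sup>2" by (simp add: algebra_simps)
    then have "x0 + t *\<^sub>R h \<in> ball x1 R"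
      using R by (simp add: dist_norm) (rule power2_less_imp_less, auto)
    then show "x0 + t *\<^sub>R h \<in> T \<and> w x0 + 0 * t \<le> w (x0 + t *\<^sub>R h)"
      using T pos zero by (auto intro: less_imp_le)
  qed
  have tangential: "0 \<le> g \<bullet> h" if h: "h \<bullet> \<nu> = 0" for h
  proof (rule ccontr)
    assume neg: "\<not> 0 \<le> g \<bullet> h"
    define d where "d = (g \<bullet> h) / (2 * (g \<bullet> \<nu>))"
    have "d > 0" using neg g\<nu> by (simp add: d_def divide_neg_neg)
    then have "(h - d *\<^sub>R \<nu>) \<bullet> \<nu> < 0" using h \<nu> by (simp add: inner_diff_left norm_eq_1)
    from inward[OF this] have "0 \<le> g \<bullet> h - d * (g \<bullet> \<nu>)" by (simp add: inner_diff_right)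
    moreover have "d * (g \<bullet> \<nu>) = (g \<bullet> h) / 2" using g\<nu> by (simp add: d_def)
    ultimately show False using neg by simp
  qed
  define h where "h = g - (g \<bullet> \<nu>) *\<^sub>R \<nu>"
  have "h \<bullet> \<nu> = 0" using \<nu> by (simp add: h_def inner_diff_left norm_eq_1)
  moreover from tangential[of "- h"] this have "g \<bullet> h \<le> 0" by simp
  ultimately have "h \<bullet> h \<le> 0"
    by (simp add: h_def inner_diff_left inner_commute)
  then have "h = 0" by (metis inner_eq_zero_iff inner_ge_zero order_antisym)
  then have g: "g = (g \<bullet> \<nu>) *\<^sub>R \<nu>" by (simp add: h_def)
  have "linear P0" using P0 by (simp add: elliptic_matrix_def)
  then have "\<nu> \<bullet> P0 g = (g \<bullet> \<nu>) * (\<nu> \<bullet> P0 \<nu>)" by (subst g) (simp add: linear_cmul)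
  moreover have "0 < \<nu> \<bullet> P0 \<nu>"
  proof -
    have "m * (norm \<nu>)\<^sup>2 \<le> \<nu> \<bullet> P0 \<nu>" using P0 unfolding elliptic_matrix_def by blast
    then show ?thesis using \<nu> m by simp
  qed
  ultimately show False using conormal g\<nu> by simp
qed

section \<open>Interior balls and normals\<close>

lemma holder_space_2_jet2:
  assumes "open S" "holder_space 2 \<alpha> S f"
  obtains G H where "jet2 S (f :: 'a::euclidean_space \<Rightarrow> real) G H"
proof -
  obtain D where D: "\<And>x. x \<in> S \<Longrightarrow> (f has_derivative (\<lambda>h. \<Sum>e\<in>Basis. (h \<bullet> e) *\<^sub>R D e x)) (at x)"
    and D1: "\<And>e. e \<in> Basis \<Longrightarrow> holder_space (Suc 0) \<alpha> S (D e)"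
    using assms unfolding numeral_2_eq_2 holder_space.simps(2)[of "Suc 0"]
    by (auto simp: at_within_open[of _ S] simp del: holder_space.simps)
  have "\<exists>D'. \<forall>x\<in>S. (D e has_derivative D' x) (at x)" if "e \<in> Basis" for e
    using D1[OF that] assms(1) by (auto simp: at_within_open[of _ S])
  then obtain D' where D': "\<And>e x. e \<in> Basis \<Longrightarrow> x \<in> S \<Longrightarrow> (D e has_derivative D' e x) (at x)"
    by metis
  have "jet2 S f (\<lambda>x. \<Sum>e\<in>Basis. D e x *\<^sub>R e) (\<lambda>x h. \<Sum>e\<in>Basis. D' e x h *\<^sub>R e)"
    unfolding jet2_def
  proof (intro ballI conjI)
    fix x assume x: "x \<in> S"
    show "(f has_derivative (\<lambda>h. (\<Sum>e\<in>Basis. D e x *\<^sub>R e) \<bullet> h)) (at x)"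
    proof -
      have "(\<Sum>e\<in>Basis. D e x *\<^sub>R e) \<bullet> h = (\<Sum>e\<in>Basis. (h \<bullet> e) *\<^sub>R D e x)" for h
        unfolding inner_sum_left by (intro sum.cong refl) (simp add: inner_commute)
      then show ?thesis using D[OF x] by (simp only:)
    qed
    show "((\<lambda>x. \<Sum>e\<in>Basis. D e x *\<^sub>R e) has_derivative (\<lambda>h. \<Sum>e\<in>Basis. D' e x h *\<^sub>R e)) (at x)"
      by (intro has_derivative_sum has_derivative_scaleR_left D' x)
  qed
  then show ?thesis by (rule that)
qed

lemma jet2_quadratic_upper_bound:
  fixes F :: "'a::euclidean_space \<Rightarrow> real"
  assumes jet: "jet2 (ball x r) F n N" and r: "r > 0"
  obtains C \<rho> where "C \<ge> 0" "0 < \<rho>" "\<rho> \<le> r"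
    "\<And>w. w \<in> ball x \<rho> \<Longrightarrow> F w \<le> F x + n x \<bullet> (w - x) + C * ((w - x) \<bullet> (w - x))"
proof -
  have n': "(n has_derivative N x) (at x)" using jet r by (auto simp: jet2_def)
  then obtain d where d: "d > 0"
    "\<And>y. norm (y - x) < d \<Longrightarrow> norm (n y - n x - N x (y - x)) \<le> 1 * norm (y - x)"
    unfolding has_derivative_at_alt by (metis zero_less_one)
  obtain B where B: "B \<ge> 0" "\<And>h. norm (N x h) \<le> norm h * B"
    using bounded_linear.nonneg_bounded[OF has_derivative_bounded_linear[OF n']] by metis
  define C where "C = B + 1"
  have n_lip: "norm (n y - n x) \<le> C * norm (y - x)" if "norm (y - x) < d" for y
  proof -
    have "norm (n y - n x) \<le> norm (n y - n x - N x (y - x)) + norm (N x (y - x))"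
      using norm_triangle_ineq[of "n y - n x - N x (y - x)" "N x (y - x)"] by simp
    also have "\<dots> \<le> 1 * norm (y - x) + norm (y - x) * B" by (intro add_mono d B that)
    finally show ?thesis by (simp add: C_def algebra_simps)
  qed
  show ?thesis
  proof (rule that[of C "min d r"])
    fix w assume w: "w \<in> ball x (min d r)"
    define h where "h = w - x"
    have h: "norm h < d" "norm h < r" using w by (auto simp: h_def dist_norm norm_minus_commute)
    have th: "norm (t *\<^sub>R h) < d" "norm (t *\<^sub>R h) < r" "norm (t *\<^sub>R h) \<le> norm h"
      if "0 \<le> t" "t \<le> 1" for t
      using that h mult_right_mono[of t 1 "norm h"] by auto
    have F': "((\<lambda>t. F (x + t *\<^sub>R h)) has_real_derivative (n (x + t *\<^sub>R h) \<bullet> h)) (at t)"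
      if "0 \<le> t" "t \<le> 1" for t
    proof -
      have "x + t *\<^sub>R h \<in> ball x r" using th[OF that] by (simp add: dist_norm)
      then have "(F has_derivative (\<lambda>k. n (x + t *\<^sub>R h) \<bullet> k)) (at (x + t *\<^sub>R h))"
        using jet by (simp add: jet2_def)
      moreover have "((\<lambda>t. x + t *\<^sub>R h) has_derivative (\<lambda>s. s *\<^sub>R h)) (at t)"
        by (auto intro!: derivative_eq_intros)
      ultimately have "((\<lambda>t. F (x + t *\<^sub>R h)) has_derivative (\<lambda>s. n (x + t *\<^sub>R h) \<bullet> (s *\<^sub>R h))) (at t)"
        by (rule has_derivative_compose[rotated])
      then show ?thesis by (simp add: has_field_derivative_def mult_commute_abs)
    qed
    have "\<exists>z>0. z < 1 \<and> F (x + 1 *\<^sub>R h) - F (x + 0 *\<^sub>R h) = (1 - 0) * (n (x + z *\<^sub>R h) \<bullet> h)"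
      by (intro MVT2 F') auto
    then obtain z where z: "0 < z" "z < 1" "F w - F x = n (x + z *\<^sub>R h) \<bullet> h"
      by (auto simp: h_def)
    have "(n (x + z *\<^sub>R h) - n x) \<bullet> h \<le> norm (n (x + z *\<^sub>R h) - n x) * norm h"
      by (rule norm_cauchy_schwarz)
    also have "\<dots> \<le> (C * norm h) * norm h"
    proof (intro mult_right_mono)
      have "norm (n (x + z *\<^sub>R h) - n x) \<le> C * norm (x + z *\<^sub>R h - x)"
        using th[of z] z by (intro n_lip) auto
      also have "\<dots> \<le> C * norm h" using th[of z] z B by (intro mult_left_mono) (auto simp: C_def)
      finally show "norm (n (x + z *\<^sub>R h) - n x) \<le> C * norm h" .
    qed simp
    also have "\<dots> = C * (h \<bullet> h)" by (simp add: power2_norm_eq_inner[symmetric] power2_eq_square)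
    finally show "F w \<le> F x + n x \<bullet> (w - x) + C * ((w - x) \<bullet> (w - x))"
      using z(3) by (simp add: h_def[symmetric] inner_diff_left)
  qed (use B d r in \<open>auto simp: C_def\<close>)
qed

text \<open>
  Near \<open>x\<close> the set is \<open>F < 0\<close> with \<open>F w = g w - w \<bullet> e\<close>, and
  \<open>F w \<le> s (\<nu> \<bullet> (w - x)) + C \<bar>w - x\<bar>\<^sup>2\<close>.  In the ball of radius \<open>R\<close> touching at \<open>x\<close> from the side
  \<open>- \<nu>\<close> one has \<open>\<bar>w - x\<bar>\<^sup>2 < - 2 R (\<nu> \<bullet> (w - x))\<close>, so the linear term wins as soon as
  \<open>2 R C < s\<close>.
\<close>

lemma interior_ball_at_frontier:
  fixes S :: "'a::euclidean_space set"
  assumes S: "open S" "holder_boundary 2 \<alpha> S" "x \<in> frontier S" and \<delta>: "\<delta> > 0"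
  obtains R \<nu> where "0 < R" "R < \<delta>" "norm \<nu> = 1" "outward_unit_normal S x \<nu>"
    "ball (x - R *\<^sub>R \<nu>) R \<subseteq> S"
proof -
  obtain r e g where chart: "boundary_chart S x r e g" and hol: "holder_space 2 \<alpha> (ball x r) g"
    using S by (auto simp: holder_boundary_def)
  have r: "r > 0" and e: "norm e = 1" and ge: "\<And>w t. g (w + t *\<^sub>R e) = g w"
    and Sg0: "S \<inter> ball x r = {w \<in> ball x r. g w < w \<bullet> e}"
    using chart by (auto simp: boundary_chart_def)
  have Sg: "w \<in> S \<longleftrightarrow> g w - w \<bullet> e < 0" if "w \<in> ball x r" for w
    using Sg0 that by (simp add: set_eq_iff) blast
  obtain G H where jetg: "jet2 (ball x r) g G H"
    using holder_space_2_jet2[OF open_ball hol] .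
  define F where "F = (\<lambda>w. g w - w \<bullet> e)"
  define n where "n = (\<lambda>w. G w - e)"
  have jet: "jet2 (ball x r) F n H"
    unfolding jet2_def
  proof (intro ballI conjI)
    fix w assume w: "w \<in> ball x r"
    have "(F has_derivative (\<lambda>h. G w \<bullet> h - h \<bullet> e)) (at w)"
      unfolding F_def using jetg w
      by (intro has_derivative_diff has_derivative_inner_left has_derivative_ident)
         (auto simp: jet2_def)
    then show "(F has_derivative (\<lambda>h. n w \<bullet> h)) (at w)"
      by (simp add: n_def inner_diff_right inner_commute)
    have "(n has_derivative (\<lambda>h. H w h - 0)) (at w)"
      unfolding n_def using jetg w
      by (intro has_derivative_diff has_derivative_const) (auto simp: jet2_def)
    then show "(n has_derivative H w) (at w)" by simp
  qed
  have xr: "x \<in> ball x r" using r by simp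
  have F': "(F has_derivative (\<lambda>h. n x \<bullet> h)) (at x)" using jet xr by (simp add: jet2_def)
  have Fx: "F x = 0"
  proof (rule antisym)
    have "x \<notin> S" using S by (simp add: frontier_def interior_open)
    then show "0 \<le> F x" using Sg[OF xr] by (simp add: F_def)
    show "F x \<le> 0"
    proof (rule ccontr)
      assume "\<not> F x \<le> 0"
      moreover have "(F \<longlongrightarrow> F x) (at x)"
        using has_derivative_continuous[OF F'] by (simp add: continuous_within)
      ultimately have "\<forall>\<^sub>F w in at x. F w > 0"
        by (intro order_tendstoD(1)[of F "F x"]) auto
      then obtain d where d: "d > 0" "\<And>w. w \<noteq> x \<Longrightarrow> dist w x < d \<Longrightarrow> F w > 0"
        by (auto simp: eventually_at)
      have "x \<in> closure S" using S by (simp add: frontier_def)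
      then obtain w where w: "w \<in> S" "dist w x < min d r"
        using d r by (metis closure_approachable min_less_iff_conj)
      then have "F w < 0" using Sg[of w] by (simp add: F_def dist_commute)
      then show False using d(2)[of w] w \<open>\<not> F x \<le> 0\<close> by fastforce
    qed
  qed
  \<comment> \<open>The graph function is constant along \<open>e\<close>, so the defining function has nonzero gradient.\<close>
  have ne: "n x \<bullet> e = -1"
  proof -
    have "(g has_derivative (\<lambda>h. G x \<bullet> h)) (at (x + 0 *\<^sub>R e))" using jetg xr by (simp add: jet2_def)
    moreover have "((\<lambda>t. x + t *\<^sub>R e) has_derivative (\<lambda>t. t *\<^sub>R e)) (at (0::real))"
      by (auto intro!: derivative_eq_intros)
    ultimately have "((\<lambda>t. g (x + t *\<^sub>R e)) has_derivative (\<lambda>t. G x \<bullet> (t *\<^sub>R e))) (at (0::real))"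
      by (rule has_derivative_compose[rotated])
    then have "((\<lambda>t::real. g x) has_derivative (\<lambda>t. G x \<bullet> (t *\<^sub>R e))) (at 0)" by (simp add: ge)
    then have "(\<lambda>t::real. G x \<bullet> (t *\<^sub>R e)) = (\<lambda>t. 0)"
      using has_derivative_unique has_derivative_const by blast
    from fun_cong[OF this, of 1] have "G x \<bullet> e = 0" by simp
    then show ?thesis using e by (simp add: n_def inner_diff_left norm_eq_1)
  qed
  then have nx: "n x \<noteq> 0" by auto
  define s where "s = norm (n x)"
  define \<nu> where "\<nu> = n x /\<^sub>R s"
  have s: "s > 0" using nx by (simp add: s_def)
  have n\<nu>: "n x = s *\<^sub>R \<nu>" using s by (simp add: \<nu>_def)
  have \<nu>1: "norm \<nu> = 1" using s by (simp add: \<nu>_def s_def)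
  have normal: "outward_unit_normal S x \<nu>"
    unfolding outward_unit_normal_def
  proof (intro conjI exI)
    show "boundary_chart S x r e g" by (rule chart)
    show "((\<lambda>w. g w - w \<bullet> e) has_derivative (\<lambda>h. s * (\<nu> \<bullet> h))) (at x)"
      using F' by (simp add: F_def n\<nu>)
  qed (use s S(3) \<nu>1 in auto)
  obtain C \<rho> where C: "C \<ge> 0" "0 < \<rho>" "\<rho> \<le> r"
    "\<And>w. w \<in> ball x \<rho> \<Longrightarrow> F w \<le> F x + n x \<bullet> (w - x) + C * ((w - x) \<bullet> (w - x))"
    using jet2_quadratic_upper_bound[OF jet r] by metis
  define R where "R = min (\<delta> / 2) (min (\<rho> / 2) (s / (2 * (C + 1))))"
  have R: "0 < R" "R \<le> \<delta> / 2" "R \<le> \<rho> / 2" "R \<le> s / (2 * (C + 1))"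
    unfolding R_def using \<delta> C s by (simp, linarith+)
  have "2 * R * (C + 1) \<le> s" using R(4) C by (simp add: field_simps)
  then have RC: "2 * R * C < s" using R by (simp add: algebra_simps)
  have "ball (x - R *\<^sub>R \<nu>) R \<subseteq> S"
  proof
    fix w assume w: "w \<in> ball (x - R *\<^sub>R \<nu>) R"
    define h where "h = w - x"
    have hR: "norm (h + R *\<^sub>R \<nu>) < R"
      using w by (simp add: h_def dist_norm norm_minus_commute algebra_simps)
    have "norm h \<le> norm (h + R *\<^sub>R \<nu>) + norm (R *\<^sub>R \<nu>)"
      using norm_triangle_ineq4[of "h + R *\<^sub>R \<nu>" "R *\<^sub>R \<nu>"] by simp
    also have "\<dots> < \<rho>" using hR R \<nu>1 by simp
    finally have w\<rho>: "w \<in> ball x \<rho>" by (simp add: h_def dist_norm norm_minus_commute)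
    have "(norm (h + R *\<^sub>R \<nu>))\<^sup>2 < R\<^sup>2" using hR by (intro power_strict_mono) auto
    moreover have "(norm (h + R *\<^sub>R \<nu>))\<^sup>2 = h \<bullet> h + 2 * R * (\<nu> \<bullet> h) + R\<^sup>2"
    proof -
      have "\<nu> \<bullet> \<nu> = 1" using \<nu>1 by (simp add: norm_eq_1)
      then show ?thesis
        unfolding power2_norm_eq_inner
        by (simp add: inner_add_left inner_add_right inner_commute power2_eq_square)
    qed
    ultimately have hh: "h \<bullet> h + 2 * R * (\<nu> \<bullet> h) < 0" by simp
    then have neg: "\<nu> \<bullet> h < 0" using R inner_ge_zero[of h] by (smt (verit) mult_nonneg_nonneg)
    have "F w \<le> s * (\<nu> \<bullet> h) + C * (h \<bullet> h)" using C(4)[OF w\<rho>] Fx by (simp add: n\<nu> h_def)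
    also have "C * (h \<bullet> h) \<le> C * (- 2 * R * (\<nu> \<bullet> h))" using hh C by (intro mult_left_mono) auto
    also have "s * (\<nu> \<bullet> h) + C * (- 2 * R * (\<nu> \<bullet> h)) = (s - 2 * R * C) * (\<nu> \<bullet> h)"
      by (simp add: algebra_simps)
    also have "\<dots> < 0" using RC neg by (simp add: mult_pos_neg)
    finally have "F w < 0" by simp
    moreover have "w \<in> ball x r" using w\<rho> C by simp
    ultimately show "w \<in> S" using Sg[of w] by (simp add: F_def)
  qed
  then show ?thesis using R \<delta> by (intro that[of R \<nu>] \<nu>1 normal) auto
qed

text \<open>
  A chart of \<open>S\<close>, extended constantly along the axis, is a chart of the cylinder.  This transfers
  the boundary condition of the global problem to normals of the cross-section.
\<close>

lemma outward_unit_normal_cylinder: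
  fixes S :: "'a::euclidean_space set" and y :: real
  assumes "outward_unit_normal S z \<nu>"
  shows "outward_unit_normal (UNIV \<times> S) (y, z) (0, \<nu>)"
proof -
  obtain r e g s where z: "z \<in> frontier S" "norm \<nu> = 1" and chart: "boundary_chart S z r e g"
    and s: "s > 0" and der: "((\<lambda>w. g w - w \<bullet> e) has_derivative (\<lambda>h. s * (\<nu> \<bullet> h))) (at z)"
    using assms by (auto simp: outward_unit_normal_def)
  have "boundary_chart (UNIV \<times> S) (y, z) r (0, e) (\<lambda>w. g (snd w))"
    unfolding boundary_chart_def
  proof (intro conjI allI)
    have Sg: "\<And>w. w \<in> ball z r \<Longrightarrow> w \<in> S \<longleftrightarrow> g w < w \<bullet> e"
      using chart by (auto simp: boundary_chart_def)
    have "snd w \<in> ball z r" if "w \<in> ball (y, z) r" for w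
      using that dist_snd_le[of "(y, z)" w] by (simp add: order.strict_trans1)
    then show "UNIV \<times> S \<inter> ball (y, z) r = {w \<in> ball (y, z) r. g (snd w) < w \<bullet> (0, e)}"
      using Sg by (auto simp: inner_prod_def simp del: mem_ball)
  qed (use chart in \<open>auto simp: boundary_chart_def norm_prod_def\<close>)
  moreover have "((\<lambda>w. g (snd w) - w \<bullet> (0, e)) has_derivative (\<lambda>h. s * ((0, \<nu>) \<bullet> h))) (at (y, z))"
    using has_derivative_compose[OF has_derivative_snd[OF has_derivative_ident],
        of "\<lambda>w. g w - w \<bullet> e" _ "(y, z)" UNIV] der
    by (simp add: inner_prod_def)
  moreover have "(y, z) \<in> frontier (UNIV \<times> S)"
    using z by (auto simp: frontier_def closure_Times interior_Times)
  moreover have "norm (0::real, \<nu>) = 1" using z by (simp add: norm_prod_def)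
  ultimately show ?thesis using s unfolding outward_unit_normal_def by blast
qed

section \<open>The operators in non-divergence form\<close>

lemma holder_space_0_continuous_on:
  assumes "holder_space 0 \<alpha> S f" "\<alpha> > 0"
  shows "continuous_on S f"
proof -
  obtain C where C: "\<And>x y. x \<in> S \<Longrightarrow> y \<in> S \<Longrightarrow> norm (f x - f y) \<le> C * dist x y powr \<alpha>"
    using assms by auto
  show ?thesis
    unfolding continuous_on
  proof
    fix x assume x: "x \<in> S"
    have "((\<lambda>y. C * dist y x powr \<alpha>) \<longlongrightarrow> C * 0 powr \<alpha>) (at x within S)"
      using assms(2) by (intro tendsto_mult tendsto_powr' tendsto_const) (auto intro!: tendsto_eq_intros)
    then have "((\<lambda>y. C * dist y x powr \<alpha>) \<longlongrightarrow> 0) (at x within S)" by simp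
    then have "((\<lambda>y. f y - f x) \<longlongrightarrow> 0) (at x within S)"
      by (rule Lim_null_comparison[rotated]) (use C x in \<open>auto simp: eventually_at_filter\<close>)
    then show "(f \<longlongrightarrow> f x) (at x within S)" by (rule LIM_zero_cancel)
  qed
qed

lemma holder_space_Suc_D:
  assumes "holder_space (Suc k) \<alpha> S f"
  obtains D where
    "\<And>x. x \<in> S \<Longrightarrow> (f has_derivative (\<lambda>h. \<Sum>e\<in>Basis. (h \<bullet> e) *\<^sub>R D e x)) (at x within S)"
    "\<And>e. e \<in> Basis \<Longrightarrow> holder_space k \<alpha> S (D e)"
  using assms unfolding holder_space.simps(2) by blast

lemma holder_space_continuous_on:
  assumes "holder_space k \<alpha> S f" "\<alpha> > 0"
  shows "continuous_on S f"
proof (cases k)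
  case 0
  then show ?thesis using assms holder_space_0_continuous_on by auto
next
  case (Suc k')
  then obtain D where "\<And>x. x \<in> S \<Longrightarrow> (f has_derivative (\<lambda>h. \<Sum>e\<in>Basis. (h \<bullet> e) *\<^sub>R D e x)) (at x within S)"
    using assms holder_space_Suc_D by blast
  then show ?thesis by (rule has_derivative_continuous_on)
qed

lemma bounded_bilinear_matrix_vector_mult:
  "bounded_bilinear (\<lambda>(M :: real^'n^'m) x. M *v x)"
proof -
  have "bilinear (\<lambda>(M :: real^'n^'m) x. M *v x)"
    unfolding bilinear_def
    by (auto intro!: linearI simp: matrix_vector_mult_add_rdistrib matrix_vector_right_distrib
        scaleR_matrix_vector_assoc matrix_vector_mult_scaleR)
  then show ?thesis by (simp add: bilinear_conv_bounded_bilinear)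
qed

lemma gradient_eq:
  fixes u :: "'a::euclidean_space \<Rightarrow> real"
  assumes "(u has_derivative (\<lambda>h. g \<bullet> h)) (at x)"
  shows "gradient u (at x) = g"
proof -
  have "frechet_derivative u (at x) = (\<lambda>h. g \<bullet> h)"
    using assms by (rule frechet_derivative_at[symmetric])
  then show ?thesis by (simp add: gradient_def euclidean_representation)
qed

lemma divergence_eq:
  assumes "(V has_derivative V') (at x)"
  shows "divergence V (at x) = (\<Sum>e\<in>Basis. V' e \<bullet> e)"
  using frechet_derivative_at[OF assms] by (simp add: divergence_def)

lemma has_derivative_gradient_within:
  fixes u :: "'a::euclidean_space \<Rightarrow> real"
  assumes "u differentiable (at x within S)"
  shows "(u has_derivative (\<lambda>h. gradient u (at x within S) \<bullet> h)) (at x within S)"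
proof -
  let ?D = "frechet_derivative u (at x within S)"
  have D: "(u has_derivative ?D) (at x within S)"
    using assms by (simp add: frechet_derivative_works)
  then have lin: "linear ?D" by (rule has_derivative_linear)
  have "?D h = gradient u (at x within S) \<bullet> h" for h
  proof -
    have "?D h = ?D (\<Sum>e\<in>Basis. (h \<bullet> e) *\<^sub>R e)" by (simp only: euclidean_representation)
    also have "\<dots> = (\<Sum>e\<in>Basis. (h \<bullet> e) *\<^sub>R ?D e)"
      by (simp only: linear_sum[OF lin] linear_cmul[OF lin])
    also have "\<dots> = gradient u (at x within S) \<bullet> h"
      unfolding gradient_def inner_sum_left by (intro sum.cong refl) (simp add: inner_commute)
    finally show ?thesis .
  qed
  then have "?D = (\<lambda>h. gradient u (at x within S) \<bullet> h)" by (rule ext)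
  with D show ?thesis by simp
qed

locale cross_section =
  fixes \<alpha> :: real and Z :: "(real^'n) section_space"
    and a :: "real^'n \<Rightarrow> real^'n^'n" and b :: "real^'n \<Rightarrow> real^'n" and m :: real
  assumes \<alpha>_pos: "0 < \<alpha>" and admissible: "admissible_section \<alpha> Z"
    and a_holder: "holder_space 2 \<alpha> (closure (lift Z)) a"
    and a_sym: "\<And>z. z \<in> closure (lift Z) \<Longrightarrow> transpose (a z) = a z"
    and a_ell: "\<And>z \<xi>. z \<in> closure (lift Z) \<Longrightarrow> m * (norm \<xi>)\<^sup>2 \<le> \<xi> \<bullet> (a z *v \<xi>)"
    and m_pos: "0 < m"
    and b_holder: "holder_space 1 \<alpha> (closure (lift Z)) b"
begin

abbreviation \<Omega> :: "(real^'n) set" where "\<Omega> \<equiv> lift Z"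

lemma open_\<Omega>: "open \<Omega>"
  using admissible by (cases Z) auto

lemma elliptic_matrix_a: "z \<in> closure \<Omega> \<Longrightarrow> elliptic_matrix (\<lambda>\<xi>. a z *v \<xi>) m"
  unfolding elliptic_matrix_def
  using a_sym[of z] a_ell[of z] by (auto simp: dot_lmul_matrix[symmetric] transpose_matrix_vector[symmetric])

text \<open>
  The divergences are expanded with the product rule.  Continuity of \<open>q\<close> and \<open>r\<close> up to the boundary,
  inherited from the first derivatives of \<open>a\<close> and \<open>b\<close>, bounds them on the closed balls of the Hopf
  lemma, which touch the boundary.
\<close>

lemma L_z_eq_elliptic_op:
  obtains q :: "real^'n \<Rightarrow> real^'n" and r :: "real^'n \<Rightarrow> real" where
    "continuous_on (closure \<Omega>) q" "continuous_on (closure \<Omega>) r"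
    "\<And>u G H z. z \<in> \<Omega> \<Longrightarrow> jet2 \<Omega> u G H \<Longrightarrow>
       L_z a b u z = elliptic_op (\<lambda>\<xi>. a z *v \<xi>) (q z) (r z) (u z) (G z) (H z)"
proof -
  have "holder_space (Suc (Suc 0)) \<alpha> (closure \<Omega>) a" using a_holder by (simp only: numeral_2_eq_2)
  then obtain Da where Da:
      "\<And>x. x \<in> closure \<Omega> \<Longrightarrow> (a has_derivative (\<lambda>h. \<Sum>e\<in>Basis. (h \<bullet> e) *\<^sub>R Da e x)) (at x within closure \<Omega>)"
      and Da_hol: "\<And>e. e \<in> Basis \<Longrightarrow> holder_space (Suc 0) \<alpha> (closure \<Omega>) (Da e)"
    using holder_space_Suc_D by blast
  have "holder_space (Suc 0) \<alpha> (closure \<Omega>) b" using b_holder by (simp only: One_nat_def)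
  then obtain Db where Db:
      "\<And>x. x \<in> closure \<Omega> \<Longrightarrow> (b has_derivative (\<lambda>h. \<Sum>e\<in>Basis. (h \<bullet> e) *\<^sub>R Db e x)) (at x within closure \<Omega>)"
      and Db_hol: "\<And>e. e \<in> Basis \<Longrightarrow> holder_space 0 \<alpha> (closure \<Omega>) (Db e)"
    using holder_space_Suc_D by blast
  have Da_cont: "continuous_on (closure \<Omega>) (Da e)" and Db_cont: "continuous_on (closure \<Omega>) (Db e)"
    if "e \<in> Basis" for e
    using Da_hol[OF that] Db_hol[OF that] \<alpha>_pos holder_space_continuous_on by blast+
  have b_cont: "continuous_on (closure \<Omega>) b"
    using b_holder \<alpha>_pos by (rule holder_space_continuous_on)
  define q where "q = (\<lambda>z. b z + (\<Sum>e\<in>Basis. transpose (Da e z) *v e))"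
  define r where "r = (\<lambda>z. \<Sum>e\<in>Basis. Db e z \<bullet> e)"
  have transp: "transpose M *v e = (\<Sum>i\<in>Basis. (e \<bullet> (M *v i)) *\<^sub>R i)" for M :: "real^'n^'n" and e
  proof -
    have "(transpose M *v e) \<bullet> i = e \<bullet> (M *v i)" for i
      by (simp add: transpose_matrix_vector dot_lmul_matrix)
    then show ?thesis using euclidean_representation[of "transpose M *v e"] by simp
  qed
  show ?thesis
  proof (rule that[of q r])
    show "continuous_on (closure \<Omega>) q"
      unfolding q_def transp
      by (intro continuous_intros b_cont bounded_bilinear.continuous_on[OF bounded_bilinear_matrix_vector_mult]
          Da_cont)
    show "continuous_on (closure \<Omega>) r" unfolding r_def by (intro continuous_intros Db_cont)
  next
    fix u G H z assume z: "z \<in> \<Omega>" and jet: "jet2 \<Omega> u G H"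
    have zc: "z \<in> closure \<Omega>" using z closure_subset by auto
    have at: "(f has_derivative f') (at z within closure \<Omega>) \<Longrightarrow> (f has_derivative f') (at z)"
      for f :: "real^'n \<Rightarrow> 'c::real_normed_vector" and f'
      using z open_\<Omega> by (metis at_within_interior closure_subset interior_maximal subsetD)
    have G: "(u has_derivative (\<lambda>h. G x \<bullet> h)) (at x)" "(G has_derivative H x) (at x)" if "x \<in> \<Omega>" for x
      using jet that by (auto simp: jet2_def)
    let ?a' = "\<lambda>h. \<Sum>e\<in>Basis. (h \<bullet> e) *\<^sub>R Da e z"
    have a': "(a has_derivative ?a') (at z)" using Da[OF zc] by (rule at)
    have "((\<lambda>x. a x *v G x) has_derivative (\<lambda>h. a z *v H z h + ?a' h *v G z)) (at z)"
      by (rule bounded_bilinear.FDERIV[OF bounded_bilinear_matrix_vector_mult a' G(2)[OF z]])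
    then have "((\<lambda>x. a x *v gradient u (at x)) has_derivative (\<lambda>h. a z *v H z h + ?a' h *v G z)) (at z)"
      by (rule has_derivative_transform_within_open[OF _ open_\<Omega> z]) (simp add: gradient_eq[OF G(1)])
    then have "divergence (\<lambda>x. a x *v gradient u (at x)) (at z) =
        (\<Sum>e\<in>Basis. (a z *v H z e + ?a' e *v G z) \<bullet> e)"
      by (rule divergence_eq)
    also have "\<dots> = (\<Sum>e\<in>Basis. (a z *v e) \<bullet> H z e + (transpose (Da e z) *v e) \<bullet> G z)"
    proof (intro sum.cong refl)
      fix e :: "real^'n" assume e: "e \<in> Basis"
      have "?a' e = Da e z"
        using e by (simp add: inner_Basis if_distrib[of "\<lambda>x. x *\<^sub>R _"] sum.delta' cong: if_cong)
      moreover have "(a z *v H z e) \<bullet> e = (a z *v e) \<bullet> H z e"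
        using elliptic_matrix_a[OF zc] unfolding elliptic_matrix_def by (metis inner_commute)
      moreover have "(Da e z *v G z) \<bullet> e = (transpose (Da e z) *v e) \<bullet> G z"
        by (metis transpose_matrix_vector dot_lmul_matrix inner_commute)
      ultimately show "(a z *v H z e + ?a' e *v G z) \<bullet> e = (a z *v e) \<bullet> H z e + (transpose (Da e z) *v e) \<bullet> G z"
        by (simp add: inner_add_left)
    qed
    finally have 1: "divergence (\<lambda>x. a x *v gradient u (at x)) (at z) =
      (\<Sum>e\<in>Basis. (a z *v e) \<bullet> H z e) + (\<Sum>e\<in>Basis. transpose (Da e z) *v e) \<bullet> G z"
      by (simp add: sum.distrib inner_sum_left)
    let ?b' = "\<lambda>h. \<Sum>e\<in>Basis. (h \<bullet> e) *\<^sub>R Db e z"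
    have b': "(b has_derivative ?b') (at z)" using Db[OF zc] by (rule at)
    have "((\<lambda>x. u x *\<^sub>R b x) has_derivative (\<lambda>h. u z *\<^sub>R ?b' h + (G z \<bullet> h) *\<^sub>R b z)) (at z)"
      by (rule has_derivative_scaleR[OF G(1)[OF z] b'])
    then have "divergence (\<lambda>x. u x *\<^sub>R b x) (at z) =
        (\<Sum>e\<in>Basis. (u z *\<^sub>R ?b' e + (G z \<bullet> e) *\<^sub>R b z) \<bullet> e)"
      by (rule divergence_eq)
    also have "\<dots> = (\<Sum>e\<in>Basis. u z * (Db e z \<bullet> e) + (b z \<bullet> e) * (G z \<bullet> e))"
    proof (intro sum.cong refl)
      fix e :: "real^'n" assume e: "e \<in> Basis"
      have "?b' e = Db e z"
        using e by (simp add: inner_Basis if_distrib[of "\<lambda>x. x *\<^sub>R _"] sum.delta' cong: if_cong)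
      then show "(u z *\<^sub>R ?b' e + (G z \<bullet> e) *\<^sub>R b z) \<bullet> e = u z * (Db e z \<bullet> e) + (b z \<bullet> e) * (G z \<bullet> e)"
        by (simp add: inner_add_left)
    qed
    also have "\<dots> = r z * u z + b z \<bullet> G z"
      by (simp add: sum.distrib r_def sum_distrib_right mult.commute[of "u z"]
          euclidean_inner[of "b z" "G z", symmetric])
    finally show "L_z a b u z = elliptic_op (\<lambda>\<xi>. a z *v \<xi>) (q z) (r z) (u z) (G z) (H z)"
      using 1 by (simp add: L_z_def elliptic_op_def q_def inner_add_left)
  qed
qed

end

lemma L_y_eq:
  assumes "open I" "y \<in> I"
    and "\<And>s. s \<in> I \<Longrightarrow> (u has_real_derivative u' s) (at s)" "(u' has_real_derivative u2) (at y)"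
    and "(A has_real_derivative A') (at y)" "(B has_real_derivative B') (at y)"
  shows "L_y A B \<epsilon> u y = \<epsilon>\<^sup>2 * (A y * u2 + A' * u' y) + \<epsilon> * (u' y * B y + u y * B')"
proof -
  have "((\<lambda>s. A s * u' s) has_real_derivative (A' * u' y + u2 * A y)) (at y)"
    by (rule DERIV_mult[OF assms(5,4)])
  then have "((\<lambda>s. A s * deriv u s) has_real_derivative (A' * u' y + u2 * A y)) (at y)"
    by (rule has_field_derivative_transform_within_open[OF _ assms(1,2)])
       (simp add: DERIV_imp_deriv[OF assms(3)])
  moreover have "((\<lambda>s. u s * B s) has_real_derivative (u' y * B y + B' * u y)) (at y)"
    using DERIV_mult[OF assms(3)[OF assms(2)] assms(6)] .
  ultimately show ?thesis by (simp add: L_y_def DERIV_imp_deriv algebra_simps)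
qed

lemma sum_Basis_prod:
  fixes f :: "'a::euclidean_space \<times> 'b::euclidean_space \<Rightarrow> 'c::comm_monoid_add"
  shows "sum f Basis = (\<Sum>i\<in>Basis. f (i, 0)) + (\<Sum>i\<in>Basis. f (0, i))"
proof -
  have "inj_on (\<lambda>u. (u::'a, 0::'b)) Basis" "inj_on (\<lambda>u. (0::'a, u::'b)) Basis"
    by (auto intro!: inj_onI)
  then show ?thesis
    unfolding Basis_prod_def by (subst sum.union_disjoint) (auto simp: sum.reindex)
qed

definition cyl_matrix ::
  "real \<Rightarrow> (real \<Rightarrow> real) \<Rightarrow> (real^'n \<Rightarrow> real^'n^'n) \<Rightarrow> real \<times> (real^'n) \<Rightarrow> real \<times> (real^'n) \<Rightarrow> real \<times> (real^'n)"
where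
  "cyl_matrix \<epsilon> A a p h = (\<epsilon>\<^sup>2 * A (fst p) * fst h, a (snd p) *v snd h)"

context cross_section
begin

lemma elliptic_matrix_cyl:
  assumes "z \<in> closure \<Omega>" "m' \<le> \<epsilon>\<^sup>2 * A y" "m' \<le> m"
  shows "elliptic_matrix (cyl_matrix \<epsilon> A a (y, z)) m'"
  unfolding elliptic_matrix_def
proof (intro conjI allI)
  have el: "elliptic_matrix (\<lambda>\<xi>. a z *v \<xi>) m" by (rule elliptic_matrix_a[OF assms(1)])
  show "linear (cyl_matrix \<epsilon> A a (y, z))"
    by (intro linearI) (auto simp: cyl_matrix_def matrix_vector_right_distrib matrix_vector_mult_scaleR
        prod_eq_iff algebra_simps)
  show "cyl_matrix \<epsilon> A a (y, z) p \<bullet> p' = p \<bullet> cyl_matrix \<epsilon> A a (y, z) p'" for p p'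
    using el by (auto simp: cyl_matrix_def inner_prod_def elliptic_matrix_def)
  show "m' * (norm p)\<^sup>2 \<le> p \<bullet> cyl_matrix \<epsilon> A a (y, z) p" for p
  proof -
    have "m' * (norm p)\<^sup>2 = m' * (fst p)\<^sup>2 + m' * (norm (snd p))\<^sup>2"
      by (simp add: norm_prod_def algebra_simps)
    also have "\<dots> \<le> \<epsilon>\<^sup>2 * A y * (fst p)\<^sup>2 + m * (norm (snd p))\<^sup>2"
      using assms by (intro add_mono mult_right_mono) auto
    also have "\<dots> \<le> p \<bullet> cyl_matrix \<epsilon> A a (y, z) p"
      using a_ell[OF assms(1)] by (simp add: cyl_matrix_def inner_prod_def power2_eq_square mult_ac)
    finally show ?thesis .
  qed
qed

lemma elliptic_op_cyl:
  shows "elliptic_op (cyl_matrix \<epsilon> A a (y, z)) (q1, q2) (r1 + r2) u g H =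
     \<epsilon>\<^sup>2 * A y * fst (H (1, 0)) + q1 * fst g + r1 * u +
     elliptic_op (\<lambda>\<xi>. a z *v \<xi>) q2 r2 u (snd g) (\<lambda>h. snd (H (0, h)))"
proof -
  have "(\<Sum>e\<in>Basis. cyl_matrix \<epsilon> A a (y, z) e \<bullet> H e) =
      \<epsilon>\<^sup>2 * A y * fst (H (1, 0)) + (\<Sum>e\<in>Basis. (a z *v e) \<bullet> snd (H (0, e)))"
    by (subst sum_Basis_prod) (simp add: cyl_matrix_def inner_prod_def)
  then show ?thesis by (simp add: elliptic_op_def inner_prod_def algebra_simps)
qed

lemma operator_eq_elliptic_op_cyl:
  assumes I: "open I" "y \<in> I" and z: "z \<in> \<Omega>" and jet: "jet2 (I \<times> \<Omega>) w G H"
    and A: "(A has_real_derivative A') (at y)" and B: "(B has_real_derivative B') (at y)"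
    and qr: "\<And>u G H z. z \<in> \<Omega> \<Longrightarrow> jet2 \<Omega> u G H \<Longrightarrow>
       L_z a b u z = elliptic_op (\<lambda>\<xi>. a z *v \<xi>) (q z) (r z) (u z) (G z) (H z)"
  shows "L_y A B \<epsilon> (\<lambda>s. w (s, z)) y + L_z a b (\<lambda>x. w (y, x)) z =
     elliptic_op (cyl_matrix \<epsilon> A a (y, z)) (\<epsilon>\<^sup>2 * A' + \<epsilon> * B y, q z) (\<epsilon> * B' + r z)
       (w (y, z)) (G (y, z)) (H (y, z))"
proof -
  have G: "(w has_derivative (\<lambda>h. G p \<bullet> h)) (at p)" "(G has_derivative H p) (at p)" if "p \<in> I \<times> \<Omega>" for p
    using jet that by (auto simp: jet2_def)
  have lin: "linear (H (y, z))" using G(2)[of "(y, z)"] I z by (auto intro: has_derivative_linear)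
  have cy: "((\<lambda>s. (s, z)) has_derivative (\<lambda>h. (h, 0))) (at s)" for s :: real
    by (auto intro!: derivative_eq_intros)
  have cz: "((\<lambda>x. (y, x)) has_derivative (\<lambda>h. (0, h))) (at x)" for x :: "real^'n"
    by (auto intro!: derivative_eq_intros)
  have 1: "((\<lambda>s. w (s, z)) has_real_derivative fst (G (s, z))) (at s)" if "s \<in> I" for s
    using has_derivative_compose[OF cy G(1)] that z
    by (simp add: has_field_derivative_def inner_prod_def mult_commute_abs)
  have 2: "((\<lambda>s. fst (G (s, z))) has_real_derivative fst (H (y, z) (1, 0))) (at y)"
  proof -
    have der: "((\<lambda>s. fst (G (s, z))) has_derivative (\<lambda>h. fst (H (y, z) (h, 0)))) (at y)"
      using has_derivative_compose[OF cy G(2)] I z by (intro has_derivative_fst) auto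
    have eq: "fst (H (y, z) (h, 0)) = fst (H (y, z) (1, 0)) * h" for h
    proof -
      have e: "h *\<^sub>R (1, 0 :: real^'n) = (h, 0)" by simp
      have "H (y, z) (h, 0) = h *\<^sub>R H (y, z) (1, 0)"
        by (rule linear_cmul[OF lin, of h "(1, 0)", unfolded e])
      then show ?thesis by (simp only: fst_scaleR real_scaleR_def mult.commute)
    qed
    from der[unfolded ext[OF eq]] show ?thesis unfolding has_field_derivative_def .
  qed
  have "jet2 \<Omega> (\<lambda>x. w (y, x)) (\<lambda>x. snd (G (y, x))) (\<lambda>x h. snd (H (y, x) (0, h)))"
    unfolding jet2_def
  proof (intro ballI conjI)
    fix x assume x: "x \<in> \<Omega>"
    show "((\<lambda>x. w (y, x)) has_derivative (\<lambda>h. snd (G (y, x)) \<bullet> h)) (at x)"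
      using has_derivative_compose[OF cz G(1)] I x by (simp add: inner_prod_def)
    show "((\<lambda>x. snd (G (y, x))) has_derivative (\<lambda>h. snd (H (y, x) (0, h)))) (at x)"
      using has_derivative_compose[OF cz G(2)] I x by (intro has_derivative_snd) auto
  qed
  from qr[OF z this] L_y_eq[OF I, of "\<lambda>s. w (s, z)" "\<lambda>s. fst (G (s, z))", OF 1 2 A B, of \<epsilon>]
  show ?thesis
    unfolding elliptic_op_cyl by (simp add: algebra_simps)
qed

end

lemma compact_continuous_bound:
  fixes f :: "'a::topological_space \<Rightarrow> real"
  assumes "compact S" "continuous_on S f"
  obtains C where "\<And>x. x \<in> S \<Longrightarrow> \<bar>f x\<bar> \<le> C"
proof -
  have "bounded (f ` S)" using assms by (intro compact_imp_bounded compact_continuous_image)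
  then show ?thesis using that by (auto simp: bounded_iff)
qed

lemma periodic_add_of_int:
  fixes f :: "'a::real_vector \<Rightarrow> 'b"
  assumes "\<And>z. f (z + e) = f z"
  shows "f (z + of_int n *\<^sub>R e) = f z"
proof -
  have nat: "f (z + real k *\<^sub>R e) = f z" for z k
  proof (induction k)
    case (Suc k)
    have "f (z + real (Suc k) *\<^sub>R e) = f ((z + real k *\<^sub>R e) + e)"
      by (simp add: algebra_simps)
    then show ?case using assms Suc by simp
  qed simp
  show ?thesis
  proof (cases n rule: int_cases2)
    case (nonneg k)
    then show ?thesis using nat by simp
  next
    case (nonpos k)
    then show ?thesis using nat[of "z - real k *\<^sub>R e" k] by simp
  qed
qed

context cross_section
begin

text \<open>
  The lifted torus is not compact, but one translation by a lattice vector moves a point into the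
  unit cube for all periodic functions simultaneously.  Hence a ratio of two periodic functions
  attains its extrema.
\<close>

lemma compact_representatives:
  obtains C where "compact C" "C \<subseteq> closure \<Omega>" "C \<noteq> {}"
    "\<And>z. z \<in> closure \<Omega> \<Longrightarrow> \<exists>z'\<in>C. \<forall>f :: real^'n \<Rightarrow> real. periodic_section Z f \<longrightarrow> f z' = f z"
proof (cases Z)
  case Torus
  let ?C = "cbox 0 One :: (real^'n) set"
  have rep: "\<exists>z'\<in>?C. \<forall>f :: real^'n \<Rightarrow> real. periodic_section Z f \<longrightarrow> f z' = f z" for z :: "real^'n"
  proof -
    define z' where "z' = z + (\<Sum>e\<in>Basis. of_int (- \<lfloor>z \<bullet> e\<rfloor>) *\<^sub>R e)"
    have "z' \<bullet> e = frac (z \<bullet> e)" if "e \<in> Basis" for e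
      using that by (simp add: z'_def inner_add_left inner_diff_left frac_def sum_negf)
    then have "z' \<in> ?C" by (auto simp: mem_box intro: less_imp_le[OF frac_lt_1])
    moreover have "f z' = f z" if f: "periodic_section Z f" for f :: "real^'n \<Rightarrow> real"
    proof -
      have "f (z + (\<Sum>e\<in>B. of_int (- \<lfloor>z \<bullet> e\<rfloor>) *\<^sub>R e)) = f z" if "finite B" "B \<subseteq> Basis" for B
        using that
      proof (induction B rule: finite_induct)
        case (insert e B)
        have "f (z + (\<Sum>e\<in>insert e B. of_int (- \<lfloor>z \<bullet> e\<rfloor>) *\<^sub>R e)) =
            f ((z + (\<Sum>e\<in>B. of_int (- \<lfloor>z \<bullet> e\<rfloor>) *\<^sub>R e)) + of_int (- \<lfloor>z \<bullet> e\<rfloor>) *\<^sub>R e)"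
          using insert.hyps by (simp add: algebra_simps)
        also have "\<dots> = f (z + (\<Sum>e\<in>B. of_int (- \<lfloor>z \<bullet> e\<rfloor>) *\<^sub>R e))"
          using f Torus insert.prems by (intro periodic_add_of_int) auto
        finally show ?case using insert by simp
      qed simp
      then show ?thesis unfolding z'_def by simp
    qed
    ultimately show ?thesis by blast
  qed
  show ?thesis
    by (rule that[of ?C]) (use Torus rep in \<open>auto simp: box_ne_empty\<close>)
next
  case (Domain D)
  then have "bounded \<Omega>" "\<Omega> \<noteq> {}" using admissible by auto
  then show ?thesis
    by (intro that[of "closure \<Omega>"]) (auto simp: compact_closure)
qed

text \<open>
  The class of functions admitted in the comparison argument.  At a boundary point, \<open>g\<close> represents
  a derivative relative to the closed cylinder.
\<close>
definition neumann_field :: "(real \<times> (real^'n) \<Rightarrow> real) \<Rightarrow> bool" where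
  "neumann_field w \<longleftrightarrow>
     (\<exists>G H. jet2 (UNIV \<times> \<Omega>) w G H) \<and> continuous_on (UNIV \<times> closure \<Omega>) w \<and>
     (\<forall>y z \<nu>. outward_unit_normal \<Omega> z \<nu> \<longrightarrow>
        (\<exists>g. (w has_derivative (\<lambda>h. g \<bullet> h)) (at (y, z) within UNIV \<times> closure \<Omega>) \<and>
             \<nu> \<bullet> (a z *v snd g) = 0)) \<and>
     (\<forall>y. periodic_section Z (\<lambda>z. w (y, z)))"

definition section_field :: "(real^'n \<Rightarrow> real) \<Rightarrow> bool" where
  "section_field \<psi> \<longleftrightarrow>
     (\<exists>G H. jet2 \<Omega> \<psi> G H) \<and> continuous_on (closure \<Omega>) \<psi> \<and>
     (\<forall>z \<nu>. outward_unit_normal \<Omega> z \<nu> \<longrightarrow>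
        (\<exists>g. (\<psi> has_derivative (\<lambda>h. g \<bullet> h)) (at z within closure \<Omega>) \<and> \<nu> \<bullet> (a z *v g) = 0)) \<and>
     periodic_section Z \<psi>"

definition section_solution :: "(real^'n \<Rightarrow> real) \<Rightarrow> real \<Rightarrow> (real^'n \<Rightarrow> real) \<Rightarrow> bool" where
  "section_solution V k \<psi> \<longleftrightarrow>
     section_field \<psi> \<and> (\<forall>z\<in>\<Omega>. 0 < \<psi> z \<and> L_z a b \<psi> z = (k - V z) * \<psi> z)"

lemma periodic_section_lincomb:
  "periodic_section Z' u \<Longrightarrow> periodic_section Z' v \<Longrightarrow>
    periodic_section Z' (\<lambda>z. s * u z + t * v z :: real)"
  by (cases Z') auto

lemma neumann_field_lincomb:
  assumes "neumann_field u" "neumann_field v"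
  shows "neumann_field (\<lambda>p. s * u p + t * v p)"
  unfolding neumann_field_def
proof (intro conjI allI impI)
  show "\<exists>G H. jet2 (UNIV \<times> \<Omega>) (\<lambda>p. s * u p + t * v p) G H"
    using assms jet2_lincomb unfolding neumann_field_def by blast
  show "continuous_on (UNIV \<times> closure \<Omega>) (\<lambda>p. s * u p + t * v p)"
    using assms unfolding neumann_field_def by (intro continuous_intros) auto
  show "periodic_section Z (\<lambda>z. s * u (y, z) + t * v (y, z))" for y
    using assms unfolding neumann_field_def by (intro periodic_section_lincomb) auto
  fix y z \<nu> assume \<nu>: "outward_unit_normal \<Omega> z \<nu>"
  obtain g g' where g: "(u has_derivative (\<lambda>h. g \<bullet> h)) (at (y, z) within UNIV \<times> closure \<Omega>)"
      "\<nu> \<bullet> (a z *v snd g) = 0"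
    and g': "(v has_derivative (\<lambda>h. g' \<bullet> h)) (at (y, z) within UNIV \<times> closure \<Omega>)"
      "\<nu> \<bullet> (a z *v snd g') = 0"
    using assms \<nu> unfolding neumann_field_def by blast
  show "\<exists>g. ((\<lambda>p. s * u p + t * v p) has_derivative (\<lambda>h. g \<bullet> h)) (at (y, z) within UNIV \<times> closure \<Omega>) \<and>
      \<nu> \<bullet> (a z *v snd g) = 0"
  proof (intro exI[of _ "s *\<^sub>R g + t *\<^sub>R g'"] conjI)
    show "((\<lambda>p. s * u p + t * v p) has_derivative (\<lambda>h. (s *\<^sub>R g + t *\<^sub>R g') \<bullet> h))
        (at (y, z) within UNIV \<times> closure \<Omega>)"
      using has_derivative_add[OF has_derivative_mult_right[OF g(1), of s]
          has_derivative_mult_right[OF g'(1), of t]]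
      by (simp add: inner_add_left)
    show "\<nu> \<bullet> (a z *v snd (s *\<^sub>R g + t *\<^sub>R g')) = 0"
      using g(2) g'(2)
      by (simp add: matrix_vector_right_distrib matrix_vector_mult_scaleR inner_add_right)
  qed
qed

lemma neumann_field_mult:
  assumes s: "\<And>y. (s has_real_derivative s' y) (at y)" "\<And>y. (s' has_real_derivative s2 y) (at y)"
    and \<psi>: "section_field \<psi>"
  shows "neumann_field (\<lambda>p. s (fst p) * \<psi> (snd p))"
  unfolding neumann_field_def
proof (intro conjI allI impI)
  obtain G H where jet: "jet2 \<Omega> \<psi> G H" using \<psi> by (auto simp: section_field_def)
  have G: "(\<psi> has_derivative (\<lambda>h. G x \<bullet> h)) (at x)" "(G has_derivative H x) (at x)" if "x \<in> \<Omega>" for x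
    using jet that by (auto simp: jet2_def)
  have fst': "(fst has_derivative fst) (at p within T)" for p :: "real \<times> (real^'n)" and T
    by (rule has_derivative_fst[OF has_derivative_ident])
  have s_fst: "((\<lambda>p. s (fst p)) has_derivative (\<lambda>h. fst h * s' (fst p))) (at p within T)"
    for p :: "real \<times> (real^'n)" and T
  proof -
    have "(s has_derivative (\<lambda>h. h * s' (fst p))) (at (fst p))"
      using s(1)[of "fst p"] by (simp add: has_field_derivative_def mult_commute_abs)
    from has_derivative_compose[OF fst' this] show ?thesis .
  qed
  have s'_fst: "((\<lambda>p. s' (fst p)) has_derivative (\<lambda>h. fst h * s2 (fst p))) (at p within T)"
    for p :: "real \<times> (real^'n)" and T
  proof -
    have "(s' has_derivative (\<lambda>h. h * s2 (fst p))) (at (fst p))"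
      using s(2)[of "fst p"] by (simp add: has_field_derivative_def mult_commute_abs)
    from has_derivative_compose[OF fst' this] show ?thesis .
  qed
  have snd': "(snd has_derivative snd) (at p within T)" for p :: "real \<times> (real^'n)" and T
    by (rule has_derivative_snd[OF has_derivative_ident])
  show "\<exists>G H. jet2 (UNIV \<times> \<Omega>) (\<lambda>p. s (fst p) * \<psi> (snd p)) G H"
  proof (intro exI)
    show "jet2 (UNIV \<times> \<Omega>) (\<lambda>p. s (fst p) * \<psi> (snd p))
        (\<lambda>p. (s' (fst p) * \<psi> (snd p), s (fst p) *\<^sub>R G (snd p)))
        (\<lambda>p h. (s' (fst p) * (G (snd p) \<bullet> snd h) + (fst h * s2 (fst p)) * \<psi> (snd p),
                s (fst p) *\<^sub>R H (snd p) (snd h) + (fst h * s' (fst p)) *\<^sub>R G (snd p)))"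
      unfolding jet2_def
    proof (intro ballI conjI)
      fix p :: "real \<times> (real^'n)" assume "p \<in> UNIV \<times> \<Omega>"
      then have p: "snd p \<in> \<Omega>" by auto
      note \<psi>_snd = has_derivative_compose[OF snd'[of p UNIV] G(1)[OF p]]
      note G_snd = has_derivative_compose[OF snd'[of p UNIV] G(2)[OF p]]
      have "((\<lambda>p. s (fst p) * \<psi> (snd p)) has_derivative
          (\<lambda>h. s (fst p) * (G (snd p) \<bullet> snd h) + (fst h * s' (fst p)) * \<psi> (snd p))) (at p)"
        by (rule has_derivative_mult[OF s_fst \<psi>_snd])
      then show "((\<lambda>p. s (fst p) * \<psi> (snd p)) has_derivative
          (\<lambda>h. (s' (fst p) * \<psi> (snd p), s (fst p) *\<^sub>R G (snd p)) \<bullet> h)) (at p)"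
        by (simp add: inner_prod_def algebra_simps)
      show "((\<lambda>p. (s' (fst p) * \<psi> (snd p), s (fst p) *\<^sub>R G (snd p))) has_derivative
          (\<lambda>h. (s' (fst p) * (G (snd p) \<bullet> snd h) + (fst h * s2 (fst p)) * \<psi> (snd p),
                s (fst p) *\<^sub>R H (snd p) (snd h) + (fst h * s' (fst p)) *\<^sub>R G (snd p)))) (at p)"
        by (intro has_derivative_Pair has_derivative_mult[OF s'_fst \<psi>_snd]
            has_derivative_scaleR[OF s_fst G_snd])
    qed
  qed
  have "continuous_on UNIV s" using s(1) by (meson DERIV_continuous_on has_field_derivative_at_within)
  then show "continuous_on (UNIV \<times> closure \<Omega>) (\<lambda>p. s (fst p) * \<psi> (snd p))"
    using \<psi> unfolding section_field_def
    by (intro continuous_on_mult continuous_on_compose2[of UNIV s _ fst]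
        continuous_on_compose2[of "closure \<Omega>" \<psi> _ snd] continuous_on_fst continuous_on_snd
        continuous_on_id) auto
  show "periodic_section Z (\<lambda>z. s (fst (y, z)) * \<psi> (snd (y, z)))" for y
    using \<psi> unfolding section_field_def by (cases Z) auto
  fix y :: real and z \<nu> assume \<nu>: "outward_unit_normal \<Omega> z \<nu>"
  obtain g where g: "(\<psi> has_derivative (\<lambda>h. g \<bullet> h)) (at z within closure \<Omega>)" "\<nu> \<bullet> (a z *v g) = 0"
    using \<psi> \<nu> unfolding section_field_def by blast
  let ?W = "UNIV \<times> closure \<Omega> :: (real \<times> (real^'n)) set"
  have "snd ` ?W = closure \<Omega>" by auto
  then have g': "(\<psi> has_derivative (\<lambda>h. g \<bullet> h)) (at (snd (y, z)) within snd ` ?W)" using g by simp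
  have "((\<lambda>p. \<psi> (snd p)) has_derivative (\<lambda>h. g \<bullet> snd h)) (at (y, z) within ?W)"
    using diff_chain_within[OF snd' g'] by (simp add: o_def)
  from has_derivative_mult[OF s_fst this]
  have "((\<lambda>p. s (fst p) * \<psi> (snd p)) has_derivative (\<lambda>h. (s' y * \<psi> z, s y *\<^sub>R g) \<bullet> h)) (at (y, z) within ?W)"
    by (simp add: inner_prod_def algebra_simps)
  moreover have "\<nu> \<bullet> (a z *v snd (s' y * \<psi> z, s y *\<^sub>R g)) = 0"
    using g(2) by (simp add: matrix_vector_mult_scaleR)
  ultimately show "\<exists>g. ((\<lambda>p. s (fst p) * \<psi> (snd p)) has_derivative (\<lambda>h. g \<bullet> h)) (at (y, z) within ?W) \<and>
      \<nu> \<bullet> (a z *v snd g) = 0" by blast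
qed

end

section \<open>Strict positivity up to the boundary\<close>

locale cylinder = cross_section \<alpha> Z a b m
  for \<alpha> :: real and Z :: "(real^'n) section_space"
    and a :: "real^'n \<Rightarrow> real^'n^'n" and b :: "real^'n \<Rightarrow> real^'n" and m :: real +
  fixes A A' B B' :: "real \<Rightarrow> real" and \<epsilon> lo :: real
  assumes A': "\<And>y. (A has_real_derivative A' y) (at y)" and A'_cont: "continuous_on UNIV A'"
    and B': "\<And>y. (B has_real_derivative B' y) (at y)" and B'_cont: "continuous_on UNIV B'"
    and A_ge: "\<And>y. lo \<le> A y" and lo_pos: "0 < lo" and \<epsilon>_pos: "0 < \<epsilon>"
begin

definition cyl_op :: "(real \<times> (real^'n) \<Rightarrow> real) \<Rightarrow> real \<Rightarrow> real^'n \<Rightarrow> real" where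
  "cyl_op w y z = L_y A B \<epsilon> (\<lambda>s. w (s, z)) y + L_z a b (\<lambda>x. w (y, x)) z"

lemma cyl_op_eq_elliptic_op:
  obtains q :: "real^'n \<Rightarrow> real^'n" and r :: "real^'n \<Rightarrow> real" where
    "continuous_on (closure \<Omega>) q" "continuous_on (closure \<Omega>) r"
    "\<And>w G H y z. z \<in> \<Omega> \<Longrightarrow> jet2 (UNIV \<times> \<Omega>) w G H \<Longrightarrow>
       cyl_op w y z = elliptic_op (cyl_matrix \<epsilon> A a (y, z)) (\<epsilon>\<^sup>2 * A' y + \<epsilon> * B y, q z)
         (\<epsilon> * B' y + r z) (w (y, z)) (G (y, z)) (H (y, z))"
proof -
  obtain q r where qr: "continuous_on (closure \<Omega>) q" "continuous_on (closure \<Omega>) r"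
    "\<And>u G H z. z \<in> \<Omega> \<Longrightarrow> jet2 \<Omega> u G H \<Longrightarrow>
       L_z a b u z = elliptic_op (\<lambda>\<xi>. a z *v \<xi>) (q z) (r z) (u z) (G z) (H z)"
    using L_z_eq_elliptic_op by metis
  show ?thesis
  proof (rule that[OF qr(1,2)])
    fix w :: "real \<times> (real^'n) \<Rightarrow> real" and G H y z assume "z \<in> \<Omega>" "jet2 (UNIV \<times> \<Omega>) w G H"
    then show "cyl_op w y z = elliptic_op (cyl_matrix \<epsilon> A a (y, z)) (\<epsilon>\<^sup>2 * A' y + \<epsilon> * B y, q z)
         (\<epsilon> * B' y + r z) (w (y, z)) (G (y, z)) (H (y, z))"
      unfolding cyl_op_def by (intro operator_eq_elliptic_op_cyl[of UNIV] A' B' qr(3)) auto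
  qed
qed

lemma cyl_op_lincomb:
  assumes "neumann_field u" "neumann_field v" and z: "z \<in> \<Omega>"
  shows "cyl_op (\<lambda>p. s * u p + t * v p) y z = s * cyl_op u y z + t * cyl_op v y z"
proof -
  obtain G H G' H' where jets: "jet2 (UNIV \<times> \<Omega>) u G H" "jet2 (UNIV \<times> \<Omega>) v G' H'"
    using assms by (auto simp: neumann_field_def)
  obtain q r where eq: "\<And>w G H y z. z \<in> \<Omega> \<Longrightarrow> jet2 (UNIV \<times> \<Omega>) w G H \<Longrightarrow>
       cyl_op w y z = elliptic_op (cyl_matrix \<epsilon> A a (y, z)) (\<epsilon>\<^sup>2 * A' y + \<epsilon> * B y, q z)
         (\<epsilon> * B' y + r z) (w (y, z)) (G (y, z)) (H (y, z))"
    using cyl_op_eq_elliptic_op by metis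
  show ?thesis
    unfolding eq[OF z jets(1)] eq[OF z jets(2)] eq[OF z jet2_lincomb[OF jets]]
    by (rule elliptic_op_lincomb)
qed

lemma cyl_op_mult:
  assumes s: "\<And>y. (s has_real_derivative s' y) (at y)" "\<And>y. (s' has_real_derivative s2 y) (at y)"
    and \<psi>: "section_field \<psi>" and z: "z \<in> \<Omega>"
  shows "cyl_op (\<lambda>p. s (fst p) * \<psi> (snd p)) y z =
    (\<epsilon>\<^sup>2 * (A y * s2 y + A' y * s' y) + \<epsilon> * (s' y * B y + s y * B' y)) * \<psi> z + s y * L_z a b \<psi> z"
proof -
  obtain G H where jet: "jet2 \<Omega> \<psi> G H" using \<psi> by (auto simp: section_field_def)
  obtain q r where qr: "\<And>u G H z. z \<in> \<Omega> \<Longrightarrow> jet2 \<Omega> u G H \<Longrightarrow>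
       L_z a b u z = elliptic_op (\<lambda>\<xi>. a z *v \<xi>) (q z) (r z) (u z) (G z) (H z)"
    using L_z_eq_elliptic_op by metis
  have "L_z a b (\<lambda>x. s y * \<psi> x + 0 * \<psi> x) z = s y * L_z a b \<psi> z"
    unfolding qr[OF z jet] qr[OF z jet2_lincomb[OF jet jet]] elliptic_op_lincomb by simp
  moreover have "L_y A B \<epsilon> (\<lambda>t. s t * \<psi> z) y =
      \<epsilon>\<^sup>2 * (A y * (s2 y * \<psi> z) + A' y * (s' y * \<psi> z)) + \<epsilon> * (s' y * \<psi> z * B y + s y * \<psi> z * B' y)"
    using s by (intro L_y_eq[of UNIV y "\<lambda>t. s t * \<psi> z" "\<lambda>t. s' t * \<psi> z"] A' B')
      (auto intro: DERIV_cmult_right)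
  ultimately show ?thesis by (simp add: cyl_op_def algebra_simps)
qed

text \<open>
  A zero in the interior is a minimum, where the operator is nonnegative, against the strict
  inequality assumed at zeros.  So \<open>w\<close> is positive in the interior, and the Hopf lemma together
  with the Neumann condition excludes a zero on the boundary.  The statement is local in \<open>y\<close>, because
  the test functions are controlled only in windows.
\<close>

lemma strict_positivity:
  assumes w: "neumann_field w" and \<rho>: "\<rho> > 0"
    and nonneg: "\<And>y z. \<bar>y - y0\<bar> < \<rho> \<Longrightarrow> z \<in> closure \<Omega> \<Longrightarrow> 0 \<le> w (y, z)"
    and ineq: "\<And>y z. \<bar>y - y0\<bar> < \<rho> \<Longrightarrow> z \<in> \<Omega> \<Longrightarrow> cyl_op w y z \<le> K * w (y, z)"
    and strict: "\<And>y z. \<bar>y - y0\<bar> < \<rho> \<Longrightarrow> z \<in> \<Omega> \<Longrightarrow> w (y, z) = 0 \<Longrightarrow> cyl_op w y z < 0"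
    and y: "\<bar>y - y0\<bar> < \<rho>" and z: "z \<in> closure \<Omega>"
  shows "0 < w (y, z)"
proof -
  obtain q r where q: "continuous_on (closure \<Omega>) q" and r: "continuous_on (closure \<Omega>) r"
    and eq: "\<And>w G H y z. z \<in> \<Omega> \<Longrightarrow> jet2 (UNIV \<times> \<Omega>) w G H \<Longrightarrow>
       cyl_op w y z = elliptic_op (cyl_matrix \<epsilon> A a (y, z)) (\<epsilon>\<^sup>2 * A' y + \<epsilon> * B y, q z)
         (\<epsilon> * B' y + r z) (w (y, z)) (G (y, z)) (H (y, z))"
    using cyl_op_eq_elliptic_op by metis
  obtain G H where jet: "jet2 (UNIV \<times> \<Omega>) w G H"
    using w by (auto simp: neumann_field_def)
  define P where "P = cyl_matrix \<epsilon> A a"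
  define Q where "Q = (\<lambda>p. (\<epsilon>\<^sup>2 * A' (fst p) + \<epsilon> * B (fst p), q (snd p)))"
  define R' where "R' = (\<lambda>p. \<epsilon> * B' (fst p) + r (snd p))"
  have op: "cyl_op w y z = elliptic_op (P (y, z)) (Q (y, z)) (R' (y, z)) (w (y, z)) (G (y, z)) (H (y, z))"
    if "z \<in> \<Omega>" for y z
    unfolding eq[OF that jet] by (simp add: P_def Q_def R'_def)
  define m' where "m' = min (\<epsilon>\<^sup>2 * lo) m"
  have m': "m' > 0" using \<epsilon>_pos lo_pos m_pos by (simp add: m'_def)
  have P_ell: "elliptic_matrix (P (y, z)) m'" if "z \<in> closure \<Omega>" for y z
  proof -
    have "\<epsilon>\<^sup>2 * lo \<le> \<epsilon>\<^sup>2 * A y" using A_ge by (intro mult_left_mono) auto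
    then show ?thesis unfolding P_def using that by (intro elliptic_matrix_cyl) (auto simp: m'_def)
  qed
  have interior: "0 < w (y, z)" if y: "\<bar>y - y0\<bar> < \<rho>" and z: "z \<in> \<Omega>" for y z
  proof (rule ccontr)
    assume "\<not> 0 < w (y, z)"
    moreover have zc: "z \<in> closure \<Omega>" using z closure_subset by auto
    ultimately have w0: "w (y, z) = 0" using nonneg[OF y zc] by simp
    let ?S = "ball y0 \<rho> \<times> \<Omega>"
    have S: "open ?S" "(y, z) \<in> ?S" using y z open_\<Omega> by (auto intro: open_Times simp: dist_real_def)
    have "w (y, z) \<le> w p" if "p \<in> ?S" for p
      using that nonneg[of "fst p" "snd p"] w0 closure_subset[of \<Omega>] by (auto simp: dist_real_def)
    then have "R' (y, z) * w (y, z) \<le> cyl_op w y z"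
      unfolding op[OF z] using S jet2_subset[OF jet, of ?S] P_ell[OF zc, of y] m'
      by (intro elliptic_op_at_minimum[of ?S]) auto
    with strict[OF y z w0] w0 show False by simp
  qed
  show ?thesis
  proof (cases "z \<in> \<Omega>")
    case True
    then show ?thesis using interior y by blast
  next
    case False
    then have zf: "z \<in> frontier \<Omega>" using z open_\<Omega> by (simp add: frontier_def interior_open)
    then have "holder_boundary 2 \<alpha> \<Omega>" using admissible by (cases Z) auto
    moreover have "\<rho> - \<bar>y - y0\<bar> > 0" using y by simp
    ultimately obtain R \<nu> where R: "0 < R" "R < \<rho> - \<bar>y - y0\<bar>" and \<nu>: "norm \<nu> = 1"
      "outward_unit_normal \<Omega> z \<nu>" and ball: "ball (z - R *\<^sub>R \<nu>) R \<subseteq> \<Omega>"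
      using interior_ball_at_frontier[OF open_\<Omega> _ zf] by metis
    define x1 where "x1 = (y, z) - R *\<^sub>R (0, \<nu>)"
    have cball: "cball (z - R *\<^sub>R \<nu>) R \<subseteq> closure \<Omega>"
      using closure_mono[OF ball] R by simp
    have in_cyl: "\<bar>fst p - y0\<bar> < \<rho> \<and> snd p \<in> closure \<Omega>" if "p \<in> cball x1 R" for p
    proof -
      have "dist (fst x1) (fst p) \<le> R" "dist (snd x1) (snd p) \<le> R"
        using that dist_fst_le[of x1 p] dist_snd_le[of x1 p] by auto
      then show ?thesis using cball R by (auto simp: x1_def dist_real_def)
    qed
    have in_cyl': "\<bar>fst p - y0\<bar> < \<rho> \<and> snd p \<in> \<Omega>" if "p \<in> ball x1 R" for p
    proof -
      have "dist (snd x1) (snd p) < R"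
        using that dist_snd_le[of x1 p] by auto
      then show ?thesis using ball in_cyl[of p] that by (auto simp: x1_def)
    qed
    have Rcomp: "compact (cball x1 R)" by simp
    have snd_in: "snd ` cball x1 R \<subseteq> closure \<Omega>" using in_cyl by auto
    have A_cont: "continuous_on UNIV A" and B_cont: "continuous_on UNIV B"
      using A' B' by (meson DERIV_continuous_on has_field_derivative_at_within)+
    have f_cont: "continuous_on (cball x1 R) (\<lambda>p. f (fst p))" if "continuous_on UNIV f" for f :: "real \<Rightarrow> real"
      using that by (intro continuous_on_compose2[of UNIV f _ fst] continuous_on_fst continuous_on_id) auto
    have g_cont: "continuous_on (cball x1 R) (\<lambda>p. f (snd p))"
      if "continuous_on (closure \<Omega>) f" for f :: "real^'n \<Rightarrow> 'z::topological_space"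
      using that snd_in by (intro continuous_on_compose2[of "closure \<Omega>" f _ snd] continuous_on_snd continuous_on_id) auto
    have a_cont: "continuous_on (closure \<Omega>) a"
      using a_holder \<alpha>_pos by (rule holder_space_continuous_on)
    have "continuous_on (cball x1 R) (\<lambda>p. \<Sum>e\<in>Basis. P p e \<bullet> e)"
      unfolding P_def cyl_matrix_def inner_prod_def
      by (simp, intro continuous_intros f_cont A_cont g_cont[OF a_cont]
          bounded_bilinear.continuous_on[OF bounded_bilinear_matrix_vector_mult])
    then obtain C1 where C1: "\<And>p. p \<in> cball x1 R \<Longrightarrow> \<bar>\<Sum>e\<in>Basis. P p e \<bullet> e\<bar> \<le> C1"
      by (rule compact_continuous_bound[OF Rcomp]) blast
    have "continuous_on (cball x1 R) (\<lambda>p. norm (Q p))"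
      unfolding Q_def by (intro continuous_intros f_cont A'_cont B_cont g_cont[OF q])
    then obtain C2 where C2: "\<And>p. p \<in> cball x1 R \<Longrightarrow> \<bar>norm (Q p)\<bar> \<le> C2"
      by (rule compact_continuous_bound[OF Rcomp]) blast
    have "continuous_on (cball x1 R) R'"
      unfolding R'_def by (intro continuous_intros f_cont B'_cont g_cont[OF r])
    then obtain C3 where C3: "\<And>p. p \<in> cball x1 R \<Longrightarrow> \<bar>R' p\<bar> \<le> C3"
      by (rule compact_continuous_bound[OF Rcomp]) blast
    define C where "C = max C1 (max C2 C3)"
    obtain g where g: "(w has_derivative (\<lambda>h. g \<bullet> h)) (at (y, z) within UNIV \<times> closure \<Omega>)"
      "\<nu> \<bullet> (a z *v snd g) = 0"
      using w \<nu>(2) unfolding neumann_field_def by blast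
    show ?thesis
    proof (rule ccontr)
      assume "\<not> 0 < w (y, z)"
      then have w0: "w (y, z) = 0" using nonneg[OF y z] by simp
      show False
      proof (rule no_boundary_zero_with_conormal_condition[OF R(1) _ x1_def])
        show "norm (0::real, \<nu>) = 1" using \<nu> by (simp add: norm_prod_def)
        show "jet2 (ball x1 R) w G H" using jet by (rule jet2_subset) (use in_cyl' in auto)
        show "continuous_on (cball x1 R) w"
          using w unfolding neumann_field_def by (auto elim!: continuous_on_subset dest: in_cyl)
        show "0 < w p" if "p \<in> ball x1 R" for p
          using interior[of "fst p" "snd p"] in_cyl'[OF that] by simp
        show "0 \<le> w p" if "p \<in> cball x1 R" for p
          using nonneg[of "fst p" "snd p"] in_cyl[OF that] by simp
        show "w (y, z) = 0" by (rule w0)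
        show "0 < m'" by (rule m')
        show "elliptic_matrix (P p) m'" if "p \<in> ball x1 R" for p
          using P_ell[of "snd p" "fst p"] in_cyl[of p] that by simp
        show "(\<Sum>e\<in>Basis. P p e \<bullet> e) \<le> C \<and> norm (Q p) \<le> C \<and> \<bar>R' p\<bar> \<le> C" if "p \<in> ball x1 R" for p
          using C1[of p] C2[of p] C3[of p] that by (auto simp: C_def abs_le_iff)
        show "elliptic_op (P p) (Q p) (R' p) (w p) (G p) (H p) \<le> K * w p" if "p \<in> ball x1 R" for p
          using op[of "snd p" "fst p"] ineq[of "fst p" "snd p"] in_cyl'[OF that] by simp
        show "(w has_derivative (\<lambda>h. g \<bullet> h)) (at (y, z) within UNIV \<times> closure \<Omega>)" by (rule g(1))
        show "ball x1 R \<subseteq> UNIV \<times> closure \<Omega>"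
        proof
          fix p assume "p \<in> ball x1 R"
          then show "p \<in> UNIV \<times> closure \<Omega>" using in_cyl[of p] by (cases p) auto
        qed
        show "elliptic_matrix (P (y, z)) m'" by (rule P_ell[OF z])
        show "(0, \<nu>) \<bullet> P (y, z) g = 0" using g(2) by (simp add: P_def cyl_matrix_def inner_prod_def)
      qed
    qed
  qed
qed

end

context cross_section
begin

definition cyl_solution ::
  "(real \<Rightarrow> real) \<Rightarrow> (real \<Rightarrow> real) \<Rightarrow> real \<Rightarrow> (real \<times> (real^'n) \<Rightarrow> real) \<Rightarrow> real \<Rightarrow>
   (real \<times> (real^'n) \<Rightarrow> real) \<Rightarrow> bool" where
  "cyl_solution A B \<epsilon> c k \<phi> \<longleftrightarrow>
     neumann_field \<phi> \<and> (\<forall>y. \<forall>z\<in>\<Omega>. 0 < \<phi> (y, z) \<and>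
       L_y A B \<epsilon> (\<lambda>s. \<phi> (s, z)) y + L_z a b (\<lambda>x. \<phi> (y, x)) z = (k - c (y, z)) * \<phi> (y, z))"

lemma neumann_field_continuous_slice:
  assumes "neumann_field w"
  shows "continuous_on (closure \<Omega>) (\<lambda>z. w (y, z))"
  using assms unfolding neumann_field_def
  by (intro continuous_on_compose2[of "UNIV \<times> closure \<Omega>" w _ "\<lambda>z. (y, z)"] continuous_intros) auto

end

context cylinder
begin

text \<open>
  The eigenvalue problem gives positivity in the open cylinder only; ratios with \<open>\<phi>\<close> in the
  denominator require it on the closure.
\<close>

lemma cyl_solution_pos:
  assumes \<phi>: "cyl_solution A B \<epsilon> c k \<phi>"
    and c: "\<And>y z. z \<in> closure \<Omega> \<Longrightarrow> \<bar>c (y, z)\<bar> \<le> C" and z: "z \<in> closure \<Omega>"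
  shows "0 < \<phi> (y, z)"
proof (rule strict_positivity[of \<phi> 1 y "\<bar>k\<bar> + C"])
  show nf: "neumann_field \<phi>" using \<phi> by (simp add: cyl_solution_def)
  show ge: "0 \<le> \<phi> (y', z')" if "z' \<in> closure \<Omega>" for y' z'
    by (rule continuous_ge_on_closure[OF neumann_field_continuous_slice[OF nf] that])
       (use \<phi> in \<open>auto simp: cyl_solution_def intro: less_imp_le\<close>)
  have op: "cyl_op \<phi> y' z' = (k - c (y', z')) * \<phi> (y', z')" "0 < \<phi> (y', z')" if "z' \<in> \<Omega>" for y' z'
    using \<phi> that by (auto simp: cyl_solution_def cyl_op_def)
  show "cyl_op \<phi> y' z' \<le> (\<bar>k\<bar> + C) * \<phi> (y', z')" if "z' \<in> \<Omega>" for y' z'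
  proof -
    have "z' \<in> closure \<Omega>" using that closure_subset by auto
    then have "k - c (y', z') \<le> \<bar>k\<bar> + C" using c[of z' y'] by linarith
    then show ?thesis using op[OF that] by (auto intro: mult_right_mono less_imp_le)
  qed
  show "cyl_op \<phi> y' z' < 0" if "z' \<in> \<Omega>" "\<phi> (y', z') = 0" for y' z'
    using op(2)[OF that(1), of y'] that(2) by simp
qed (use z in auto)

end

context cross_section
begin

text \<open>
  A function on the cross-section, extended constantly along \<open>y\<close>, solves a problem on the
  cylinder with \<open>A = 1\<close> and \<open>B = 0\<close>.  In this way the results for the cylinder also apply to the
  local problem.
\<close>

lemma constant_cylinder: "cylinder \<alpha> Z a b m (\<lambda>_. 1) (\<lambda>_. 0) (\<lambda>_. 0) (\<lambda>_. 0) 1 1"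
  by unfold_locales auto

lemma section_solution_imp_cyl_solution:
  assumes \<psi>: "section_solution V k \<psi>"
  shows "cyl_solution (\<lambda>_. 1) (\<lambda>_. 0) 1 (\<lambda>p. V (snd p)) k (\<lambda>p. 1 * \<psi> (snd p))"
proof -
  interpret c1: cylinder \<alpha> Z a b m "\<lambda>_. 1" "\<lambda>_. 0" "\<lambda>_. 0" "\<lambda>_. 0" 1 1 by (rule constant_cylinder)
  have sf: "section_field \<psi>" using \<psi> by (simp add: section_solution_def)
  note s = DERIV_const[of "1::real"] DERIV_const[of "0::real"]
  have "neumann_field (\<lambda>p. 1 * \<psi> (snd p))" by (rule neumann_field_mult[OF s sf])
  moreover have "c1.cyl_op (\<lambda>p. 1 * \<psi> (snd p)) y z = L_z a b \<psi> z" if "z \<in> \<Omega>" for y z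
    using c1.cyl_op_mult[OF s sf that, of y] by simp
  ultimately show ?thesis
    using \<psi> unfolding cyl_solution_def section_solution_def c1.cyl_op_def by auto
qed

lemma section_solution_pos:
  assumes \<psi>: "section_solution V k \<psi>" and V: "\<And>z. z \<in> closure \<Omega> \<Longrightarrow> \<bar>V z\<bar> \<le> C"
    and z: "z \<in> closure \<Omega>"
  shows "0 < \<psi> z"
proof -
  interpret c1: cylinder \<alpha> Z a b m "\<lambda>_. 1" "\<lambda>_. 0" "\<lambda>_. 0" "\<lambda>_. 0" 1 1 by (rule constant_cylinder)
  show ?thesis
    using c1.cyl_solution_pos[OF section_solution_imp_cyl_solution[OF \<psi>] _ z, of C 0] V by simp
qed

end

context cylinder
begin

text \<open>
  For \<open>\<sigma> = 1\<close> the functions \<open>s\<^sub>i(y) \<psi>\<^sub>i(z)\<close> are subsolutions at level \<open>lam\<close> in the windows, for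
  \<open>\<sigma> = -1\<close> supersolutions.  Let \<open>t\<close> be the largest (smallest) value of the ratios
  \<open>s\<^sub>i \<psi>\<^sub>i / \<phi>\<close> over all windows.  By \<open>edge\<close> it is attained in the interior of some window, so
  \<open>w = \<sigma> (t \<phi> - s\<^sub>i \<psi>\<^sub>i)\<close> is nonnegative on that window and vanishes at a point.  If \<open>\<sigma> k < \<sigma> lam\<close>,
  then \<open>w\<close> satisfies the hypotheses of \<open>strict_positivity\<close>, a contradiction.
\<close>

lemma comparison:
  fixes I :: "'i set" and s s' s2 :: "'i \<Rightarrow> real \<Rightarrow> real"
  assumes \<phi>: "cyl_solution A B \<epsilon> c k \<phi>"
    and c: "\<And>y z. z \<in> closure \<Omega> \<Longrightarrow> \<bar>c (y, z)\<bar> \<le> C"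
    and I: "finite I" "I \<noteq> {}" and r: "r > 0"
    and s: "\<And>i y. i \<in> I \<Longrightarrow> (s i has_real_derivative s' i y) (at y)"
      "\<And>i y. i \<in> I \<Longrightarrow> (s' i has_real_derivative s2 i y) (at y)"
      "\<And>i y. i \<in> I \<Longrightarrow> 0 < s i y"
    and \<psi>: "\<And>i. i \<in> I \<Longrightarrow> section_solution (V i) (\<kappa> i) (\<psi> i)"
    and V: "\<And>i z. i \<in> I \<Longrightarrow> z \<in> closure \<Omega> \<Longrightarrow> \<bar>V i z\<bar> \<le> C"
    and \<sigma>: "\<sigma> = 1 \<or> \<sigma> = -1"
    and ineq: "\<And>i y z. i \<in> I \<Longrightarrow> \<bar>y - x i\<bar> < r \<Longrightarrow> z \<in> \<Omega> \<Longrightarrow>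
      0 \<le> \<sigma> * (\<epsilon>\<^sup>2 * (A y * s2 i y + A' y * s' i y) + \<epsilon> * (s' i y * B y + s i y * B' y) +
               (\<kappa> i + c (y, z) - V i z - lam) * s i y)"
    and edge: "\<And>i y. i \<in> I \<Longrightarrow> \<bar>y - x i\<bar> = r \<Longrightarrow>
      \<exists>j\<in>I. \<exists>y'. \<bar>y' - x j\<bar> < r \<and>
        (\<forall>z\<in>closure \<Omega>. \<phi> (y', z) = \<phi> (y, z) \<and> \<sigma> * (s i y * \<psi> i z) \<le> \<sigma> * (s j y' * \<psi> j z))"
  shows "\<sigma> * lam \<le> \<sigma> * k"
proof (rule ccontr)
  assume "\<not> \<sigma> * lam \<le> \<sigma> * k"
  then have gap: "0 < \<sigma> * (lam - k)" by (simp add: right_diff_distrib)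
  have \<phi>_pos: "0 < \<phi> (y, z)" if "z \<in> closure \<Omega>" for y z
    using cyl_solution_pos[OF \<phi>] c that by blast
  have \<psi>_pos: "0 < \<psi> i z" if "i \<in> I" "z \<in> closure \<Omega>" for i z
    using section_solution_pos[OF \<psi>] V that by blast
  have nf: "neumann_field \<phi>" using \<phi> by (simp add: cyl_solution_def)
  have sf: "section_field (\<psi> i)" if "i \<in> I" for i using \<psi>[OF that] by (simp add: section_solution_def)
  define F where "F = (\<lambda>i p. \<sigma> * (s i (fst p) * \<psi> i (snd p) / \<phi> p))"
  obtain K where K: "compact K" "K \<subseteq> closure \<Omega>" "K \<noteq> {}"
    and rep: "\<And>z. z \<in> closure \<Omega> \<Longrightarrow> \<exists>z'\<in>K. \<forall>f :: real^'n \<Rightarrow> real. periodic_section Z f \<longrightarrow> f z' = f z"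
    using compact_representatives by metis
  define D where "D = (\<lambda>i. cball (x i) r \<times> K)"
  have "\<exists>p\<in>D i. \<forall>p'\<in>D i. F i p' \<le> F i p" if i: "i \<in> I" for i
  proof (rule continuous_attains_sup)
    show "compact (D i)" unfolding D_def by (intro compact_Times K) simp
    show "D i \<noteq> {}" using K r by (auto simp: D_def)
    have "continuous_on UNIV (s i)" using s(1)[OF i]
      by (meson DERIV_continuous_on has_field_derivative_at_within)
    then show "continuous_on (D i) (F i)"
      unfolding F_def D_def
    proof (intro continuous_on_mult continuous_on_divide continuous_on_const)
      show "continuous_on (cball (x i) r \<times> K) (\<lambda>p. s i (fst p))"
        if "continuous_on UNIV (s i)"
        using that by (intro continuous_on_compose2[of UNIV "s i" _ fst] continuous_on_fst continuous_on_id) auto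
      show "continuous_on (cball (x i) r \<times> K) (\<lambda>p. \<psi> i (snd p))"
        using sf[OF i] K unfolding section_field_def
        by (intro continuous_on_compose2[of "closure \<Omega>" "\<psi> i" _ snd] continuous_on_snd continuous_on_id) auto
      show "continuous_on (cball (x i) r \<times> K) \<phi>"
        using nf K unfolding neumann_field_def by (auto elim!: continuous_on_subset)
      show "\<forall>p\<in>cball (x i) r \<times> K. \<phi> p \<noteq> 0"
        using \<phi>_pos K by (metis less_irrefl mem_Sigma_iff subsetD surj_pair)
    qed
  qed
  then obtain P where P: "\<And>i. i \<in> I \<Longrightarrow> P i \<in> D i" "\<And>i p. i \<in> I \<Longrightarrow> p \<in> D i \<Longrightarrow> F i p \<le> F i (P i)"
    by metis
  define T where "T = Max ((\<lambda>i. F i (P i)) ` I)"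
  have "T \<in> (\<lambda>i. F i (P i)) ` I" unfolding T_def using I by (intro Max_in) auto
  then obtain i1 where i1: "i1 \<in> I" "T = F i1 (P i1)" by auto
  have T_ge_K: "F i p \<le> T" if "i \<in> I" "p \<in> D i" for i p
  proof -
    have "F i (P i) \<le> T" unfolding T_def using I that by (intro Max_ge) auto
    then show ?thesis using P(2)[OF that] by simp
  qed
  have T_ge: "F i (y, z) \<le> T" if i: "i \<in> I" and y: "\<bar>y - x i\<bar> \<le> r" and z: "z \<in> closure \<Omega>" for i y z
  proof -
    obtain z' where z': "z' \<in> K" "\<forall>f :: real^'n \<Rightarrow> real. periodic_section Z f \<longrightarrow> f z' = f z"
      using rep[OF z] by blast
    have "\<psi> i z' = \<psi> i z" using z'(2) sf[OF i] by (auto simp: section_field_def)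
    moreover have "\<phi> (y, z') = \<phi> (y, z)" using z'(2) nf unfolding neumann_field_def by blast
    ultimately have "F i (y, z) = F i (y, z')" by (simp add: F_def)
    also have "\<dots> \<le> T" using y z' by (intro T_ge_K[OF i]) (auto simp: D_def dist_real_def)
    finally show ?thesis .
  qed
  obtain i y0 z0 where i: "i \<in> I" and y0: "\<bar>y0 - x i\<bar> < r" and z0: "z0 \<in> closure \<Omega>" and FT: "F i (y0, z0) = T"
  proof -
    obtain y z where yz: "P i1 = (y, z)" by (cases "P i1")
    then have y: "\<bar>y - x i1\<bar> \<le> r" and z: "z \<in> closure \<Omega>"
      using P(1)[OF i1(1)] K by (auto simp: D_def dist_real_def)
    show ?thesis
    proof (cases "\<bar>y - x i1\<bar> < r")
      case True
      then show ?thesis using that[OF i1(1) True z] i1 yz by simp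
    next
      case False
      with y have "\<bar>y - x i1\<bar> = r" by simp
      from edge[OF i1(1) this] obtain j y' where j: "j \<in> I" "\<bar>y' - x j\<bar> < r" "\<phi> (y', z) = \<phi> (y, z)"
        "\<sigma> * (s i1 y * \<psi> i1 z) \<le> \<sigma> * (s j y' * \<psi> j z)" using z by blast
      have "F i1 (y, z) \<le> F j (y', z)"
        using divide_right_mono[OF j(4), of "\<phi> (y, z)"] \<phi>_pos[OF z, of y] j(3)
        by (simp add: F_def)
      moreover have "F j (y', z) \<le> T" using j z by (intro T_ge) auto
      ultimately have "F j (y', z) = T" using i1 yz by simp
      then show ?thesis using that[OF j(1,2) z] by blast
    qed
  qed
  define v where "v = (\<lambda>p. s i (fst p) * \<psi> i (snd p))"
  define t where "t = v (y0, z0) / \<phi> (y0, z0)"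
  have Tt: "T = \<sigma> * t" using FT by (simp add: F_def t_def v_def)
  define w where "w = (\<lambda>p. (\<sigma> * t) * \<phi> p + (- \<sigma>) * v p)"
  have nv: "neumann_field v" unfolding v_def using s i sf by (intro neumann_field_mult) auto
  have v_pos: "0 < v (y, z)" if "z \<in> closure \<Omega>" for y z
    using s(3)[OF i] \<psi>_pos[OF i that] by (simp add: v_def)
  have op_le: "cyl_op w y z \<le> (k - c (y, z)) * w (y, z) - \<sigma> * (lam - k) * v (y, z)"
    if y: "\<bar>y - x i\<bar> < r" and z: "z \<in> \<Omega>" for y z
  proof -
    define Ls where "Ls = \<epsilon>\<^sup>2 * (A y * s2 i y + A' y * s' i y) + \<epsilon> * (s' i y * B y + s i y * B' y)"
    have pos: "0 < \<psi> i z" using \<psi>[OF i] z by (simp add: section_solution_def)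
    have 1: "cyl_op \<phi> y z = (k - c (y, z)) * \<phi> (y, z)"
      using \<phi> z by (simp add: cyl_solution_def cyl_op_def)
    have 2: "cyl_op v y z = Ls * \<psi> i z + s i y * ((\<kappa> i - V i z) * \<psi> i z)"
      using cyl_op_mult[OF s(1)[OF i] s(2)[OF i] sf[OF i] z, of y] \<psi>[OF i] z
      by (simp add: v_def Ls_def section_solution_def)
    have 3: "0 \<le> \<sigma> * (Ls + (\<kappa> i + c (y, z) - V i z - lam) * s i y) * \<psi> i z"
      using ineq[OF i y z] pos by (simp add: Ls_def)
    have "cyl_op w y z = (\<sigma> * t) * cyl_op \<phi> y z + (- \<sigma>) * cyl_op v y z"
      unfolding w_def by (rule cyl_op_lincomb[OF nf nv z])
    also have "\<dots> = (k - c (y, z)) * w (y, z) - \<sigma> * (lam - k) * v (y, z)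
        - \<sigma> * (Ls + (\<kappa> i + c (y, z) - V i z - lam) * s i y) * \<psi> i z"
      unfolding 1 2 by (simp add: w_def v_def algebra_simps)
    finally show ?thesis using 3 by simp
  qed
  have w_nonneg: "0 \<le> w (y, z)" if y: "\<bar>y - x i\<bar> < r" and z: "z \<in> closure \<Omega>" for y z
  proof -
    have "\<sigma> * v (y, z) / \<phi> (y, z) \<le> \<sigma> * t"
      using T_ge[OF i _ z, of y] y by (simp add: F_def v_def Tt)
    then show ?thesis using \<phi>_pos[OF z, of y] by (simp add: w_def field_simps)
  qed
  have "0 < w (y0, z0)"
  proof (rule strict_positivity[of w r "x i" "\<bar>k\<bar> + C"])
    show "neumann_field w" unfolding w_def by (rule neumann_field_lincomb[OF nf nv])
    fix y z assume y: "\<bar>y - x i\<bar> < r" and z: "z \<in> \<Omega>"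
    have zc: "z \<in> closure \<Omega>" using z closure_subset by auto
    have neg: "0 < \<sigma> * (lam - k) * v (y, z)" using gap v_pos[OF zc] by simp
    have "k - c (y, z) \<le> \<bar>k\<bar> + C" using c[OF zc, of y] by linarith
    then have "(k - c (y, z)) * w (y, z) \<le> (\<bar>k\<bar> + C) * w (y, z)"
      using w_nonneg[OF y zc] by (rule mult_right_mono)
    then show "cyl_op w y z \<le> (\<bar>k\<bar> + C) * w (y, z)" using op_le[OF y z] neg by simp
    show "cyl_op w y z < 0" if "w (y, z) = 0" using op_le[OF y z] neg that by simp
  qed (use r w_nonneg y0 z0 in auto)
  moreover have "w (y0, z0) = 0" using \<phi>_pos[OF z0, of y0] by (simp add: w_def t_def)
  ultimately show False by simp
qed

end

context cross_section
begin

text \<open>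
  Monotonicity of the principal eigenvalue in the potential, from \<open>comparison\<close> with a single
  window on which everything is constant in \<open>y\<close>.  It yields periodicity and Lipschitz
  continuity of the local eigenvalue in \<open>y\<close>.
\<close>

lemma section_eigenvalue_le:
  assumes \<psi>: "section_solution V k \<psi>" "section_solution V' k' \<psi>'"
    and V: "\<And>z. z \<in> closure \<Omega> \<Longrightarrow> \<bar>V z\<bar> \<le> C" "\<And>z. z \<in> closure \<Omega> \<Longrightarrow> \<bar>V' z\<bar> \<le> C"
    and le: "\<And>z. z \<in> closure \<Omega> \<Longrightarrow> V z \<le> V' z + \<delta>"
  shows "k \<le> k' + \<delta>"
proof -
  interpret c1: cylinder \<alpha> Z a b m "\<lambda>_. 1" "\<lambda>_. 0" "\<lambda>_. 0" "\<lambda>_. 0" 1 1 by (rule constant_cylinder)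
  have "1 * (k - \<delta>) \<le> 1 * k'"
  proof (rule c1.comparison[OF section_solution_imp_cyl_solution[OF \<psi>(2)],
        of C "{0::nat}" 1 "\<lambda>_ _. 1" "\<lambda>_ _. 0" "\<lambda>_ _. 0" "\<lambda>_. V" "\<lambda>_. k" "\<lambda>_. \<psi>" 1 "\<lambda>_. 0" "k - \<delta>"])
    show "0 \<le> 1 * (1\<^sup>2 * (1 * 0 + 0 * 0) + 1 * (0 * 0 + 1 * 0) +
        (k + V' (snd (y, z)) - V z - (k - \<delta>)) * 1)" if "z \<in> \<Omega>" for y :: real and z
      using le[of z] that closure_subset[of \<Omega>] by auto
    show "\<exists>j\<in>{0::nat}. \<exists>y'::real. \<bar>y' - 0\<bar> < 1 \<and>
        (\<forall>z\<in>closure \<Omega>. 1 * \<psi>' (snd (y', z)) = 1 * \<psi>' (snd (y, z)) \<and> 1 * (1 * \<psi> z) \<le> 1 * (1 * \<psi> z))" for y :: real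
      by (intro bexI[of _ 0] exI[of _ 0]) auto
  qed (use V \<psi>(1) in auto)
  then show ?thesis by simp
qed

lemma section_solution_bounds:
  assumes \<psi>: "section_solution V k \<psi>" and V: "\<And>z. z \<in> closure \<Omega> \<Longrightarrow> \<bar>V z\<bar> \<le> C"
  obtains l u where "0 < l" "\<And>z. z \<in> closure \<Omega> \<Longrightarrow> l \<le> \<psi> z \<and> \<psi> z \<le> u"
proof -
  obtain K where K: "compact K" "K \<subseteq> closure \<Omega>" "K \<noteq> {}"
    and rep: "\<And>z. z \<in> closure \<Omega> \<Longrightarrow> \<exists>z'\<in>K. \<forall>f :: real^'n \<Rightarrow> real. periodic_section Z f \<longrightarrow> f z' = f z"
    using compact_representatives by metis
  have sf: "section_field \<psi>" using \<psi> by (simp add: section_solution_def)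
  then have cont: "continuous_on K \<psi>"
    using K(2) unfolding section_field_def by (meson continuous_on_subset)
  obtain z1 where z1: "z1 \<in> K" "\<And>z. z \<in> K \<Longrightarrow> \<psi> z1 \<le> \<psi> z"
    using continuous_attains_inf[OF K(1,3) cont] by blast
  obtain z2 where z2: "z2 \<in> K" "\<And>z. z \<in> K \<Longrightarrow> \<psi> z \<le> \<psi> z2"
    using continuous_attains_sup[OF K(1,3) cont] by blast
  show ?thesis
  proof (rule that[of "\<psi> z1" "\<psi> z2"])
    show "0 < \<psi> z1" using section_solution_pos[OF \<psi> V] z1 K by blast
    fix z assume "z \<in> closure \<Omega>"
    then obtain z' where "z' \<in> K" "\<psi> z' = \<psi> z" using rep sf unfolding section_field_def by blast
    then show "\<psi> z1 \<le> \<psi> z \<and> \<psi> z \<le> \<psi> z2" using z1(2)[of z'] z2(2)[of z'] by simp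
  qed
qed

end

lemma bounded_on_interval:
  fixes f :: "real \<Rightarrow> real"
  assumes "continuous_on UNIV f"
  obtains K where "0 \<le> K" "\<And>y. y \<in> {u..v} \<Longrightarrow> \<bar>f y\<bar> \<le> K"
proof -
  have "continuous_on {u..v} f" using assms continuous_on_subset by blast
  then obtain K where "\<And>y. y \<in> {u..v} \<Longrightarrow> \<bar>f y\<bar> \<le> K"
    using compact_continuous_bound[of "{u..v}" f] by auto
  then show ?thesis by (intro that[of "\<bar>K\<bar>"]) (auto intro: order_trans[OF _ abs_ge_self])
qed

section \<open>Exponential test functions\<close>

locale propagation = cross_section \<alpha> Z a b m
  for \<alpha> :: real and Z :: "(real^'n) section_space"
    and a :: "real^'n \<Rightarrow> real^'n^'n" and b :: "real^'n \<Rightarrow> real^'n" and m :: real +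
  fixes A A' B B' :: "real \<Rightarrow> real" and lo :: real
    and c :: "real \<times> (real^'n) \<Rightarrow> real" and C L :: real
    and \<phi> :: "real \<Rightarrow> real \<times> (real^'n) \<Rightarrow> real" and k :: "real \<Rightarrow> real"
    and \<psi> :: "real \<Rightarrow> real^'n \<Rightarrow> real" and \<kappa> :: "real \<Rightarrow> real"
  assumes A': "\<And>y. (A has_real_derivative A' y) (at y)" and A'_cont: "continuous_on UNIV A'"
    and B': "\<And>y. (B has_real_derivative B' y) (at y)" and B'_cont: "continuous_on UNIV B'"
    and A_ge: "\<And>y. lo \<le> A y" and lo_pos: "0 < lo"
    and A_per: "\<And>y. A (y + 1) = A y" and B_per: "\<And>y. B (y + 1) = B y"
    and c_per: "\<And>y z. z \<in> closure (lift Z) \<Longrightarrow> c (y + 1, z) = c (y, z)"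
    and c_bound: "\<And>y z. z \<in> closure (lift Z) \<Longrightarrow> \<bar>c (y, z)\<bar> \<le> C"
    and c_lip: "\<And>y y' z. z \<in> closure (lift Z) \<Longrightarrow> \<bar>c (y, z) - c (y', z)\<bar> \<le> L * \<bar>y - y'\<bar>"
    and \<phi>_per: "\<And>\<epsilon> y z. 0 < \<epsilon> \<Longrightarrow> z \<in> closure (lift Z) \<Longrightarrow> \<phi> \<epsilon> (y + 1, z) = \<phi> \<epsilon> (y, z)"
    and \<phi>_sol: "\<And>\<epsilon>. 0 < \<epsilon> \<Longrightarrow> cyl_solution A B \<epsilon> c (k \<epsilon>) (\<phi> \<epsilon>)"
    and \<psi>_sol: "\<And>y. section_solution (\<lambda>z. c (y, z)) (\<kappa> y) (\<psi> y)"
begin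

lemma cylinder_eps: "0 < \<epsilon> \<Longrightarrow> cylinder \<alpha> Z a b m A A' B B' \<epsilon> lo"
  using A' A'_cont B' B'_cont A_ge lo_pos by unfold_locales auto

lemma A_cont: "continuous_on UNIV A" and B_cont: "continuous_on UNIV B"
  using A' B' by (meson DERIV_continuous_on has_field_derivative_at_within)+

lemma A_pos: "0 < A y" using A_ge[of y] lo_pos by simp

lemma \<kappa>_lipschitz: "\<bar>\<kappa> y - \<kappa> y'\<bar> \<le> L * \<bar>y - y'\<bar>"
proof -
  have "\<kappa> y \<le> \<kappa> y' + L * \<bar>y - y'\<bar>" for y y'
  proof (rule section_eigenvalue_le[OF \<psi>_sol \<psi>_sol c_bound c_bound])
    fix z assume "z \<in> closure \<Omega>"
    from c_lip[OF this, of y y'] show "c (y, z) \<le> c (y', z) + L * \<bar>y - y'\<bar>" by simp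
  qed
  from this[of y y'] this[of y' y] show ?thesis by (simp add: abs_minus_commute abs_le_iff)
qed

lemma \<kappa>_per: "\<kappa> (y + 1) = \<kappa> y"
proof (rule antisym)
  show "\<kappa> (y + 1) \<le> \<kappa> y"
    using section_eigenvalue_le[OF \<psi>_sol \<psi>_sol c_bound c_bound, of "y + 1" y 0] c_per by simp
  show "\<kappa> y \<le> \<kappa> (y + 1)"
    using section_eigenvalue_le[OF \<psi>_sol \<psi>_sol c_bound c_bound, of y "y + 1" 0] c_per by simp
qed

lemma L_nonneg: "0 \<le> L"
  using \<kappa>_lipschitz[of 0 1] by simp

lemma \<kappa>_cont: "continuous_on UNIV \<kappa>"
  by (rule lipschitz_on_continuous_on[of L])
     (use \<kappa>_lipschitz L_nonneg in \<open>auto simp: lipschitz_on_def dist_real_def\<close>)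

text \<open>
  For \<open>s = e\<^bsup>S/\<epsilon>\<^esup>\<close> the operator in \<open>y\<close> divided by \<open>s\<close> equals \<open>A S'\<^sup>2 + B S'\<close> plus a
  correction of order \<open>\<epsilon>\<close>.
\<close>

lemma comparison_exp:
  fixes I :: "'i set" and S S' S2 :: "'i \<Rightarrow> real \<Rightarrow> real"
  assumes \<epsilon>: "0 < \<epsilon>" and I: "finite I" "I \<noteq> {}" and r: "r > 0"
    and S: "\<And>i y. i \<in> I \<Longrightarrow> (S i has_real_derivative S' i y) (at y)"
      "\<And>i y. i \<in> I \<Longrightarrow> (S' i has_real_derivative S2 i y) (at y)"
    and \<sigma>: "\<sigma> = 1 \<or> \<sigma> = -1"
    and ineq: "\<And>i y z. i \<in> I \<Longrightarrow> \<bar>y - x i\<bar> < r \<Longrightarrow> z \<in> \<Omega> \<Longrightarrow>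
      0 \<le> \<sigma> * (A y * (S' i y)\<^sup>2 + B y * S' i y + \<kappa> (x i) + c (y, z) - c (x i, z) - lam +
               \<epsilon> * (A y * S2 i y + A' y * S' i y + B' y))"
    and edge: "\<And>i y. i \<in> I \<Longrightarrow> \<bar>y - x i\<bar> = r \<Longrightarrow>
      \<exists>j\<in>I. \<exists>y'. \<bar>y' - x j\<bar> < r \<and>
        (\<forall>z\<in>closure \<Omega>. \<phi> \<epsilon> (y', z) = \<phi> \<epsilon> (y, z) \<and>
          \<sigma> * (exp (S i y / \<epsilon>) * \<psi> (x i) z) \<le> \<sigma> * (exp (S j y' / \<epsilon>) * \<psi> (x j) z))"
  shows "\<sigma> * lam \<le> \<sigma> * k \<epsilon>"
proof -
  interpret cyl: cylinder \<alpha> Z a b m A A' B B' \<epsilon> lo by (rule cylinder_eps[OF \<epsilon>])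
  show ?thesis
  proof (rule cyl.comparison[OF \<phi>_sol[OF \<epsilon>] c_bound I r,
        of "\<lambda>i y. exp (S i y / \<epsilon>)" "\<lambda>i y. exp (S i y / \<epsilon>) * (S' i y / \<epsilon>)"
           "\<lambda>i y. exp (S i y / \<epsilon>) * ((S' i y / \<epsilon>)\<^sup>2 + S2 i y / \<epsilon>)"
           "\<lambda>i z. c (x i, z)" "\<lambda>i. \<kappa> (x i)" "\<lambda>i. \<psi> (x i)" \<sigma> x lam])
    fix i y assume i: "i \<in> I"
    show 1: "((\<lambda>y. exp (S i y / \<epsilon>)) has_real_derivative exp (S i y / \<epsilon>) * (S' i y / \<epsilon>)) (at y)"
      by (rule DERIV_fun_exp[OF DERIV_cdivide[OF S(1)[OF i]]])
    show "((\<lambda>y. exp (S i y / \<epsilon>) * (S' i y / \<epsilon>)) has_real_derivative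
        exp (S i y / \<epsilon>) * ((S' i y / \<epsilon>)\<^sup>2 + S2 i y / \<epsilon>)) (at y)"
      using DERIV_mult[OF 1 DERIV_cdivide[OF S(2)[OF i, of y], of \<epsilon>]]
      by (simp add: power2_eq_square algebra_simps)
  next
    fix i y z assume i: "i \<in> I" "\<bar>y - x i\<bar> < r" "z \<in> \<Omega>"
    let ?E = "exp (S i y / \<epsilon>)"
    let ?X = "\<sigma> * (\<epsilon>\<^sup>2 * (A y * (?E * ((S' i y / \<epsilon>)\<^sup>2 + S2 i y / \<epsilon>)) + A' y * (?E * (S' i y / \<epsilon>))) +
             \<epsilon> * (?E * (S' i y / \<epsilon>) * B y + ?E * B' y) +
             (\<kappa> (x i) + c (y, z) - c (x i, z) - lam) * ?E)"
    have "?X = ?E * (\<sigma> * (A y * (S' i y)\<^sup>2 + B y * S' i y + \<kappa> (x i) + c (y, z) - c (x i, z) - lam +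
               \<epsilon> * (A y * S2 i y + A' y * S' i y + B' y)))"
      using \<epsilon> by (simp add: field_simps power2_eq_square)
    also have "0 \<le> \<dots>"
      by (rule mult_nonneg_nonneg[OF less_imp_le[OF exp_gt_zero] ineq[OF i]])
    finally show "0 \<le> ?X" .
  qed (use c_bound \<psi>_sol \<sigma> edge in auto)
qed

lemma eventually_lower_order_small:
  assumes g: "0 < g"
  shows "\<forall>\<^sub>F \<epsilon> in at_right 0. 0 < \<epsilon> \<and> (\<forall>y\<in>{u..v}. \<forall>p q. \<bar>p\<bar> \<le> Q \<longrightarrow> \<bar>q\<bar> \<le> Q \<longrightarrow>
     \<bar>\<epsilon> * (A y * p + A' y * q + B' y)\<bar> \<le> g)"
proof -
  obtain KA where KA: "0 \<le> KA" "\<And>y. y \<in> {u..v} \<Longrightarrow> \<bar>A y\<bar> \<le> KA" 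
    using bounded_on_interval[OF A_cont, of u v] by blast
  obtain KA' where KA': "0 \<le> KA'" "\<And>y. y \<in> {u..v} \<Longrightarrow> \<bar>A' y\<bar> \<le> KA'" 
    using bounded_on_interval[OF A'_cont, of u v] by blast
  obtain KB' where KB': "0 \<le> KB'" "\<And>y. y \<in> {u..v} \<Longrightarrow> \<bar>B' y\<bar> \<le> KB'" 
    using bounded_on_interval[OF B'_cont, of u v] by blast
  define E where "E = KA * \<bar>Q\<bar> + KA' * \<bar>Q\<bar> + KB' + 1"
  have E: "0 < E" using KA KA' KB' by (simp add: E_def add_nonneg_pos)
  have bd: "\<bar>A y * p + A' y * q + B' y\<bar> \<le> E" if "y \<in> {u..v}" "\<bar>p\<bar> \<le> Q" "\<bar>q\<bar> \<le> Q" for y p q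
  proof -
    have "\<bar>A y * p\<bar> \<le> KA * \<bar>Q\<bar>" "\<bar>A' y * q\<bar> \<le> KA' * \<bar>Q\<bar>"
      unfolding abs_mult using that KA KA' by (intro mult_mono; force)+
    then show ?thesis using KB'(2)[OF that(1)] by (simp add: E_def)
  qed
  have "\<forall>\<^sub>F \<epsilon> in at_right 0. \<epsilon> \<in> {0<..<g / E}"
    using g E by (intro eventually_at_right_real) simp
  then show ?thesis
  proof eventually_elim
    case (elim \<epsilon>)
    have "\<bar>\<epsilon> * (A y * p + A' y * q + B' y)\<bar> \<le> g" if "y \<in> {u..v}" "\<bar>p\<bar> \<le> Q" "\<bar>q\<bar> \<le> Q" for y p q
    proof -
      have "\<bar>\<epsilon> * (A y * p + A' y * q + B' y)\<bar> = \<epsilon> * \<bar>A y * p + A' y * q + B' y\<bar>"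
        using elim by (simp add: abs_mult)
      also have "\<dots> \<le> \<epsilon> * E" using bd[OF that] elim by (intro mult_left_mono) auto
      also have "\<dots> \<le> g" using elim E by (simp add: field_simps)
      finally show ?thesis .
    qed
    then show ?case using elim by auto
  qed
qed

text \<open>
  The phase is \<open>- l (y - y0)\<^sup>2 / 2\<close> on the window of radius one, so that each edge is a translate of the
  centre, where the phase is larger.  Near \<open>y0\<close> the Hamiltonian is at least
  \<open>\<kappa> y0 - B\<^sup>2 / (4 A)\<close> for every slope, by completing the square; away from \<open>y0\<close> a large \<open>l\<close> makes
  the quadratic term dominate everything else.
\<close>

lemma eventually_ge_below_pointwise_bound:
  assumes lam: "lam < \<kappa> y0 - (B y0)\<^sup>2 / (4 * A y0)"
  shows "\<forall>\<^sub>F \<epsilon> in at_right 0. lam \<le> k \<epsilon>"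
proof -
  define g where "g = \<kappa> y0 - (B y0)\<^sup>2 / (4 * A y0) - lam"
  have g: "g > 0" using lam by (simp add: g_def)
  have "continuous_on UNIV (\<lambda>y. (B y)\<^sup>2 / (4 * A y))"
    using A_pos by (intro continuous_intros A_cont B_cont) (auto simp: less_imp_neq[symmetric])
  then have "isCont (\<lambda>y. (B y)\<^sup>2 / (4 * A y)) y0" by (simp add: continuous_on_eq_continuous_at)
  then obtain d where d: "d > 0" "\<And>y. \<bar>y - y0\<bar> < d \<Longrightarrow> \<bar>(B y)\<^sup>2 / (4 * A y) - (B y0)\<^sup>2 / (4 * A y0)\<bar> < g / 4"
    using g unfolding continuous_at_eps_delta dist_real_def by (metis divide_pos_pos zero_less_numeral)
  define \<rho> where "\<rho> = min d (g / (4 * (L + 1)))"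
  have \<rho>: "\<rho> > 0" "\<rho> \<le> d" using d g L_nonneg by (auto simp: \<rho>_def)
  have "\<rho> \<le> g / (4 * (L + 1))" by (simp add: \<rho>_def)
  then have "\<rho> * (4 * (L + 1)) \<le> g" using L_nonneg by (simp add: pos_le_divide_eq)
  then have L\<rho>: "L * \<rho> \<le> g / 4" using \<rho> L_nonneg by (simp add: algebra_simps)
  obtain KB where KB: "0 \<le> KB" "\<And>y. y \<in> {y0 - 1..y0 + 1} \<Longrightarrow> \<bar>B y\<bar> \<le> KB"
    using bounded_on_interval[OF B_cont, of "y0 - 1" "y0 + 1"] by blast
  define D where "D = \<bar>lam - \<kappa> y0\<bar> + 2 * \<bar>C\<bar> + g"
  \<comment> \<open>For \<open>\<bar>p\<bar> \<ge> U\<close> the quadratic term exceeds \<open>KB \<bar>p\<bar> + D\<close>; the parabola reaches that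
    slope at distance \<open>\<rho>\<close> from \<open>y0\<close>.\<close>
  define U where "U = (KB + D) / lo + 1"
  have D0: "D \<ge> 0" using g by (simp add: D_def)
  have U: "U \<ge> 1" using KB D0 lo_pos by (simp add: U_def)
  define l where "l = U / \<rho>"
  have l: "l > 0" using U \<rho> by (simp add: l_def)
  have steep: "D \<le> A y * p\<^sup>2 + B y * p" if p: "U \<le> \<bar>p\<bar>" and y: "y \<in> {y0 - 1..y0 + 1}" for y p
  proof -
    have "lo * U = KB + D + lo" using lo_pos by (simp add: U_def field_simps)
    then have "KB + D \<le> lo * \<bar>p\<bar>" using mult_left_mono[OF p, of lo] lo_pos by simp
    then have "(KB + D) * \<bar>p\<bar> \<le> (lo * \<bar>p\<bar>) * \<bar>p\<bar>" by (intro mult_right_mono) auto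
    then have "KB * \<bar>p\<bar> + D * \<bar>p\<bar> \<le> lo * p\<^sup>2"
      by (simp add: distrib_right power2_eq_square mult.assoc)
    moreover have "lo * p\<^sup>2 \<le> A y * p\<^sup>2" using A_ge by (intro mult_right_mono) auto
    moreover have "- (KB * \<bar>p\<bar>) \<le> B y * p"
    proof -
      have "\<bar>B y * p\<bar> \<le> KB * \<bar>p\<bar>" unfolding abs_mult using KB(2)[OF y] by (intro mult_right_mono) auto
      then show ?thesis by linarith
    qed
    moreover have "D * 1 \<le> D * \<bar>p\<bar>" using p U D0 by (intro mult_left_mono) auto
    ultimately show ?thesis by linarith
  qed
  have square: "- ((B y)\<^sup>2 / (4 * A y)) \<le> A y * p\<^sup>2 + B y * p" for y p
  proof -
    have "A y * p\<^sup>2 + B y * p + (B y)\<^sup>2 / (4 * A y) = A y * (p + B y / (2 * A y))\<^sup>2"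
      using A_pos[of y] by (simp add: power2_eq_square field_simps)
    moreover have "\<dots> \<ge> 0" using A_pos[of y] by simp
    ultimately show ?thesis by simp
  qed
  have "\<forall>\<^sub>F \<epsilon> in at_right 0. 0 < \<epsilon> \<and> (\<forall>y\<in>{y0 - 1..y0 + 1}. \<forall>p q. \<bar>p\<bar> \<le> l \<longrightarrow> \<bar>q\<bar> \<le> l \<longrightarrow>
     \<bar>\<epsilon> * (A y * p + A' y * q + B' y)\<bar> \<le> g / 4)"
    using g by (intro eventually_lower_order_small) simp
  then show ?thesis
  proof eventually_elim
    case (elim \<epsilon>)
    then have \<epsilon>: "0 < \<epsilon>" by simp
    have "1 * lam \<le> 1 * k \<epsilon>"
    proof (rule comparison_exp[OF \<epsilon>, of "{0::nat}" 1 "\<lambda>_ y. - l * (y - y0)\<^sup>2 / 2" "\<lambda>_ y. - l * (y - y0)"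
          "\<lambda>_ _. - l" 1 "\<lambda>_. y0" lam])
      fix y z assume y: "\<bar>y - y0\<bar> < 1" and z: "z \<in> \<Omega>"
      have zc: "z \<in> closure \<Omega>" using z closure_subset by auto
      define p where "p = - l * (y - y0)"
      have yI: "y \<in> {y0 - 1..y0 + 1}" using y by auto
      have "l * \<bar>y - y0\<bar> \<le> l * 1" using l y by (intro mult_left_mono) auto
      then have pl: "\<bar>p\<bar> \<le> l" using l by (simp add: p_def abs_mult)
      have small: "\<bar>\<epsilon> * (A y * (- l) + A' y * p + B' y)\<bar> \<le> g / 4"
      proof -
        have "\<bar>- l\<bar> \<le> l" using l by simp
        with elim yI pl show ?thesis by blast
      qed
      have main: "g / 4 \<le> A y * p\<^sup>2 + B y * p + \<kappa> y0 + c (y, z) - c (y0, z) - lam"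
      proof (cases "\<bar>y - y0\<bar> < \<rho>")
        case True
        have "L * \<bar>y - y0\<bar> \<le> L * \<rho>" using True L_nonneg by (intro mult_left_mono) auto
        then have "\<bar>c (y, z) - c (y0, z)\<bar> \<le> g / 4" using c_lip[OF zc, of y y0] L\<rho> by linarith
        moreover have "\<bar>(B y)\<^sup>2 / (4 * A y) - (B y0)\<^sup>2 / (4 * A y0)\<bar> < g / 4" using d(2) True \<rho> by simp
        ultimately show ?thesis using square[of y p] g_def by linarith
      next
        case False
        then have "l * \<rho> \<le> l * \<bar>y - y0\<bar>" using l by (intro mult_left_mono) auto
        moreover have "\<bar>p\<bar> = l * \<bar>y - y0\<bar>" using l by (simp add: p_def abs_mult)
        moreover have "l * \<rho> = U" using \<rho> by (simp add: l_def)
        ultimately have "U \<le> \<bar>p\<bar>" by simp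
        from steep[OF this yI] have "D \<le> A y * p\<^sup>2 + B y * p" .
        moreover have "\<bar>c (y, z)\<bar> \<le> C" "\<bar>c (y0, z)\<bar> \<le> C" using c_bound[OF zc] by auto
        ultimately show ?thesis using g by (simp add: D_def)
      qed
      show "0 \<le> 1 * (A y * (- l * (y - y0))\<^sup>2 + B y * (- l * (y - y0)) + \<kappa> y0 + c (y, z) - c (y0, z) - lam +
               \<epsilon> * (A y * - l + A' y * (- l * (y - y0)) + B' y))"
        using main small unfolding p_def by simp
    next
      fix y assume y: "\<bar>y - y0\<bar> = 1"
      have "\<phi> \<epsilon> (y0, z) = \<phi> \<epsilon> (y, z)" if "z \<in> closure \<Omega>" for z
      proof -
        have "y = y0 + 1 \<or> y0 = y + 1" using y by linarith
        then show ?thesis using \<phi>_per[OF \<epsilon> that, of y0] \<phi>_per[OF \<epsilon> that, of y] by auto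
      qed
      moreover have "exp (- l * (y - y0)\<^sup>2 / 2 / \<epsilon>) * \<psi> y0 z \<le> exp (- l * (y0 - y0)\<^sup>2 / 2 / \<epsilon>) * \<psi> y0 z"
        if "z \<in> closure \<Omega>" for z
      proof (rule mult_right_mono)
        show "exp (- l * (y - y0)\<^sup>2 / 2 / \<epsilon>) \<le> exp (- l * (y0 - y0)\<^sup>2 / 2 / \<epsilon>)" using l \<epsilon> by simp
        show "0 \<le> \<psi> y0 z" using section_solution_pos[OF \<psi>_sol c_bound that] by (simp add: less_imp_le)
      qed
      ultimately show "\<exists>j\<in>{0::nat}. \<exists>y'. \<bar>y' - y0\<bar> < 1 \<and> (\<forall>z\<in>closure \<Omega>. \<phi> \<epsilon> (y', z) = \<phi> \<epsilon> (y, z) \<and>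
          1 * (exp (- l * (y - y0)\<^sup>2 / 2 / \<epsilon>) * \<psi> y0 z) \<le> 1 * (exp (- l * (y' - y0)\<^sup>2 / 2 / \<epsilon>) * \<psi> y0 z))"
        by (intro bexI[of _ 0] exI[of _ y0]) auto
    qed (auto intro!: derivative_eq_intros)
    then show ?case by simp
  qed
qed

text \<open>
  The windows have radius \<open>\<delta> = 1 / N\<close> and centres \<open>i \<delta>\<close>, so every edge point is the centre of
  another window modulo the period.  On \<open>\<bar>y - x i\<bar> \<le> \<delta>\<close> the slope \<open>p\<close> varies by at most \<open>\<tau>\<close>, hence \<open>S\<close>
  differs from its Taylor polynomial by at most \<open>\<tau> \<delta>\<close> at the edge.  The quadratic term with coefficient
  \<open>\<eta> = 2 \<tau> / \<delta>\<close> amounts to \<open>2 \<tau> \<delta>\<close> there and outweighs that error, but changes the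
  slope by at most \<open>4 \<tau>\<close>, which the gap \<open>g\<close> absorbs.  The remaining gain \<open>\<tau> \<delta>\<close> in the
  exponent at the edge beats the bounded ratio of the local eigenfunctions when \<open>\<epsilon>\<close> is small.
\<close>

lemma eventually_comparison_of_C1_phase:
  fixes S p :: "real \<Rightarrow> real"
  assumes S: "\<And>y. (S has_real_derivative p y) (at y)" and p_cont: "continuous_on UNIV p"
    and S_per: "\<And>y. S (y + 1) = S y" and \<sigma>: "\<sigma> = 1 \<or> \<sigma> = -1" and g: "0 < g"
    and gap: "\<And>y. g \<le> \<sigma> * (A y * (p y)\<^sup>2 + B y * p y + \<kappa> y - lam)"
  shows "\<forall>\<^sub>F \<epsilon> in at_right 0. \<sigma> * lam \<le> \<sigma> * k \<epsilon>"
proof -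
  obtain Pm where Pm: "0 \<le> Pm" "\<And>y. y \<in> {-1..2} \<Longrightarrow> \<bar>p y\<bar> \<le> Pm"
    using bounded_on_interval[OF p_cont, of "-1" 2] by blast
  define Q where "Q = Pm + 4"
  define h where "h = (\<lambda>u::real \<times> real. A (fst u) * (snd u)\<^sup>2 + B (fst u) * snd u)"
  define K where "K = {-1..2::real} \<times> {-Q..Q}"
  have "compact K" unfolding K_def by (intro compact_Times) auto
  moreover have "continuous_on K h"
    unfolding h_def
    by (intro continuous_intros continuous_on_compose2[OF A_cont, of _ fst]
        continuous_on_compose2[OF B_cont, of _ fst]) auto
  ultimately have "uniformly_continuous_on K h" by (rule compact_uniformly_continuous[rotated])
  then obtain d where d: "d > 0" "\<And>u v. u \<in> K \<Longrightarrow> v \<in> K \<Longrightarrow> dist v u < d \<Longrightarrow> \<bar>h v - h u\<bar> < g / 4"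
    unfolding uniformly_continuous_on_def dist_real_def using g
    by (metis divide_pos_pos zero_less_numeral)
  define \<tau> where "\<tau> = min 1 (d / 8)"
  have \<tau>: "\<tau> > 0" "\<tau> \<le> 1" "4 * \<tau> \<le> d / 2" using d by (auto simp: \<tau>_def)
  have "uniformly_continuous_on {-1..2} p"
    using p_cont by (intro compact_uniformly_continuous) (auto elim: continuous_on_subset)
  then obtain d' where d': "d' > 0"
    "\<And>x y. x \<in> {-1..2} \<Longrightarrow> y \<in> {-1..2} \<Longrightarrow> \<bar>y - x\<bar> < d' \<Longrightarrow> \<bar>p y - p x\<bar> < \<tau>"
    unfolding uniformly_continuous_on_def dist_real_def using \<tau> by metis
  \<comment> \<open>The windows must be small against the oscillation of the Hamiltonian, of \<open>p\<close> and of \<open>c\<close>.\<close>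
  define \<delta>0 where "\<delta>0 = min (min 1 (d / 2)) (min d' (g / (4 * (L + 1))))"
  have "\<delta>0 > 0" using d d' g L_nonneg by (simp add: \<delta>0_def)
  then obtain n where n: "inverse (real (Suc n)) < \<delta>0" using reals_Archimedean by blast
  define N where "N = Suc n"
  define \<delta> where "\<delta> = 1 / real N"
  have N0: "real N > 0" by (simp add: N_def)
  have \<delta>: "0 < \<delta>" "\<delta> < 1" "\<delta> < d / 2" "\<delta> < d'" "\<delta> < g / (4 * (L + 1))"
    using n N0 by (auto simp: \<delta>_def N_def \<delta>0_def inverse_eq_divide)
  have N\<delta>: "real N * \<delta> = 1" using N0 by (simp add: \<delta>_def)
  have "\<delta> * (4 * (L + 1)) < g" using \<delta>(5) L_nonneg by (simp add: pos_less_divide_eq)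
  then have L\<delta>: "L * \<delta> \<le> g / 4" using \<delta> L_nonneg by (simp add: algebra_simps)
  define x where "x = (\<lambda>i::nat. real i * \<delta>)"
  have x01: "0 \<le> x i" "x i < 1" if "i < N" for i
  proof -
    show "0 \<le> x i" using \<delta> by (simp add: x_def)
    have "real i * \<delta> < real N * \<delta>" using that \<delta> by (intro mult_strict_right_mono) auto
    then show "x i < 1" using N\<delta> by (simp add: x_def)
  qed
  have neighbour: "\<exists>j<N. x j = y \<or> x j + 1 = y \<or> x j = y + 1" if i: "i < N" and y: "\<bar>y - x i\<bar> = \<delta>" for i y
  proof -
    have "y = x i + \<delta> \<or> y = x i - \<delta>" using y by linarith
    then show ?thesis
    proof
      assume y: "y = x i + \<delta>"
      show ?thesis
      proof (cases "Suc i < N")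
        case True
        then show ?thesis using y by (intro exI[of _ "Suc i"]) (simp add: x_def algebra_simps)
      next
        case False
        then have "real (Suc i) * \<delta> = 1" using i N\<delta> by (metis Suc_lessI)
        then show ?thesis using y by (intro exI[of _ 0]) (simp add: x_def N_def algebra_simps)
      qed
    next
      assume y: "y = x i - \<delta>"
      show ?thesis
      proof (cases i)
        case 0
        have "real (Suc n) * \<delta> = 1" using N\<delta> by (simp add: N_def)
        then have "real n * \<delta> = 1 - \<delta>" by (simp add: algebra_simps)
        then show ?thesis using y 0 by (intro exI[of _ n]) (simp add: x_def N_def)
      next
        case (Suc i')
        then show ?thesis using y i by (intro exI[of _ i']) (simp add: x_def algebra_simps)
      qed
    qed
  qed
  define \<eta> where "\<eta> = 2 * \<tau> / \<delta>"
  have \<eta>: "\<eta> > 0" "\<eta> * \<delta> = 2 * \<tau>" using \<tau> \<delta> by (auto simp: \<eta>_def)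
  define T where "T = (\<lambda>i y. S (x i) + p (x i) * (y - x i) - \<sigma> * \<eta> * (y - x i)\<^sup>2)"
  define T' where "T' = (\<lambda>i y. p (x i) - 2 * \<sigma> * \<eta> * (y - x i))"
  have T_edge: "\<tau> * \<delta> \<le> \<sigma> * (S y - T i y)" if i: "i < N" and y: "\<bar>y - x i\<bar> = \<delta>" for i y
  proof -
    let ?J = "{x i - \<delta>..x i + \<delta>}"
    have J: "?J \<subseteq> {-1..2}" using x01[OF i] \<delta> by auto
    have "norm ((S y - p (x i) * y) - (S (x i) - p (x i) * x i)) \<le> \<tau> * norm (y - x i)"
    proof (rule field_differentiable_bound[of ?J])
      show "((\<lambda>t. S t - p (x i) * t) has_real_derivative p t - p (x i)) (at t within ?J)" for t
        using S[of t] by (auto intro!: derivative_eq_intros intro: has_field_derivative_at_within)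
      show "norm (p t - p (x i)) \<le> \<tau>" if "t \<in> ?J" for t
      proof -
        have "x i \<in> ?J" using \<delta> by simp
        then have "x i \<in> {-1..2}" "t \<in> {-1..2}" using that J by blast+
        moreover have "\<bar>t - x i\<bar> < d'" using that \<delta> by (auto simp: abs_le_iff abs_less_iff)
        ultimately show ?thesis using d'(2)[of "x i" t] by simp
      qed
    qed (use y \<delta> in auto)
    then have Taylor: "\<bar>S y - S (x i) - p (x i) * (y - x i)\<bar> \<le> \<tau> * \<delta>"
      using y by (simp add: algebra_simps)
    have "(y - x i)\<^sup>2 = \<delta>\<^sup>2" using y by (metis power2_abs)
    then have "\<eta> * (y - x i)\<^sup>2 = (\<eta> * \<delta>) * \<delta>" by (simp add: power2_eq_square)
    also have "\<dots> = 2 * (\<tau> * \<delta>)" by (simp add: \<eta>(2))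
    finally have sq: "\<eta> * (y - x i)\<^sup>2 = 2 * (\<tau> * \<delta>)" .
    define X where "X = S y - S (x i) - p (x i) * (y - x i)"
    have "\<sigma> * (S y - T i y) = \<sigma> * X + \<sigma> * \<sigma> * (\<eta> * (y - x i)\<^sup>2)"
      by (simp add: T_def X_def algebra_simps)
    then have "\<sigma> * (S y - T i y) = \<sigma> * X + 2 * (\<tau> * \<delta>)" using \<sigma> by (auto simp: sq)
    moreover have "- (\<tau> * \<delta>) \<le> \<sigma> * X" using Taylor \<sigma> by (auto simp: X_def[symmetric])
    ultimately show ?thesis by linarith
  qed
  have "\<exists>l u. 0 < l \<and> (\<forall>z\<in>closure \<Omega>. l \<le> \<psi> y z \<and> \<psi> y z \<le> u)" for y
    using section_solution_bounds[OF \<psi>_sol c_bound, of y] by metis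
  then obtain l u where lu: "\<And>y. 0 < l y" "\<And>y z. z \<in> closure \<Omega> \<Longrightarrow> l y \<le> \<psi> y z \<and> \<psi> y z \<le> u y"
    by metis
  define \<Lambda> where "\<Lambda> = (\<Sum>i<N. \<bar>u (x i)\<bar>) * (\<Sum>j<N. 1 / l (x j))"
  have \<Lambda>0: "0 \<le> \<Lambda>" unfolding \<Lambda>_def using lu(1) by (intro mult_nonneg_nonneg sum_nonneg) (auto intro: less_imp_le)
  have \<Lambda>: "\<psi> (x i) z \<le> \<Lambda> * \<psi> (x j) z" if "i < N" "j < N" and z: "z \<in> closure \<Omega>" for i j z
  proof -
    have "\<bar>u (x i)\<bar> \<le> (\<Sum>i<N. \<bar>u (x i)\<bar>)"
      using that by (intro member_le_sum[of i "{..<N}" "\<lambda>i. \<bar>u (x i)\<bar>"]) auto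
    then have 1: "\<psi> (x i) z \<le> (\<Sum>i<N. \<bar>u (x i)\<bar>)" using lu(2)[OF z, of "x i"] by linarith
    have "1 / l (x j) \<le> (\<Sum>j<N. 1 / l (x j))"
      using that lu(1) by (intro member_le_sum[of j "{..<N}" "\<lambda>j. 1 / l (x j)"]) (auto intro: less_imp_le)
    moreover have "0 < \<psi> (x j) z" "1 \<le> \<psi> (x j) z / l (x j)"
      using lu(1)[of "x j"] lu(2)[OF z, of "x j"] by (auto simp: pos_le_divide_eq)
    ultimately have 2: "1 \<le> (\<Sum>j<N. 1 / l (x j)) * \<psi> (x j) z"
      using mult_right_mono[of "1 / l (x j)" "\<Sum>j<N. 1 / l (x j)" "\<psi> (x j) z"] by simp
    have "\<psi> (x i) z \<le> (\<Sum>i<N. \<bar>u (x i)\<bar>) * 1" using 1 by simp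
    also have "\<dots> \<le> (\<Sum>i<N. \<bar>u (x i)\<bar>) * ((\<Sum>j<N. 1 / l (x j)) * \<psi> (x j) z)"
      using 2 by (intro mult_left_mono sum_nonneg) auto
    finally show ?thesis by (simp add: \<Lambda>_def mult.assoc)
  qed
  define Q' where "Q' = max Q (2 * \<eta>)"
  have "\<forall>\<^sub>F \<epsilon> in at_right 0. 0 < \<epsilon> \<and> (\<forall>y\<in>{-1..2}. \<forall>p q. \<bar>p\<bar> \<le> Q' \<longrightarrow> \<bar>q\<bar> \<le> Q' \<longrightarrow>
     \<bar>\<epsilon> * (A y * p + A' y * q + B' y)\<bar> \<le> g / 4)"
    using g by (intro eventually_lower_order_small) simp
  moreover have "\<forall>\<^sub>F \<epsilon> in at_right 0. \<epsilon> \<in> {0<..<\<tau> * \<delta> / (\<Lambda> + 1)}"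
    using \<tau> \<delta> \<Lambda>0 by (intro eventually_at_right_real) (simp add: add_nonneg_pos)
  ultimately show ?thesis
  proof eventually_elim
    case (elim \<epsilon>)
    then have \<epsilon>: "0 < \<epsilon>" by simp
    have "\<epsilon> * (\<Lambda> + 1) < \<tau> * \<delta>" using elim \<Lambda>0 by (simp add: pos_less_divide_eq)
    then have "\<Lambda> \<le> \<tau> * \<delta> / \<epsilon>" using \<epsilon> by (simp add: pos_le_divide_eq algebra_simps)
    also have "\<dots> \<le> exp (\<tau> * \<delta> / \<epsilon>)" using exp_ge_add_one_self[of "\<tau> * \<delta> / \<epsilon>"] by linarith
    finally have \<Lambda>_exp: "\<Lambda> \<le> exp (\<tau> * \<delta> / \<epsilon>)" .
    have dominate: "exp (s / \<epsilon>) * \<psi> (x i) z \<le> exp (s' / \<epsilon>) * \<psi> (x j) z"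
      if "s + \<tau> * \<delta> \<le> s'" "i < N" "j < N" and z: "z \<in> closure \<Omega>" for s s' i j z
    proof -
      have pos: "0 \<le> \<psi> (x j) z" using lu(1)[of "x j"] lu(2)[OF z, of "x j"] by linarith
      have "exp (s / \<epsilon>) * \<psi> (x i) z \<le> exp (s / \<epsilon>) * (\<Lambda> * \<psi> (x j) z)"
        using \<Lambda>[OF that(2-4)] by (intro mult_left_mono) auto
      also have "\<dots> \<le> exp (s / \<epsilon>) * (exp (\<tau> * \<delta> / \<epsilon>) * \<psi> (x j) z)"
        using \<Lambda>_exp pos by (intro mult_left_mono mult_right_mono) auto
      also have "\<dots> = exp ((s + \<tau> * \<delta>) / \<epsilon>) * \<psi> (x j) z" by (simp add: exp_add add_divide_distrib)
      also have "\<dots> \<le> exp (s' / \<epsilon>) * \<psi> (x j) z"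
        using that \<epsilon> pos by (intro mult_right_mono) (auto simp: divide_right_mono)
      finally show ?thesis .
    qed
    show ?case
    proof (rule comparison_exp[OF \<epsilon>, of "{..<N}" \<delta> T T' "\<lambda>_ _. - 2 * \<sigma> * \<eta>" \<sigma> x lam])
      show "{..<N} \<noteq> {}" by (auto simp: N_def)
      show "(T i has_real_derivative T' i y) (at y)" for i y
        unfolding T_def T'_def by (auto intro!: derivative_eq_intros simp: algebra_simps)
      show "(T' i has_real_derivative - 2 * \<sigma> * \<eta>) (at y)" for i y
        unfolding T'_def by (auto intro!: derivative_eq_intros)
    next
      fix i y z assume "i \<in> {..<N}" and y: "\<bar>y - x i\<bar> < \<delta>" and z: "z \<in> \<Omega>"
      then have i: "i < N" by simp
      have zc: "z \<in> closure \<Omega>" using z closure_subset by auto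
      have yI: "y \<in> {-1..2}" and xI: "x i \<in> {-1..2}" using y x01[OF i] \<delta> by auto
      have "\<bar>T' i y - p (x i)\<bar> = 2 * \<eta> * \<bar>y - x i\<bar>" using \<sigma> \<eta> by (auto simp: T'_def abs_mult)
      also have "\<dots> \<le> 2 * \<eta> * \<delta>" using y \<eta> by (intro mult_left_mono) auto
      also have "\<dots> = 4 * \<tau>" using \<eta>(2) by (simp only: mult.assoc)
      finally have T'p: "\<bar>T' i y - p (x i)\<bar> \<le> 4 * \<tau>" .
      have pQ: "\<bar>p (x i)\<bar> \<le> Pm" using Pm(2)[OF xI] .
      then have TQ: "\<bar>T' i y\<bar> \<le> Q" using T'p \<tau> by (simp add: Q_def abs_le_iff)
      have "dist (y, T' i y) (x i, p (x i)) \<le> \<bar>y - x i\<bar> + \<bar>T' i y - p (x i)\<bar>"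
        using sqrt_sum_squares_le_sum_abs[of "y - x i" "T' i y - p (x i)"]
        by (simp add: dist_prod_def dist_real_def)
      also have "\<dots> < d" using y T'p \<tau> \<delta> by linarith
      finally have "\<bar>h (y, T' i y) - h (x i, p (x i))\<bar> < g / 4"
        using d(2)[of "(x i, p (x i))" "(y, T' i y)"] yI xI pQ TQ Pm
        by (auto simp: K_def Q_def abs_le_iff)
      moreover have "\<bar>c (y, z) - c (x i, z)\<bar> \<le> g / 4"
      proof -
        have "L * \<bar>y - x i\<bar> \<le> L * \<delta>" using y L_nonneg by (intro mult_left_mono) auto
        then show ?thesis using c_lip[OF zc, of y "x i"] L\<delta> by linarith
      qed
      moreover have "\<bar>\<epsilon> * (A y * (- 2 * \<sigma> * \<eta>) + A' y * T' i y + B' y)\<bar> \<le> g / 4"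
      proof -
        have "\<bar>- 2 * \<sigma> * \<eta>\<bar> \<le> Q'" using \<sigma> \<eta> by (auto simp: Q'_def)
        moreover have "\<bar>T' i y\<bar> \<le> Q'" using TQ by (simp add: Q'_def)
        ultimately show ?thesis using elim yI by blast
      qed
      moreover have "g \<le> \<sigma> * (h (x i, p (x i)) + \<kappa> (x i) - lam)" using gap[of "x i"] by (simp add: h_def)
      moreover have "h (y, T' i y) = A y * (T' i y)\<^sup>2 + B y * T' i y" by (simp add: h_def)
      ultimately show "0 \<le> \<sigma> * (A y * (T' i y)\<^sup>2 + B y * T' i y + \<kappa> (x i) + c (y, z) - c (x i, z) - lam +
          \<epsilon> * (A y * (- 2 * \<sigma> * \<eta>) + A' y * T' i y + B' y))"
        using \<sigma> g by (elim disjE; simp only: mult_1_left mult_minus1; linarith)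
    next
      fix i y assume "i \<in> {..<N}" and y: "\<bar>y - x i\<bar> = \<delta>"
      then have i: "i < N" by simp
      obtain j where j: "j < N" "x j = y \<or> x j + 1 = y \<or> x j = y + 1" using neighbour[OF i y] by blast
      have Sj: "T j (x j) = S y" using j(2) S_per by (auto simp: T_def)
      have "\<phi> \<epsilon> (x j, z) = \<phi> \<epsilon> (y, z)" if "z \<in> closure \<Omega>" for z
        using j(2) \<phi>_per[OF \<epsilon> that] by auto
      moreover have "\<sigma> * (exp (T i y / \<epsilon>) * \<psi> (x i) z) \<le> \<sigma> * (exp (T j (x j) / \<epsilon>) * \<psi> (x j) z)"
        if "z \<in> closure \<Omega>" for z
        using \<sigma>
      proof
        assume "\<sigma> = 1"
        then show ?thesis using dominate[OF _ i j(1) that, of "T i y" "T j (x j)"] T_edge[OF i y] Sj by simp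
      next
        assume "\<sigma> = -1"
        then show ?thesis using dominate[OF _ j(1) i that, of "T j (x j)" "T i y"] T_edge[OF i y] Sj by simp
      qed
      ultimately show "\<exists>j\<in>{..<N}. \<exists>y'. \<bar>y' - x j\<bar> < \<delta> \<and> (\<forall>z\<in>closure \<Omega>. \<phi> \<epsilon> (y', z) = \<phi> \<epsilon> (y, z) \<and>
          \<sigma> * (exp (T i y / \<epsilon>) * \<psi> (x i) z) \<le> \<sigma> * (exp (T j y' / \<epsilon>) * \<psi> (x j) z))"
        using j(1) \<delta> by (intro bexI[of _ j] exI[of _ "x j"]) auto
    qed (use \<delta> \<sigma> in auto)
  qed
qed

end

section \<open>Periodic phases and the limit\<close>

lemma continuous_antiderivative:
  fixes p :: "real \<Rightarrow> real"
  assumes "continuous_on UNIV p"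
  obtains S where "\<And>y. (S has_real_derivative p y) (at y)"
proof (rule that[of "\<lambda>u. LBINT y=0..u. p y"])
  fix x :: real
  define u v where "u = min 0 (x - 1)" and "v = max 0 (x + 1)"
  have "((\<lambda>u. LBINT y=0..u. p y) has_vector_derivative p x) (at x within {u..v})"
    using assms by (intro interval_integral_FTC2[of u 0 v p x, simplified zero_ereal_def[symmetric]])
      (auto simp: u_def v_def elim: continuous_on_subset)
  moreover have "x \<in> interior {u..v}"
    unfolding interior_atLeastAtMost_real by (auto simp: u_def v_def min_less_iff_disj less_max_iff_disj)
  ultimately show "((\<lambda>u. LBINT y=0..u. p y) has_real_derivative p x) (at x)"
    by (simp only: at_within_interior has_real_derivative_iff_has_vector_derivative)
qed

lemma periodic_antiderivative:
  fixes p :: "real \<Rightarrow> real"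
  assumes p: "continuous_on UNIV p" "\<And>y. p (y + 1) = p y" and mean: "integral {0..1} p = 0"
  obtains S where "\<And>y. (S has_real_derivative p y) (at y)" "\<And>y. S (y + 1) = S y"
proof -
  obtain S where S: "\<And>y. (S has_real_derivative p y) (at y)"
    using continuous_antiderivative[OF p(1)] by blast
  have "(p has_integral (S 1 - S 0)) {0..1}"
    using S by (intro fundamental_theorem_of_calculus)
      (auto simp: has_real_derivative_iff_has_vector_derivative[symmetric] intro: has_field_derivative_at_within)
  then have "S 1 = S 0" using mean by (simp add: integral_unique)
  moreover have "\<exists>C. \<forall>y. S (y + 1) - S y = C"
  proof -
    have "((\<lambda>y. S (y + 1) - S y) has_real_derivative 0) (at y)" for y
      using DERIV_diff[OF DERIV_shift[THEN iffD1, OF S[of "y + 1"]] S[of y]] p(2)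
      by simp
    then show ?thesis by (metis DERIV_isconst_all)
  qed
  then obtain C where "\<And>y. S (y + 1) - S y = C" by blast
  ultimately have "S (y + 1) = S y" for y by (metis add_0 eq_iff_diff_eq_0)
  with S show ?thesis by (rule that)
qed

context propagation
begin

text \<open>
  The minimum over \<open>p\<close> of the Hamiltonian \<open>A p\<^sup>2 + B p + \<kappa>\<close>.
\<close>
definition V :: "real \<Rightarrow> real" where "V y = \<kappa> y - (B y)\<^sup>2 / (4 * A y)"

text \<open>
  Half the distance between the two momenta at which the Hamiltonian equals \<open>l\<close>.
\<close>
definition half_gap :: "real \<Rightarrow> real \<Rightarrow> real" where "half_gap l y = sqrt ((l - V y) / A y)"

abbreviation "M \<equiv> M_const A B \<kappa>"
abbreviation "\<gamma> \<equiv> gamma_const A B"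
abbreviation "j \<equiv> j_fun A B \<kappa>"

lemma j_eq: "j l = integral {0..1} (half_gap l)"
  by (simp add: j_fun_def half_gap_def[abs_def] V_def algebra_simps)

lemma A_nonzero: "A y \<noteq> 0" using A_pos[of y] by simp

lemma V_cont: "continuous_on UNIV V"
  unfolding V_def[abs_def] using A_nonzero
  by (intro continuous_intros \<kappa>_cont A_cont B_cont) auto

lemma V_per: "V (y + 1) = V y"
  by (simp add: V_def \<kappa>_per A_per B_per)

lemma half_gap_cont: "continuous_on UNIV (half_gap l)"
  unfolding half_gap_def[abs_def] using A_nonzero
  by (intro continuous_intros V_cont A_cont) auto

lemma half_gap_cont_on: "continuous_on S (half_gap l)"
  using half_gap_cont by (rule continuous_on_subset) simp

lemma half_gap_per: "half_gap l (y + 1) = half_gap l y"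
  by (simp add: half_gap_def V_per A_per)

lemma M_attained: "\<exists>y0. M = V y0" and V_le_M: "V y \<le> M"
proof -
  have "continuous_on {0..1::real} V" using V_cont continuous_on_subset by blast
  then have "\<exists>y0\<in>{0..1}. \<forall>y\<in>{0..1}. V y \<le> V y0"
    by (intro continuous_attains_sup) auto
  then obtain y0 where y0: "\<And>y. y \<in> {0..1} \<Longrightarrow> V y \<le> V y0" by blast
  have le: "V y \<le> V y0" for y
  proof -
    have "V (y + of_int (- \<lfloor>y\<rfloor>) *\<^sub>R 1) = V y" by (rule periodic_add_of_int[of V 1]) (rule V_per)
    then have "V (frac y) = V y" by (simp add: frac_def)
    then show ?thesis using y0[of "frac y"] frac_lt_1[of y] by simp
  qed
  have "M = V y0"
    unfolding M_const_def V_def[symmetric] by (rule cSup_eq_maximum) (use le in auto)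
  then show "\<exists>y0. M = V y0" "V y \<le> M" using le by auto
qed

lemma A_half_gap_squared: "M \<le> l \<Longrightarrow> A y * (half_gap l y)\<^sup>2 = l - V y"
  using V_le_M[of y] A_pos[of y] by (simp add: half_gap_def)

lemma j_strict_mono: "l < l' \<Longrightarrow> j l < j l'"
  unfolding j_eq
proof (rule integral_less_real)
  assume "l < l'"
  then show "half_gap l y < half_gap l' y" for y
    using A_pos[of y] by (simp add: half_gap_def divide_strict_right_mono)
qed (auto intro: half_gap_cont_on)

lemma j_cont: "continuous_on UNIV j"
proof -
  have "continuous_on (UNIV \<times> cbox 0 1) (\<lambda>(l, y). half_gap l y)"
    unfolding half_gap_def case_prod_beta using A_nonzero
    by (intro continuous_intros continuous_on_compose2[OF V_cont, of _ snd]
        continuous_on_compose2[OF A_cont, of _ snd]) auto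
  from integral_continuous_on_param[OF this] show ?thesis
    by (simp add: j_eq[abs_def])
qed

lemma j_unbounded: "\<exists>l\<ge>M. t \<le> j l"
proof -
  obtain K where K: "0 \<le> K" "\<And>y. y \<in> {0..1} \<Longrightarrow> \<bar>A y\<bar> \<le> K"
    using bounded_on_interval[OF A_cont, of 0 1] by blast
  define l where "l = M + K * t\<^sup>2"
  have "integral {0..1::real} (\<lambda>_. \<bar>t\<bar>) \<le> j l"
    unfolding j_eq
  proof (rule integral_le)
    fix y :: real assume "y \<in> {0..1}"
    then have "A y \<le> K" using K(2)[of y] by simp
    then have "A y * t\<^sup>2 \<le> K * t\<^sup>2" by (intro mult_right_mono) auto
    then have "t\<^sup>2 \<le> (l - V y) / A y"
      using V_le_M[of y] A_pos[of y] by (simp add: l_def pos_le_divide_eq mult.commute)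
    then show "\<bar>t\<bar> \<le> half_gap l y" unfolding half_gap_def by (metis real_sqrt_abs real_sqrt_le_mono)
  qed (auto intro!: integrable_continuous_real half_gap_cont_on)
  then have "t \<le> j l" by simp
  moreover have "M \<le> l" using K by (simp add: l_def)
  ultimately show ?thesis by blast
qed

lemma j_bij: "bij_betw j {M..} {j M..}"
proof (rule bij_betw_imageI)
  show "inj_on j {M..}"
    by (rule linorder_inj_onI) (use j_strict_mono in \<open>auto dest: less_imp_neq\<close>)
  show "j ` {M..} = {j M..}"
  proof
    show "j ` {M..} \<subseteq> {j M..}" using j_strict_mono by (force simp: le_less)
    show "{j M..} \<subseteq> j ` {M..}"
    proof
      fix t assume t: "t \<in> {j M..}"
      obtain l where l: "M \<le> l" "t \<le> j l" using j_unbounded by blast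
      have "\<exists>x\<ge>M. x \<le> l \<and> j x = t"
        using t l j_cont by (intro IVT') (auto elim: continuous_on_subset)
      then show "t \<in> j ` {M..}" by auto
    qed
  qed
qed

text \<open>
  The cases \<open>\<theta> = \<plusminus>1\<close> solve the Hamilton-Jacobi equation at level \<open>l\<close>; a factor strictly between
  \<open>-1\<close> and \<open>1\<close> lowers the Hamiltonian wherever \<open>V < l\<close>.
\<close>
definition momentum :: "real \<Rightarrow> real \<Rightarrow> real \<Rightarrow> real" where
  "momentum \<theta> l y = \<theta> * half_gap l y - B y / (2 * A y)"

lemma hamiltonian_momentum:
  assumes "M \<le> l"
  shows "A y * (momentum \<theta> l y)\<^sup>2 + B y * momentum \<theta> l y + \<kappa> y = V y + \<theta>\<^sup>2 * (l - V y)"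
proof -
  have "A y * (momentum \<theta> l y)\<^sup>2 + B y * momentum \<theta> l y = \<theta>\<^sup>2 * (A y * (half_gap l y)\<^sup>2) - (B y)\<^sup>2 / (4 * A y)"
    using A_nonzero[of y] by (simp add: momentum_def power2_eq_square field_simps)
  then show ?thesis using A_half_gap_squared[OF assms, of y] by (simp add: V_def)
qed

lemma momentum_phase:
  assumes "\<theta> * j l = \<gamma>"
  obtains S where "\<And>y. (S has_real_derivative momentum \<theta> l y) (at y)" "\<And>y. S (y + 1) = S y"
    "continuous_on UNIV (momentum \<theta> l)"
proof -
  have cB: "continuous_on UNIV (\<lambda>y. B y / (2 * A y))"
    using A_nonzero by (intro continuous_intros A_cont B_cont) auto
  have cont: "continuous_on UNIV (momentum \<theta> l)"
    unfolding momentum_def[abs_def] by (intro continuous_intros half_gap_cont cB)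
  have int: "(\<lambda>y. B y / (2 * A y)) integrable_on {0..1}" "half_gap l integrable_on {0..1}"
    using cB by (auto intro!: integrable_continuous_real half_gap_cont_on elim: continuous_on_subset)
  have "integral {0..1} (momentum \<theta> l) = \<theta> * j l - \<gamma>"
    unfolding momentum_def[abs_def] j_eq gamma_const_def
    using int by (subst integral_diff) (auto intro!: integrable_continuous_real continuous_intros half_gap_cont_on)
  then have "integral {0..1} (momentum \<theta> l) = 0" using assms by simp
  moreover have "momentum \<theta> l (y + 1) = momentum \<theta> l y" for y
    by (simp add: momentum_def half_gap_per A_per B_per)
  ultimately obtain S where "\<And>y. (S has_real_derivative momentum \<theta> l y) (at y)" "\<And>y. S (y + 1) = S y"
    using periodic_antiderivative[OF cont] by blast
  with cont show ?thesis using that by blast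
qed

lemma eventually_le:
  assumes l: "M < l" and jl: "\<bar>\<gamma>\<bar> < j l"
  shows "\<forall>\<^sub>F \<epsilon> in at_right 0. k \<epsilon> \<le> l"
proof -
  define \<theta> where "\<theta> = \<gamma> / j l"
  have "\<theta> * j l = \<gamma>" using jl by (simp add: \<theta>_def)
  then obtain S where S: "\<And>y. (S has_real_derivative momentum \<theta> l y) (at y)" "\<And>y. S (y + 1) = S y"
    "continuous_on UNIV (momentum \<theta> l)" using momentum_phase by blast
  have "\<bar>\<theta>\<bar> < 1" using jl by (simp add: \<theta>_def)
  then have \<theta>: "\<theta>\<^sup>2 < 1" by (simp add: abs_square_less_1)
  have "\<forall>\<^sub>F \<epsilon> in at_right 0. - 1 * l \<le> - 1 * k \<epsilon>"
  proof (rule eventually_comparison_of_C1_phase[OF S(1,3,2), of _ "(1 - \<theta>\<^sup>2) * (l - M)"])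
    show "0 < (1 - \<theta>\<^sup>2) * (l - M)" using \<theta> l by simp
    show "(1 - \<theta>\<^sup>2) * (l - M) \<le> - 1 * (A y * (momentum \<theta> l y)\<^sup>2 + B y * momentum \<theta> l y + \<kappa> y - l)" for y
    proof -
      have "(1 - \<theta>\<^sup>2) * (l - M) \<le> (1 - \<theta>\<^sup>2) * (l - V y)"
        using \<theta> V_le_M[of y] by (intro mult_left_mono) auto
      also have "\<dots> = - 1 * (V y + \<theta>\<^sup>2 * (l - V y) - l)" by (simp add: algebra_simps)
      finally show ?thesis using hamiltonian_momentum[of l y \<theta>] l by simp
    qed
  qed simp
  then show ?thesis by simp
qed

lemma eventually_ge:
  assumes l: "M \<le> l" and jl: "j l = \<bar>\<gamma>\<bar>" and lam: "lam < l"
  shows "\<forall>\<^sub>F \<epsilon> in at_right 0. lam \<le> k \<epsilon>"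
proof -
  define \<theta> :: real where "\<theta> = (if \<gamma> \<ge> 0 then 1 else - 1)"
  have \<theta>: "\<theta>\<^sup>2 = 1" by (simp add: \<theta>_def)
  have "\<theta> * j l = \<gamma>" using jl by (simp add: \<theta>_def)
  then obtain S where S: "\<And>y. (S has_real_derivative momentum \<theta> l y) (at y)" "\<And>y. S (y + 1) = S y"
    "continuous_on UNIV (momentum \<theta> l)" using momentum_phase by blast
  have "\<forall>\<^sub>F \<epsilon> in at_right 0. 1 * lam \<le> 1 * k \<epsilon>"
    by (rule eventually_comparison_of_C1_phase[OF S(1,3,2), of _ "l - lam"])
       (use lam hamiltonian_momentum[OF l, of _ \<theta>] \<theta> in auto)
  then show ?thesis by simp
qed

lemma eventually_ge_below_M:
  assumes "lam < M"
  shows "\<forall>\<^sub>F \<epsilon> in at_right 0. lam \<le> k \<epsilon>"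
  using M_attained assms eventually_ge_below_pointwise_bound unfolding V_def by metis

lemma tendsto_of_eventual_bounds:
  assumes lower: "\<And>lam. lam < l \<Longrightarrow> \<forall>\<^sub>F \<epsilon> in at_right 0. lam \<le> k \<epsilon>"
    and upper: "\<And>lam. l < lam \<Longrightarrow> \<forall>\<^sub>F \<epsilon> in at_right 0. k \<epsilon> \<le> lam"
  shows "(k \<longlongrightarrow> l) (at_right 0)"
proof (rule order_tendstoI)
  fix u assume "u < l"
  then have "(u + l) / 2 < l" "u < (u + l) / 2" by auto
  then show "\<forall>\<^sub>F \<epsilon> in at_right 0. u < k \<epsilon>"
    using lower[of "(u + l) / 2"] by (auto elim!: eventually_mono)
next
  fix u assume "l < u"
  then have "l < (u + l) / 2" "(u + l) / 2 < u" by auto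
  then show "\<forall>\<^sub>F \<epsilon> in at_right 0. k \<epsilon> < u"
    using upper[of "(u + l) / 2"] by (auto elim!: eventually_mono)
qed

theorem limit_subcritical:
  assumes "\<bar>\<gamma>\<bar> \<le> j M"
  shows "(k \<longlongrightarrow> M) (at_right 0)"
proof (rule tendsto_of_eventual_bounds)
  fix lam assume "M < lam"
  then show "\<forall>\<^sub>F \<epsilon> in at_right 0. k \<epsilon> \<le> lam"
    using assms j_strict_mono[of M lam] by (intro eventually_le) auto
qed (rule eventually_ge_below_M)

theorem limit_supercritical:
  assumes "j M \<le> \<bar>\<gamma>\<bar>"
  shows "(k \<longlongrightarrow> the_inv_into {M..} j \<bar>\<gamma>\<bar>) (at_right 0)"
proof -
  let ?l = "the_inv_into {M..} j \<bar>\<gamma>\<bar>"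
  have img: "\<bar>\<gamma>\<bar> \<in> j ` {M..}" and inj: "inj_on j {M..}"
    using j_bij assms by (auto simp: bij_betw_def)
  have jl: "j ?l = \<bar>\<gamma>\<bar>" by (rule f_the_inv_into_f[OF inj img])
  have Ml: "M \<le> ?l" using the_inv_into_into[OF inj img, of "{M..}"] by simp
  show ?thesis
  proof (rule tendsto_of_eventual_bounds)
    fix lam assume "?l < lam"
    then show "\<forall>\<^sub>F \<epsilon> in at_right 0. k \<epsilon> \<le> lam"
      using Ml jl j_strict_mono[of ?l lam] by (intro eventually_le) auto
  qed (rule eventually_ge[OF Ml jl])
qed

end

section \<open>Convergence of the principal eigenvalue\<close>

lemma holder_space_subset:
  "holder_space k \<alpha> S f \<Longrightarrow> T \<subseteq> S \<Longrightarrow> holder_space k \<alpha> T f"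
proof (induction k arbitrary: f)
  case 0
  then show ?case by (fastforce simp: subset_iff)
next
  case (Suc k)
  obtain D where D:
    "\<And>x. x \<in> S \<Longrightarrow> (f has_derivative (\<lambda>h. \<Sum>e\<in>Basis. (h \<bullet> e) *\<^sub>R D e x)) (at x within S)"
    "\<And>e. e \<in> Basis \<Longrightarrow> holder_space k \<alpha> S (D e)"
    using holder_space_Suc_D[OF Suc.prems(1)] by blast
  have "(f has_derivative (\<lambda>h. \<Sum>e\<in>Basis. (h \<bullet> e) *\<^sub>R D e x)) (at x within T)" if "x \<in> T" for x
    using D(1) that Suc.prems(2) has_derivative_subset by blast
  moreover have "holder_space k \<alpha> T (D e)" if "e \<in> Basis" for e
    using Suc.IH[OF D(2)[OF that] Suc.prems(2)] .
  ultimately show ?case unfolding holder_space.simps(2) by blast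
qed

lemma holder_space_Suc_real:
  fixes f :: "real \<Rightarrow> real"
  assumes "holder_space (Suc k) \<alpha> UNIV f" "0 < \<alpha>"
  obtains f' where "\<And>y. (f has_real_derivative f' y) (at y)" "continuous_on UNIV f'"
proof -
  obtain D where D:
    "\<And>x. x \<in> UNIV \<Longrightarrow> (f has_derivative (\<lambda>h. \<Sum>e\<in>Basis. (h \<bullet> e) *\<^sub>R D e x)) (at x within UNIV)"
    "\<And>e. e \<in> Basis \<Longrightarrow> holder_space k \<alpha> UNIV (D e)"
    using holder_space_Suc_D[OF assms(1)] by blast
  show ?thesis
  proof (rule that[of "D 1"])
    show "(f has_real_derivative D 1 y) (at y)" for y
      using D(1)[of y] by (simp add: has_field_derivative_def mult_commute_abs)
    show "continuous_on UNIV (D 1)"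
      using D(2)[of 1] assms(2) by (intro holder_space_continuous_on) auto
  qed
qed

lemma holder_space_2_differentiable:
  assumes "holder_space 2 \<alpha> S f" "x \<in> S"
  shows "f differentiable (at x within S)"
  using assms unfolding numeral_2_eq_2 holder_space.simps(2) differentiable_def by blast

context cross_section
begin

lemma global_eigenpair_imp_cyl_solution:
  assumes "global_eigenpair \<alpha> Z A a B b c \<epsilon> \<phi> k"
  shows "cyl_solution A B \<epsilon> c k \<phi>"
proof -
  let ?W = "UNIV \<times> \<Omega> :: (real \<times> (real^'n)) set"
  have cl: "closure ?W = UNIV \<times> closure \<Omega>" by (simp add: closure_Times)
  have hol: "holder_space 2 \<alpha> (closure ?W) \<phi>" and per: "periodic_cyl Z \<phi>"
    and eq: "\<And>y z. z \<in> \<Omega> \<Longrightarrow> L_y A B \<epsilon> (\<lambda>s. \<phi> (s, z)) y + L_z a b (\<lambda>x. \<phi> (y, x)) z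
        + c (y, z) * \<phi> (y, z) = k * \<phi> (y, z)"
    and pos: "\<And>y z. z \<in> \<Omega> \<Longrightarrow> 0 < \<phi> (y, z)"
    and bc: "\<And>w \<nu>. outward_unit_normal ?W w \<nu> \<Longrightarrow>
        \<nu> \<bullet> block_diag_mult A a w (gradient \<phi> (at w within closure ?W)) = 0"
    using assms unfolding global_eigenpair_def Let_def by auto
  have "neumann_field \<phi>"
    unfolding neumann_field_def
  proof (intro conjI allI impI)
    have "open ?W" using open_\<Omega> by (intro open_Times) auto
    moreover have "holder_space 2 \<alpha> ?W \<phi>" using hol by (rule holder_space_subset) (rule closure_subset)
    ultimately show "\<exists>G H. jet2 ?W \<phi> G H" using holder_space_2_jet2 by blast
    show "continuous_on (UNIV \<times> closure \<Omega>) \<phi>"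
      using holder_space_continuous_on[OF hol \<alpha>_pos] by (simp add: cl)
    show "periodic_section Z (\<lambda>z. \<phi> (y, z))" for y using per by (simp add: periodic_cyl_def)
    fix y :: real and z \<nu> assume \<nu>: "outward_unit_normal \<Omega> z \<nu>"
    then have "z \<in> closure \<Omega>" by (simp add: outward_unit_normal_def frontier_def)
    then have "(y, z) \<in> closure ?W" by (simp add: cl)
    from has_derivative_gradient_within[OF holder_space_2_differentiable[OF hol this]]
      bc[OF outward_unit_normal_cylinder[OF \<nu>, of y]]
    show "\<exists>g. (\<phi> has_derivative (\<lambda>h. g \<bullet> h)) (at (y, z) within UNIV \<times> closure \<Omega>) \<and>
        \<nu> \<bullet> (a z *v snd g) = 0"
      unfolding cl by (auto simp: block_diag_mult_def inner_prod_def)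
  qed
  moreover have "L_y A B \<epsilon> (\<lambda>s. \<phi> (s, z)) y + L_z a b (\<lambda>x. \<phi> (y, x)) z = (k - c (y, z)) * \<phi> (y, z)"
    if "z \<in> \<Omega>" for y z
    using eq[OF that, of y] by (simp add: left_diff_distrib)
  ultimately show ?thesis using pos by (simp add: cyl_solution_def)
qed

lemma local_eigenpair_imp_section_solution:
  assumes "local_eigenpair \<alpha> Z a b c y \<psi> k"
  shows "section_solution (\<lambda>z. c (y, z)) k \<psi>"
proof -
  have hol: "holder_space 2 \<alpha> (closure \<Omega>) \<psi>" and per: "periodic_section Z \<psi>"
    and eq: "\<And>z. z \<in> \<Omega> \<Longrightarrow> L_z a b \<psi> z + c (y, z) * \<psi> z = k * \<psi> z"
    and pos: "\<And>z. z \<in> \<Omega> \<Longrightarrow> 0 < \<psi> z"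
    and bc: "\<And>z \<nu>. outward_unit_normal \<Omega> z \<nu> \<Longrightarrow>
        \<nu> \<bullet> (a z *v gradient \<psi> (at z within closure \<Omega>)) = 0"
    using assms unfolding local_eigenpair_def by auto
  have "section_field \<psi>"
    unfolding section_field_def
  proof (intro conjI allI impI)
    have "holder_space 2 \<alpha> \<Omega> \<psi>" using hol by (rule holder_space_subset) (rule closure_subset)
    then show "\<exists>G H. jet2 \<Omega> \<psi> G H" using holder_space_2_jet2[OF open_\<Omega>] by blast
    show "continuous_on (closure \<Omega>) \<psi>" by (rule holder_space_continuous_on[OF hol \<alpha>_pos])
    show "periodic_section Z \<psi>" by (rule per)
    fix z \<nu> assume \<nu>: "outward_unit_normal \<Omega> z \<nu>"
    then have "z \<in> closure \<Omega>" by (simp add: outward_unit_normal_def frontier_def)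
    from has_derivative_gradient_within[OF holder_space_2_differentiable[OF hol this]] bc[OF \<nu>]
    show "\<exists>g. (\<psi> has_derivative (\<lambda>h. g \<bullet> h)) (at z within closure \<Omega>) \<and> \<nu> \<bullet> (a z *v g) = 0"
      by blast
  qed
  moreover have "L_z a b \<psi> z = (k - c (y, z)) * \<psi> z" if "z \<in> \<Omega>" for z
    using eq[OF that] by (simp add: left_diff_distrib)
  ultimately show ?thesis using pos by (simp add: section_solution_def)
qed

lemma periodic_cyl_bounded:
  assumes per: "periodic_cyl Z c" and cont: "continuous_on (UNIV \<times> closure \<Omega>) c"
  obtains C :: real where "\<And>y z. z \<in> closure \<Omega> \<Longrightarrow> \<bar>c (y, z)\<bar> \<le> C"
proof -
  obtain K where K: "compact K" "K \<subseteq> closure \<Omega>"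
    and rep: "\<And>z. z \<in> closure \<Omega> \<Longrightarrow> \<exists>z'\<in>K. \<forall>f :: real^'n \<Rightarrow> real. periodic_section Z f \<longrightarrow> f z' = f z"
    using compact_representatives by metis
  have "compact ({0..1::real} \<times> K)" using K by (intro compact_Times) auto
  moreover have "continuous_on ({0..1} \<times> K) c" using cont K by (auto elim!: continuous_on_subset)
  ultimately obtain C where C: "\<And>p. p \<in> {0..1} \<times> K \<Longrightarrow> \<bar>c p\<bar> \<le> C"
    by (rule compact_continuous_bound) blast
  show ?thesis
  proof (rule that[of C])
    fix y z assume z: "z \<in> closure \<Omega>"
    have "c (y + of_int (- \<lfloor>y\<rfloor>) *\<^sub>R 1, z) = c (y, z)"
      using per z by (intro periodic_add_of_int[of "\<lambda>y. c (y, z)" 1]) (auto simp: periodic_cyl_def periodic1_def)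
    then have y: "c (frac y, z) = c (y, z)" by (simp add: frac_def)
    obtain z' where z': "z' \<in> K" "c (frac y, z') = c (frac y, z)"
      using rep[OF z] per unfolding periodic_cyl_def by blast
    have "(frac y, z') \<in> {0..1} \<times> K" using z' frac_lt_1[of y] by (auto intro: less_imp_le)
    from C[OF this] show "\<bar>c (y, z)\<bar> \<le> C" using y z' by simp
  qed
qed

end

theorem theorem1p3:
  fixes \<alpha> :: real
    and Z :: "(real^'n) section_space"
    and A B :: "real \<Rightarrow> real"
    and a :: "real^'n \<Rightarrow> real^'n^'n"
    and b :: "real^'n \<Rightarrow> real^'n"
    and c :: "real \<times> (real^'n) \<Rightarrow> real"
    and \<phi> :: "real \<Rightarrow> real \<times> (real^'n) \<Rightarrow> real" and k\<epsilon> :: "real \<Rightarrow> real"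
    and \<psi> :: "real \<Rightarrow> real^'n \<Rightarrow> real" and \<kappa> :: "real \<Rightarrow> real"
  assumes "0 < \<alpha>" and "\<alpha> < 1"
    and "admissible_section \<alpha> Z"
    and "periodic1 A" and "holder_space 2 \<alpha> UNIV A"
    and "\<exists>lo hi. 0 < lo \<and> lo < hi \<and> (\<forall>y. lo \<le> A y \<and> A y \<le> hi)"
    and "periodic_section Z a" and "holder_space 2 \<alpha> (closure (lift Z)) a"
    and "\<forall>z\<in>closure (lift Z). transpose (a z) = a z"
    and "\<exists>lo hi. 0 < lo \<and> lo < hi \<and>
           (\<forall>z\<in>closure (lift Z). \<forall>\<xi>. lo * (norm \<xi>)\<^sup>2 \<le> \<xi> \<bullet> (a z *v \<xi>) \<and>
                                        \<xi> \<bullet> (a z *v \<xi>) \<le> hi * (norm \<xi>)\<^sup>2)"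
    and "periodic1 B" and "holder_space 1 \<alpha> UNIV B"
    and "periodic_section Z b" and "holder_space 1 \<alpha> (closure (lift Z)) b"
    and "periodic_cyl Z c" and "\<exists>L. L-lipschitz_on (closure (UNIV \<times> lift Z)) c"
    and "\<forall>w \<nu>. outward_unit_normal (UNIV \<times> lift Z) w \<nu> \<longrightarrow> (B (fst w), b (snd w)) \<bullet> \<nu> = 0"
    and "\<forall>\<epsilon>>0. global_eigenpair \<alpha> Z A a B b c \<epsilon> (\<phi> \<epsilon>) (k\<epsilon> \<epsilon>)"
    and "\<forall>y. local_eigenpair \<alpha> Z a b c y (\<psi> y) (\<kappa> y)"
  shows "let M = M_const A B \<kappa>; \<gamma> = gamma_const A B; j = j_fun A B \<kappa> in
      (\<exists>y0. M = \<kappa> y0 - (B y0)\<^sup>2 / (4 * A y0)) \<and>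
      (\<forall>y. \<kappa> y - (B y)\<^sup>2 / (4 * A y) \<le> M) \<and>
      bij_betw j {M..} {j M..} \<and>
      (\<exists>l. (k\<epsilon> \<longlongrightarrow> l) (at_right 0)) \<and>
      (\<bar>\<gamma>\<bar> \<le> j M \<longrightarrow> (k\<epsilon> \<longlongrightarrow> M) (at_right 0)) \<and>
      (\<bar>\<gamma>\<bar> \<ge> j M \<longrightarrow> (k\<epsilon> \<longlongrightarrow> the_inv_into {M..} j \<bar>\<gamma>\<bar>) (at_right 0))"
proof -
  obtain lo where lo: "0 < lo" "\<And>y. lo \<le> A y" using assms(6) by blast
  obtain m where m: "0 < m" "\<And>z \<xi>. z \<in> closure (lift Z) \<Longrightarrow> m * (norm \<xi>)\<^sup>2 \<le> \<xi> \<bullet> (a z *v \<xi>)"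
    using assms(10) by blast
  interpret cross_section \<alpha> Z a b m
    by unfold_locales (use assms m in auto)
  obtain A' where A': "\<And>y. (A has_real_derivative A' y) (at y)" "continuous_on UNIV A'"
    using holder_space_Suc_real[of "Suc 0" \<alpha> A] assms(1,5) by (auto simp only: numeral_2_eq_2)
  obtain B' where B': "\<And>y. (B has_real_derivative B' y) (at y)" "continuous_on UNIV B'"
    using holder_space_Suc_real[of 0 \<alpha> B] assms(1,12) by (auto simp only: One_nat_def)
  obtain L where L: "L-lipschitz_on (UNIV \<times> closure \<Omega>) c" using assms(16) by (auto simp: closure_Times)
  obtain C where C: "\<And>y z. z \<in> closure \<Omega> \<Longrightarrow> \<bar>c (y, z)\<bar> \<le> C"
    using periodic_cyl_bounded[OF assms(15) lipschitz_on_continuous_on[OF L]] by blast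
  interpret propagation \<alpha> Z a b m A A' B B' lo c C L \<phi> k\<epsilon> \<psi> \<kappa>
  proof unfold_locales
    show "\<bar>c (y, z) - c (y', z)\<bar> \<le> L * \<bar>y - y'\<bar>" if "z \<in> closure \<Omega>" for y y' z
      using lipschitz_onD[OF L, of "(y, z)" "(y', z)"] that by (simp add: dist_Pair_Pair dist_real_def)
    show "cyl_solution A B \<epsilon> c (k\<epsilon> \<epsilon>) (\<phi> \<epsilon>)" if "0 < \<epsilon>" for \<epsilon>
      using assms(18) that by (intro global_eigenpair_imp_cyl_solution) auto
    show "section_solution (\<lambda>z. c (y, z)) (\<kappa> y) (\<psi> y)" for y
      using assms(19) by (intro local_eigenpair_imp_section_solution) auto
    show "\<phi> \<epsilon> (y + 1, z) = \<phi> \<epsilon> (y, z)" if "0 < \<epsilon>" "z \<in> closure \<Omega>" for \<epsilon> y z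
      using assms(18) that unfolding global_eigenpair_def Let_def periodic_cyl_def periodic1_def by blast
    show "c (y + 1, z) = c (y, z)" if "z \<in> closure \<Omega>" for y z
      using assms(15) that unfolding periodic_cyl_def periodic1_def by blast
  qed (use A' B' lo C assms(4,11) in \<open>auto simp: periodic1_def\<close>)
  have "\<exists>l. (k\<epsilon> \<longlongrightarrow> l) (at_right 0)"
    using limit_subcritical limit_supercritical by (meson linear)
  then show ?thesis
    unfolding Let_def
    using M_attained V_le_M j_bij limit_subcritical limit_supercritical by (simp add: V_def)
qed

end
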